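(* Let $n\ge 3$ be an integer, let $l,r$ be nonzero complex numbers, and assume that $(r^2)^k\neq 1$ for every $k\in\{1,\dots,n\}$. Suppose that the Lawrence-Krammer representation of $B(A_{n-1})$ on $\mathcal V^{(n)}$ is reducible. Then $\mathcal V^{(n)}$ has a unique nonzero proper invariant subspace, except when $l=-r^3$ and $r^{2n}=-1$; in this exceptional case, $\mathcal V^{(n)}$ contains a direct sum of a one-dimensional invariant subspace and an irreducible $\frac{(n-1)(n-2)}{2}$-dimensional invariant subspace.
   Context: Let $l,r$ be nonzero complex numbers with $r^2\ne1$, $m=\frac1r-r$ and $F=\mathbb{Q}(l,r)\subset\mathbb{C}$. The BMW algebra $B(A_{n-1})$ is the unital associative $F$-algebra generated by invertible elements $g_1,\dots,g_{n-1}$, with $e_i:=\frac{l}{m}(g_i^2+m g_i-1)$, subject to: $g_ig_j=g_jg_i$ for $|i-j|\ge2$; $g_ig_{i+1}g_i=g_{i+1}g_ig_{i+1}$; $g_ie_i=l^{-1}e_i$; $e_ig_{i+1}e_i=l e_i$; $e_ig_{i-1}e_i=l e_i$ (whenever the indices make sense). The Lawrence-Krammer space $\mathcal V^{(n)}$ is the $F$-vector space with basis $\{w_{ij}:1\le i<j\le n\}$. The Lawrence-Krammer representation makes it a $B(A_{n-1})$-module, $g_k$ acting by the endomorphism $\nu_k$ defined, for $1\le k\le n-1$, by: - $\nu_k(w_{ij})=r\,w_{ij}$ if $\{i,j\}\cap\{k,k+1\}=\emptyset$; - $\nu_k(w_{k,k+1})=l^{-1}w_{k,k+1}$; - $\nu_k(w_{k,j})=w_{k+1,j}$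 for $j\ge k+2$; - $\nu_k(w_{k+1,j})=w_{k,j}+m\,r^{j-k-2}\,w_{k,k+1}-m\,w_{k+1,j}$ for $j\ge k+2$; - $\nu_k(w_{i,k})=w_{i,k+1}$ for $i\le k-1$; - $\nu_k(w_{i,k+1})=w_{i,k}+\frac{m}{l\,r^{k-1-i}}\,w_{k,k+1}-m\,w_{i,k+1}$ for $i\le k-1$. Invariant subspaces are $F$-subspaces stable under $B(A_{n-1})$; an invariant subspace is irreducible if it is nonzero and contains no invariant subspaces other than $0$ and itself; the representation is reducible if $\mathcal V^{(n)}$ is not irreducible; dimensions are over $F$. *)

theory Defs
  imports
    Complex_Main
    "HOL-Algebra.Generated_Fields"
    "HOL-Algebra.QuotRing"
    "HOL-Library.Poly_Mapping"
    "Jordan_Normal_Form.VS_Connect"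
begin

definition m_param :: "complex \<Rightarrow> complex" where
  "m_param r = 1 / r - r"

definition base_field :: "complex \<Rightarrow> complex \<Rightarrow> complex set" where
  "base_field l r = generate_field class_ring {l, r}"

definition base_ring :: "complex \<Rightarrow> complex \<Rightarrow> complex ring" where
  "base_ring l r = class_ring\<lparr>carrier := base_field l r\<rparr>"


section \<open>The BMW algebra\<close>

text \<open>The letter \<open>Ginv i\<close> becomes the inverse of \<open>G i\<close> in the quotient. Words form a
  free monoid, written additively because \<^type>\<open>poly_mapping\<close> multiplies by convolution over an
  additive monoid: \<open>gword \<Rightarrow>\<^sub>0 complex\<close> is then the free associative algebra on all letters.\<close>

datatype letter = G nat | Ginv nat

fun letter_index :: "letter \<Rightarrow> nat" where
  "letter_index (G i) = i"
| "letter_index (Ginv i) = i"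

datatype gword = Gword (letters: "letter list")

instantiation gword :: monoid_add
begin

definition "0 = Gword []"

definition "u + v = Gword (letters u @ letters v)"

instance
  by standard (simp_all add: zero_gword_def plus_gword_def)

end

definition free_alg :: "nat \<Rightarrow> complex \<Rightarrow> complex \<Rightarrow> (gword \<Rightarrow>\<^sub>0 complex) ring" where
  "free_alg n l r =
    \<lparr>carrier = {a. \<forall>u\<in>Poly_Mapping.keys a.
        Poly_Mapping.lookup a u \<in> base_field l r \<and> letter_index ` set (letters u) \<subseteq> {1..n - 1}},
     mult = (*), one = 1, zero = 0, add = (+)\<rparr>"

definition const :: "complex \<Rightarrow> gword \<Rightarrow>\<^sub>0 complex" where
  "const c = Poly_Mapping.single 0 c"

definition gen :: "nat \<Rightarrow> gword \<Rightarrow>\<^sub>0 complex" where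
  "gen i = Poly_Mapping.single (Gword [G i]) 1"

definition gen_inv :: "nat \<Rightarrow> gword \<Rightarrow>\<^sub>0 complex" where
  "gen_inv i = Poly_Mapping.single (Gword [Ginv i]) 1"

definition bmw_e :: "complex \<Rightarrow> complex \<Rightarrow> nat \<Rightarrow> gword \<Rightarrow>\<^sub>0 complex" where
  "bmw_e l r i = const (l / m_param r) * (gen i * gen i + const (m_param r) * gen i - 1)"

text \<open>A relation \<open>a = b\<close> is recorded as the element \<open>a - b\<close>.\<close>

definition bmw_relations :: "nat \<Rightarrow> complex \<Rightarrow> complex \<Rightarrow> (gword \<Rightarrow>\<^sub>0 complex) set" where
  "bmw_relations n l r =
     {gen i * gen_inv i - 1 | i. i \<in> {1..n - 1}} \<union>
     {gen_inv i * gen i - 1 | i. i \<in> {1..n - 1}} \<union>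
     {gen i * gen j - gen j * gen i | i j.
        i \<in> {1..n - 1} \<and> j \<in> {1..n - 1} \<and> (i + 2 \<le> j \<or> j + 2 \<le> i)} \<union>
     {gen i * gen (i + 1) * gen i - gen (i + 1) * gen i * gen (i + 1) | i.
        i \<in> {1..n - 1} \<and> i + 1 \<in> {1..n - 1}} \<union>
     {gen i * bmw_e l r i - const (1 / l) * bmw_e l r i | i. i \<in> {1..n - 1}} \<union>
     {bmw_e l r i * gen (i + 1) * bmw_e l r i - const l * bmw_e l r i | i.
        i \<in> {1..n - 1} \<and> i + 1 \<in> {1..n - 1}} \<union>
     {bmw_e l r i * gen (i - 1) * bmw_e l r i - const l * bmw_e l r i | i.
        i \<in> {1..n - 1} \<and> i - 1 \<in> {1..n - 1}}"

text \<open>The algebra \<open>B(A\<^bsub>n-1\<^esub>)\<close>. The scalars of \<^const>\<open>base_field\<close> enter as constants of the free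
  algebra, so every two-sided ring ideal is also a linear subspace.\<close>

definition bmw :: "nat \<Rightarrow> complex \<Rightarrow> complex \<Rightarrow> (gword \<Rightarrow>\<^sub>0 complex) set ring" where
  "bmw n l r = free_alg n l r Quot (Idl\<^bsub>free_alg n l r\<^esub> (bmw_relations n l r))"


section \<open>The Lawrence-Krammer representation\<close>

definition pairs :: "nat \<Rightarrow> (nat \<times> nat) set" where
  "pairs n = {(i, j). 1 \<le> i \<and> i < j \<and> j \<le> n}"

definition lk_space ::
    "nat \<Rightarrow> complex \<Rightarrow> complex \<Rightarrow> (complex, nat \<times> nat \<Rightarrow> complex) module" where
  "lk_space n l r = LinearCombinations.ring.func_space (base_ring l r) (pairs n)"

definition lk_basis :: "nat \<Rightarrow> nat \<Rightarrow> nat \<Rightarrow> (nat \<times> nat \<Rightarrow> complex)" where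
  "lk_basis n i j = (\<lambda>p\<in>pairs n. if p = (i, j) then 1 else 0)"

text \<open>The image of the basis vector \<open>w\<^sub>i\<^sub>j\<close> under \<open>\<nu>\<^sub>k\<close>. Given \<open>i < j\<close>, the third branch has
  \<open>j \<ge> k + 2\<close>, the fourth likewise, the fifth has \<open>i \<le> k - 1\<close>, and the last has \<open>j = k + 1\<close> and
  \<open>i \<le> k - 1\<close>; hence no exponent is truncated.\<close>

definition nu_basis ::
    "nat \<Rightarrow> complex \<Rightarrow> complex \<Rightarrow> nat \<Rightarrow> nat \<times> nat \<Rightarrow> (nat \<times> nat \<Rightarrow> complex)" where
  "nu_basis n l r k = (\<lambda>(i, j).
    let V = lk_space n l r; w = lk_basis n; m = m_param r in
    if {i, j} \<inter> {k, k + 1} = {} then r \<odot>\<^bsub>V\<^esub> w i j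
    else if i = k \<and> j = k + 1 then (1 / l) \<odot>\<^bsub>V\<^esub> w k (k + 1)
    else if i = k then w (k + 1) j
    else if i = k + 1 then
      w k j \<oplus>\<^bsub>V\<^esub> (m * r ^ (j - k - 2)) \<odot>\<^bsub>V\<^esub> w k (k + 1) \<oplus>\<^bsub>V\<^esub> (- m) \<odot>\<^bsub>V\<^esub> w (k + 1) j
    else if j = k then w i (k + 1)
    else
      w i k \<oplus>\<^bsub>V\<^esub> (m / (l * r ^ (k - 1 - i))) \<odot>\<^bsub>V\<^esub> w k (k + 1) \<oplus>\<^bsub>V\<^esub> (- m) \<odot>\<^bsub>V\<^esub> w i (k + 1))"

definition nu ::
    "nat \<Rightarrow> complex \<Rightarrow> complex \<Rightarrow> nat \<Rightarrow> (nat \<times> nat \<Rightarrow> complex) \<Rightarrow> (nat \<times> nat \<Rightarrow> complex)" where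
  "nu n l r k v =
     (\<Oplus>\<^bsub>lk_space n l r\<^esub>p\<in>pairs n. v p \<odot>\<^bsub>lk_space n l r\<^esub> nu_basis n l r k p)"

fun letter_act ::
    "nat \<Rightarrow> complex \<Rightarrow> complex \<Rightarrow> letter \<Rightarrow> (nat \<times> nat \<Rightarrow> complex) \<Rightarrow> (nat \<times> nat \<Rightarrow> complex)" where
  "letter_act n l r (G k) = nu n l r k"
| "letter_act n l r (Ginv k) = inv_into (carrier (lk_space n l r)) (nu n l r k)"

definition free_act :: "nat \<Rightarrow> complex \<Rightarrow> complex \<Rightarrow> (gword \<Rightarrow>\<^sub>0 complex) \<Rightarrow>
    (nat \<times> nat \<Rightarrow> complex) \<Rightarrow> (nat \<times> nat \<Rightarrow> complex)" where
  "free_act n l r a v =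
     (\<Oplus>\<^bsub>lk_space n l r\<^esub>u\<in>Poly_Mapping.keys a.
        Poly_Mapping.lookup a u \<odot>\<^bsub>lk_space n l r\<^esub> foldr (letter_act n l r) (letters u) v)"

text \<open>The action of an element of the quotient algebra, which is a coset \<open>X\<close>. The maps \<open>\<nu>\<^sub>k\<close> are
  bijective and satisfy the defining relations, so all members of \<open>X\<close> act in the same way.\<close>

definition lk_rep :: "nat \<Rightarrow> complex \<Rightarrow> complex \<Rightarrow> (gword \<Rightarrow>\<^sub>0 complex) set \<Rightarrow>
    (nat \<times> nat \<Rightarrow> complex) \<Rightarrow> (nat \<times> nat \<Rightarrow> complex)" where
  "lk_rep n l r X v = the_elem ((\<lambda>a. free_act n l r a v) ` X)"

definition lk_invariant ::
    "nat \<Rightarrow> complex \<Rightarrow> complex \<Rightarrow> (nat \<times> nat \<Rightarrow> complex) set \<Rightarrow> bool" where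
  "lk_invariant n l r W \<longleftrightarrow>
     VectorSpace.subspace (base_ring l r) W (lk_space n l r) \<and>
     (\<forall>X\<in>carrier (bmw n l r). \<forall>v\<in>W. lk_rep n l r X v \<in> W)"

definition lk_irreducible ::
    "nat \<Rightarrow> complex \<Rightarrow> complex \<Rightarrow> (nat \<times> nat \<Rightarrow> complex) set \<Rightarrow> bool" where
  "lk_irreducible n l r W \<longleftrightarrow>
     lk_invariant n l r W \<and> W \<noteq> {\<zero>\<^bsub>lk_space n l r\<^esub>} \<and>
     (\<forall>U. lk_invariant n l r U \<and> U \<subseteq> W \<longrightarrow> U = {\<zero>\<^bsub>lk_space n l r\<^esub>} \<or> U = W)"

definition lk_reducible :: "nat \<Rightarrow> complex \<Rightarrow> complex \<Rightarrow> bool" where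
  "lk_reducible n l r \<longleftrightarrow> \<not> lk_irreducible n l r (carrier (lk_space n l r))"

definition lk_dim ::
    "nat \<Rightarrow> complex \<Rightarrow> complex \<Rightarrow> (nat \<times> nat \<Rightarrow> complex) set \<Rightarrow> nat" where
  "lk_dim n l r W = vectorspace.dim (base_ring l r) ((lk_space n l r)\<lparr>carrier := W\<rparr>)"

end

theory Submission
  imports Defs "HOL-Library.Function_Algebras"
begin

text \<open>Each \<open>e\<^sub>k\<close> has rank one with image spanned by \<open>w\<^bsub>k,k+1\<^esub>\<close>, and each \<open>w\<^bsub>k,k+1\<^esub>\<close> generates the whole space. Hence
  every proper invariant subspace is killed by all \<open>e\<^sub>k\<close>, the sum \<open>K\<close> of two of them is again proper,
  and on \<open>K\<close> the operators satisfy \<open>(g - r) (g + 1/r) = 0\<close>.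

  The \<open>(-1/r)\<close>-eigenspace of \<open>g\<^sub>1\<close> is small: under \<open>g\<^sub>3, \<dots>, g\<^bsub>n-1\<^esub>\<close> it is the permutation module of
  dimension \<open>n - 2\<close>. The condition \<open>e\<^sub>2 = 0\<close> cuts its intersection with \<open>K\<close> down to the trivial line, or, for
  \<open>l = r\<close>, to the standard summand; for \<open>l = - r\<^sup>3\<close> every nonzero vector of it generates all of it. So
  this intersection is contained in every invariant subspace \<open>U\<close> of \<open>K\<close> which meets it. By conjugation the
  same holds for all \<open>g\<^sub>k\<close>, so all \<open>g\<^sub>k - r\<close> map \<open>K\<close> into \<open>U\<close>, and averaging over cosets gives
  \<open>K = U + K\<^sup>t\<close>, where \<open>K\<^sup>t\<close> is the part on which all \<open>g\<^sub>k\<close> are \<open>r\<close>. That part is nonzero only for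
  \<open>l = r\<^bsup>3-2n\<^esup>\<close>, and then it is a line equal to \<open>K\<close> unless \<open>l = - r\<^sup>3\<close>.\<close>

section \<open>The operators in coordinates\<close>

text \<open>Uniqueness amounts to showing that \<open>K\<close>, the sum of two nonzero proper
  invariant subspaces, has no nonzero invariant subspace but itself. Existence is just reducibility,
  so the parameters of reducibility never have to be determined. Simplicity of \<open>K\<close>
  would normally come from the modules of a semisimple Hecke algebra; here linear algebra inside one
  eigenspace replaces it, and besides r^2 being different from 1 the hypothesis on r enters only as
  the nonvanishing of the q-integers [k] = (1 - r^(2k)) / (1 - r^2) for k up to n. The value l = -
  r^3 is special because \<open>phi 2\<close> then vanishes on all of \<open>eig 1\<close>: nothing
  bounds the intersection from above, so it has to be generated from below. If moreover r^(2n) = -1,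
  this l equals r^(3-2n), so the trivial line and the kernel of a boundary map are both invariant,
  and uniqueness fails.\<close>

locale lk =
  fixes F :: "complex set" and n :: nat and l r :: complex
  assumes zero_F [simp]: "0 \<in> F" and one_F [simp]: "1 \<in> F"
    and add_F [simp]: "\<And>a b. a \<in> F \<Longrightarrow> b \<in> F \<Longrightarrow> a + b \<in> F"
    and minus_F [simp]: "\<And>a. a \<in> F \<Longrightarrow> - a \<in> F"
    and mult_F [simp]: "\<And>a b. a \<in> F \<Longrightarrow> b \<in> F \<Longrightarrow> a * b \<in> F"
    and inverse_F [simp]: "\<And>a. a \<in> F \<Longrightarrow> inverse a \<in> F"
    and l_F [simp]: "l \<in> F" and r_F [simp]: "r \<in> F"
    and n_ge_3: "n \<ge> 3" and l_neq_0 [simp]: "l \<noteq> 0" and r_neq_0 [simp]: "r \<noteq> 0" and r_sq_neq_1: "r\<^sup>2 \<noteq> 1"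
begin

definition m where "m = m_param r"

lemma m_alt: "m = 1 / r - r" by (simp add: m_def m_param_def)

lemma m_neq_0 [simp]: "m \<noteq> 0" using r_sq_neq_1 by (simp add: m_alt power2_eq_square field_simps)

lemma diff_F [simp]: "a \<in> F \<Longrightarrow> b \<in> F \<Longrightarrow> a - b \<in> F"
  using add_F[of a "- b"] by simp

lemma divide_F [simp]: "a \<in> F \<Longrightarrow> b \<in> F \<Longrightarrow> a / b \<in> F"
  by (simp add: divide_inverse)

lemma power_F [simp]: "a \<in> F \<Longrightarrow> a ^ k \<in> F"
  by (induction k) auto

lemma sum_F [simp]: "(\<And>x. x \<in> X \<Longrightarrow> f x \<in> F) \<Longrightarrow> sum f X \<in> F"
  by (induction X rule: infinite_finite_induct) auto

lemma m_F [simp]: "m \<in> F" by (simp add: m_alt)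

definition scl :: "complex \<Rightarrow> (nat \<times> nat \<Rightarrow> complex) \<Rightarrow> nat \<times> nat \<Rightarrow> complex"
  where "scl c v = (\<lambda>p. c * v p)"

lemma scl_apply [simp]: "scl c v p = c * v p" by (simp add: scl_def)

lemma scl_simps:
  "scl c (u + v) = scl c u + scl c v" "scl c (u - v) = scl c u - scl c v"
  "scl (a + b) v = scl a v + scl b v" "scl (a - b) v = scl a v - scl b v"
  "scl a (scl b v) = scl (a * b) v" "scl 1 v = v" "scl 0 v = 0" "scl c 0 = 0" "scl c (- v) = - scl c v"
  by (auto simp: fun_eq_iff algebra_simps)

lemma sum_fun_apply:
  fixes f :: "'a \<Rightarrow> nat \<times> nat \<Rightarrow> complex"
  shows "(sum f X) p = (\<Sum>x\<in>X. f x p)"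
  by (induction X rule: infinite_finite_induct) auto

definition w :: "nat \<Rightarrow> nat \<Rightarrow> nat \<times> nat \<Rightarrow> complex" where
  "w i j = (\<lambda>p. if p = (i, j) then 1 else 0)"

text \<open>A stand-in for the carrier of \<open>lk_space\<close>, whose elements are
  \<open>undefined\<close> off \<open>pairs n\<close>. With zero there instead, sums and scalings
  are pointwise on the whole function type.\<close>

definition H :: "(nat \<times> nat \<Rightarrow> complex) set" where
  "H = {v. (\<forall>p. v p \<in> F) \<and> (\<forall>p. p \<notin> pairs n \<longrightarrow> v p = 0)}"

definition Rs :: "nat \<Rightarrow> nat \<Rightarrow> (nat \<times> nat \<Rightarrow> complex) \<Rightarrow> complex" where
  "Rs a s v = (\<Sum>j\<in>{a..n}. r ^ j * v (s, j))"

definition Cs :: "nat \<Rightarrow> nat \<Rightarrow> (nat \<times> nat \<Rightarrow> complex) \<Rightarrow> complex" where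
  "Cs b s v = (\<Sum>i\<in>{1..<b}. r ^ i * v (i, s))"

text \<open>The coefficient of \<open>w k (k + 1)\<close> in the image under
  \<open>nu n l r k\<close>, collected from all basis vectors. The absolute exponents in
  \<open>Rs\<close> and \<open>Cs\<close> let the same sums serve every k; dividing by a power of r
  restores the offsets j - k - 2 and k - 1 - i.\<close>

definition L :: "nat \<Rightarrow> (nat \<times> nat \<Rightarrow> complex) \<Rightarrow> complex" where
  "L k v = v (k, k + 1) / l + m * Rs (k + 2) (k + 1) v / r ^ (k + 2) + m / l * (r * Cs k (k + 1) v / r ^ k)"

text \<open>\<open>nu n l r k\<close> on coefficient functions, hence the transpose of the formulas
  for basis vectors; \<open>nu_cut\<close> proves the agreement.\<close>

definition g :: "nat \<Rightarrow> (nat \<times> nat \<Rightarrow> complex) \<Rightarrow> nat \<times> nat \<Rightarrow> complex" where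
  "g k v = (\<lambda>(i, j).
     if (i, j) \<notin> pairs n then 0
     else if i = k \<and> j = k + 1 then L k v
     else if i = k then v (k + 1, j)
     else if i = k + 1 then v (k, j) - m * v (k + 1, j)
     else if j = k then v (i, k + 1)
     else if j = k + 1 then v (i, k) - m * v (i, k + 1)
     else r * v (i, j))"

text \<open>The form with \<open>e\<^sub>k v = phi k v \<cdot> w\<^bsub>k,k+1\<^esub>\<close>: on a proper invariant subspace all these forms vanish,
  so the operators satisfy the quadratic Hecke relation there.\<close>

definition phi :: "nat \<Rightarrow> (nat \<times> nat \<Rightarrow> complex) \<Rightarrow> complex" where
  "phi k v = (1 - (l - 1 / l) / m) * v (k, k + 1)
     + (l * Rs (k + 2) k v + Rs (k + 2) (k + 1) v) / r ^ (k + 2)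
     + r * (Cs k k v + Cs k (k + 1) v / l) / r ^ k"

lemma Rs_linear:
  "Rs a s (u + v) = Rs a s u + Rs a s v" "Rs a s (u - v) = Rs a s u - Rs a s v"
  "Rs a s (scl c v) = c * Rs a s v" "Rs a s 0 = 0"
  by (simp_all add: Rs_def sum.distrib sum_subtractf sum_distrib_left algebra_simps)

lemma Cs_linear:
  "Cs a s (u + v) = Cs a s u + Cs a s v" "Cs a s (u - v) = Cs a s u - Cs a s v"
  "Cs a s (scl c v) = c * Cs a s v" "Cs a s 0 = 0"
  by (simp_all add: Cs_def sum.distrib sum_subtractf sum_distrib_left algebra_simps)

lemma L_linear:
  "L k (u + v) = L k u + L k v" "L k (u - v) = L k u - L k v" "L k (scl c v) = c * L k v" "L k 0 = 0"
  by (simp_all add: L_def Rs_linear Cs_linear add_divide_distrib diff_divide_distrib algebra_simps)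

lemma phi_linear:
  "phi k (u + v) = phi k u + phi k v" "phi k (u - v) = phi k u - phi k v"
  "phi k (scl c v) = c * phi k v" "phi k 0 = 0"
  by (simp_all add: phi_def Rs_linear Cs_linear add_divide_distrib diff_divide_distrib algebra_simps)

lemma g_linear:
  "g k (u + v) = g k u + g k v" "g k (u - v) = g k u - g k v" "g k (scl c v) = scl c (g k v)" "g k 0 = 0"
  by (auto simp: fun_eq_iff g_def L_linear algebra_simps)

lemma g_sum:
  fixes f :: "'a \<Rightarrow> nat \<times> nat \<Rightarrow> complex"
  shows "g k (sum f X) = (\<Sum>x\<in>X. g k (f x))"
proof (induction X rule: infinite_finite_induct)
  case (insert x X)
  then show ?case by (simp only: sum.insert[OF insert(1,2)] g_linear)
qed (simp_all only: sum.infinite sum.empty g_linear not_False_eq_True)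

lemma g_diag: "1 \<le> k \<Longrightarrow> k < n \<Longrightarrow> g k v (k, k + 1) = L k v"
  by (simp add: g_def pairs_def)

lemma g_far: "(i, j) \<in> pairs n \<Longrightarrow> {i, j} \<inter> {k, k + 1} = {} \<Longrightarrow> g k v (i, j) = r * v (i, j)"
  by (simp add: g_def pairs_def)

lemma H_closed:
  "0 \<in> H" "u \<in> H \<Longrightarrow> v \<in> H \<Longrightarrow> u + v \<in> H" "u \<in> H \<Longrightarrow> v \<in> H \<Longrightarrow> u - v \<in> H"
  "c \<in> F \<Longrightarrow> v \<in> H \<Longrightarrow> scl c v \<in> H" "p \<in> pairs n \<Longrightarrow> w (fst p) (snd p) \<in> H"
  by (auto simp: H_def w_def)

lemma H_F: "v \<in> H \<Longrightarrow> v p \<in> F" by (cases p) (auto simp: H_def)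

lemma H_supp: "v \<in> H \<Longrightarrow> p \<notin> pairs n \<Longrightarrow> v p = 0" by (cases p) (auto simp: H_def)

lemma L_F: "v \<in> H \<Longrightarrow> L k v \<in> F"
  by (auto simp: L_def Rs_def Cs_def H_F)

lemma phi_F: "v \<in> H \<Longrightarrow> phi k v \<in> F"
  by (auto simp: phi_def Rs_def Cs_def H_F)

lemma g_H: "v \<in> H \<Longrightarrow> g k v \<in> H"
  using H_F[of v] L_F[of v k] by (auto simp: H_def[of] g_def)

text \<open>The weights \<open>r ^ j\<close> form an eigenvector of the transposed Burau matrix, so every weighted row or
  column sum whose range contains both or none of \<open>k\<close>, \<open>k + 1\<close> is merely multiplied by \<open>r\<close>.\<close>

lemma twist_sum:
  assumes "finite A" "k \<in> A \<longleftrightarrow> k + 1 \<in> A"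
    "k \<in> A \<Longrightarrow> f' k = f (k + 1)" "k \<in> A \<Longrightarrow> f' (k + 1) = f k - m * f (k + 1)"
    "\<And>j. j \<in> A \<Longrightarrow> j \<noteq> k \<Longrightarrow> j \<noteq> k + 1 \<Longrightarrow> f' j = r * f j"
  shows "(\<Sum>j\<in>A. r ^ j * f' j) = r * (\<Sum>j\<in>A. r ^ j * f j)"
proof (cases "k \<in> A")
  case False
  then show ?thesis using assms by (subst sum_distrib_left, intro sum.cong) auto
next
  case True
  let ?B = "A - {k, k + 1}"
  have A: "A = insert k (insert (k + 1) ?B)" using True assms by auto
  have *: "sum h A = h k + h (k + 1) + sum h ?B" for h :: "nat \<Rightarrow> complex"
    by (subst A) (use assms(1) in \<open>simp add: add.assoc\<close>)
  have "(\<Sum>j\<in>?B. r ^ j * f' j) = r * (\<Sum>j\<in>?B. r ^ j * f j)"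
    using assms by (subst sum_distrib_left, intro sum.cong) auto
  then show ?thesis unfolding * assms(3,4)[OF True] by (simp add: m_alt field_simps)
qed

lemma Rs_split: "a \<le> n \<Longrightarrow> Rs a s v = r ^ a * v (s, a) + Rs (a + 1) s v"
  by (simp add: Rs_def sum.atLeast_Suc_atMost)

lemma Cs_split: "1 \<le> b \<Longrightarrow> Cs (b + 1) s v = Cs b s v + r ^ b * v (b, s)"
  by (simp add: Cs_def)

lemma Rs_g_twist:
  assumes "1 \<le> k" "k < n" "s \<noteq> k" "s \<noteq> k + 1" "1 \<le> s" "s < a" "k \<ge> a \<or> k + 1 < a"
  shows "Rs a s (g k v) = r * Rs a s v"
  unfolding Rs_def
  by (rule twist_sum[where k=k]) (use assms in \<open>auto simp: g_def pairs_def\<close>)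

lemma Cs_g_twist:
  assumes "1 \<le> k" "k < n" "s \<noteq> k" "s \<noteq> k + 1" "s \<le> n" "b \<le> s" "k + 1 < b \<or> k \<ge> b"
  shows "Cs b s (g k v) = r * Cs b s v"
  unfolding Cs_def
  by (rule twist_sum[where k=k and f="\<lambda>i. v (i, s)"]) (use assms in \<open>auto simp: g_def pairs_def\<close>)

lemma Rs_g:
  assumes "1 \<le> k" "k + 2 \<le> a"
  shows "Rs a k (g k v) = Rs a (k + 1) v"
    "Rs a (k + 1) (g k v) = Rs a k v - m * Rs a (k + 1) v"
  using assms by (auto simp: Rs_def g_def pairs_def sum_distrib_left
    sum_subtractf[symmetric] algebra_simps intro!: sum.cong)

lemma Cs_g:
  assumes "b \<le> k" "k < n"
  shows "Cs b k (g k v) = Cs b (k + 1) v"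
    "Cs b (k + 1) (g k v) = Cs b k v - m * Cs b (k + 1) v"
  using assms by (auto simp: Cs_def g_def pairs_def sum_distrib_left
    sum_subtractf[symmetric] algebra_simps intro!: sum.cong)

section \<open>The relations satisfied by the operators\<close>

lemma r_mult_r_neq_1: "r * r \<noteq> 1" using r_sq_neq_1 by (simp add: power2_eq_square)

text \<open>Apart from the entry (k, k + 1), \<open>g k\<close> acts by 2x2 blocks with
  characteristic polynomial X^2 + m X - 1 = (X - r) (X + 1/r), or by the root r. Only the entry (k,
  k + 1) can therefore survive, and \<open>phi\<close> is, up to the factor m / l, what is left
  there.\<close>

lemma quadratic:
  assumes "1 \<le> k" "k < n" "v \<in> H"
  shows "g k (g k v) + scl m (g k v) - v = scl (m / l * phi k v) (w k (k + 1))"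
proof (rule ext, clarify)
  fix i j
  show "(g k (g k v) + scl m (g k v) - v) (i, j) = scl (m / l * phi k v) (w k (k + 1)) (i, j)"
  proof (cases "(i, j) = (k, k + 1)")
    case True
    have gk: "g k v (k, k + 1) = L k v" using assms by (simp add: g_def pairs_def)
    define P where "P s = Rs (k + 2) s v / r ^ (k + 2)" for s
    define Q where "Q s = r * Cs k s v / r ^ k" for s
    have 1: "L k v = v (k, k + 1) / l + m * P (k + 1) + m / l * Q (k + 1)"
      by (simp add: L_def P_def Q_def)
    have 2: "L k (g k v) = L k v / l + m * (P k - m * P (k + 1)) + m / l * (Q k - m * Q (k + 1))"
      unfolding L_def[of k "g k v"] gk P_def Q_def
      using assms Rs_g[of k "k + 2" v] Cs_g[of k k v]
      by (simp add: diff_divide_distrib right_diff_distrib del: One_nat_def)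
    have 3: "phi k v = (1 - (l - 1 / l) / m) * v (k, k + 1) + (l * P k + P (k + 1)) + (Q k + Q (k + 1) / l)"
      by (simp add: phi_def P_def Q_def add_divide_distrib distrib_left)
    have "L k (g k v) + m * L k v - v (k, k + 1) = m / l * phi k v"
      unfolding 2 1 3 by (simp add: field_simps)
    then show ?thesis using True assms by (simp add: g_diag[simplified] w_def)
  next
    case False
    then show ?thesis using assms H_supp[OF assms(3)]
      by (auto simp: g_def pairs_def w_def m_alt field_simps)
  qed
qed

text \<open>\<open>L\<close> matters only at the three entries with both indices among k, k + 1, k +
  2. There both sides are linear in these entries and in the sums \<open>P s\<close> and
  \<open>Q s\<close>, on which the two operators act by the same Burau blocks, so a field identity
  remains.\<close>

lemma braid:
  assumes "1 \<le> k" "k + 1 < n"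
  shows "g k (g (k + 1) (g k v)) = g (k + 1) (g k (g (k + 1) v))" (is "?u = ?v")
proof (rule ext, clarify)
  fix i j
  note R = Rs_g_twist[of k "k + 2" "k + 3"] Rs_g[of k "k + 3"] Rs_g_twist[of "k + 1" k "k + 3"] Rs_g[of "k + 1" "k + 3"]
     Cs_g_twist[of k "k + 2" "k"] Cs_g[of k "k"] Cs_g_twist[of "k + 1" k "k"] Cs_g[of "k" "k + 1"]
  obtain k1 k2 where k12: "k1 = k + 1" "k2 = k + 2" by blast
  \<comment> \<open>Cutting at rows below k and columns above k + 2 leaves tails on which both
    operators act in closed form; the entries split off appear explicitly in \<open>L1\<close> and
    \<open>L2\<close>.\<close>
  define P Q where "P s u = Rs (k + 3) s u / r ^ (k + 3)" and "Q s u = r * Cs k s u / r ^ k" for s u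
  have L1: "L k u = u (k, k1) / l + m * (u (k1, k2) + r * P k1 u) + m / l * Q k1 u" for u
    using assms Rs_split[of "k + 2" "k + 1" u]
    by (simp add: L_def P_def Q_def k12 field_simps eval_nat_numeral)
  have L2: "L k1 u = u (k1, k2) / l + m * P k2 u + m / l * (u (k, k2) + Q k2 u / r)" for u
    using assms Cs_split[of k "k + 2" u]
    by (simp add: L_def P_def Q_def k12 field_simps eval_nat_numeral)
  have g1: "g k u (k, k1) = L k u" "g k u (k, k2) = u (k1, k2)"
     "g k u (k1, k2) = u (k, k2) - m * u (k1, k2)" for u
    using assms by (auto simp: g_def pairs_def k12)
  have g2: "g k1 u (k1, k2) = L k1 u" "g k1 u (k, k1) = u (k, k2)"
     "g k1 u (k, k2) = u (k, k1) - m * u (k, k2)" for u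
    using assms by (auto simp: g_def pairs_def k12)
  have P: "P k (g k u) = P k1 u" "P k1 (g k u) = P k u - m * P k1 u" "P k2 (g k u) = r * P k2 u"
    "P k (g k1 u) = r * P k u" "P k1 (g k1 u) = P k2 u" "P k2 (g k1 u) = P k1 u - m * P k2 u" for u
    unfolding P_def k12 using assms R[of u]
    by (simp_all add: diff_divide_distrib numeral_2_eq_2)
  have Q: "Q k (g k u) = Q k1 u" "Q k1 (g k u) = Q k u - m * Q k1 u" "Q k2 (g k u) = r * Q k2 u"
    "Q k (g k1 u) = r * Q k u" "Q k1 (g k1 u) = Q k2 u" "Q k2 (g k1 u) = Q k1 u - m * Q k2 u" for u
    unfolding Q_def k12 using assms R[of u]
    by (simp_all add: diff_divide_distrib right_diff_distrib numeral_2_eq_2)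
  note all = g1 g2 L1 L2 P Q
  consider "(i, j) = (k, k + 1)" | "(i, j) = (k, k + 2)" | "(i, j) = (k + 1, k + 2)" 
    | "(i, j) \<notin> {(k, k + 1), (k, k + 2), (k + 1, k + 2)}" by blast
  then show "?u (i, j) = ?v (i, j)"
  proof cases
    case 4
    then show ?thesis using assms by (auto simp: g_def pairs_def m_alt field_simps)
  next
    case 1
    then show ?thesis unfolding k12[symmetric] by (simp add: all m_alt field_simps)
  next
    case 2
    then show ?thesis unfolding k12[symmetric] by (simp add: all m_alt field_simps)
  next
    case 3
    then show ?thesis unfolding k12[symmetric] by (simp add: all m_alt field_simps)
  qed
qed

lemma commute:
  assumes "1 \<le> k" "k + 2 \<le> k'" "k' < n"
  shows "g k (g k' v) = g k' (g k v)"
proof (rule ext, clarify)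
  fix i j
  have 1: "L k (g k' v) = r * L k v"
    using assms Rs_g_twist[of k' "k + 1" "k + 2" v] Cs_g_twist[of k' "k + 1" k v]
    by (simp add: L_def g_def[of k' v] pairs_def algebra_simps)
  have 2: "L k' (g k v) = r * L k' v"
    using assms Rs_g_twist[of k "k' + 1" "k' + 2" v] Cs_g_twist[of k "k' + 1" k' v]
    by (simp add: L_def g_def[of k v] pairs_def algebra_simps)
  consider "(i, j) = (k, k + 1)" | "(i, j) = (k', k' + 1)"
    | "(i, j) \<notin> {(k, k + 1), (k', k' + 1)}" by blast
  then show "g k (g k' v) (i, j) = g k' (g k v) (i, j)"
  proof cases
    case 3
    then show ?thesis using assms by (auto simp: g_def pairs_def algebra_simps)
  next
    case 1
    then show ?thesis
      using assms \<open>L k (g k' v) = r * L k v\<close> by (simp add: g_diag[simplified] g_far pairs_def)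
  next
    case 2
    then show ?thesis
      using assms \<open>L k' (g k v) = r * L k' v\<close> by (simp add: g_diag[simplified] g_far pairs_def)
  qed
qed

subsection \<open>Invariant subspaces\<close>

text \<open>Only the \<open>g k\<close> occur because their inverses are polynomials in them
  (\<open>ginv\<close>); stability under the whole algebra follows in
  \<open>lk_invariant_iff\<close>.\<close>

definition inv_sub :: "(nat \<times> nat \<Rightarrow> complex) set \<Rightarrow> bool" where
  "inv_sub W \<longleftrightarrow> W \<subseteq> H \<and> 0 \<in> W \<and> (\<forall>u\<in>W. \<forall>v\<in>W. u + v \<in> W) \<and>
     (\<forall>c\<in>F. \<forall>v\<in>W. scl c v \<in> W) \<and> (\<forall>k\<in>{1..<n}. \<forall>v\<in>W. g k v \<in> W)"

lemma inv_subD: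
  assumes "inv_sub W"
  shows "v \<in> W \<Longrightarrow> v \<in> H" "0 \<in> W" "u \<in> W \<Longrightarrow> v \<in> W \<Longrightarrow> u + v \<in> W"
    "c \<in> F \<Longrightarrow> v \<in> W \<Longrightarrow> scl c v \<in> W" "1 \<le> k \<Longrightarrow> k < n \<Longrightarrow> v \<in> W \<Longrightarrow> g k v \<in> W"
  using assms by (auto simp: inv_sub_def)

lemma inv_sub_diff:
  assumes "inv_sub W" "u \<in> W" "v \<in> W"
  shows "u - v \<in> W"
proof -
  have "u + scl (- 1) v \<in> W" using inv_subD(3,4)[OF assms(1)] assms by auto
  also have "u + scl (- 1) v = u - v" by (rule ext) simp
  finally show ?thesis .
qed

lemma inv_sub_sum:
  fixes f :: "'a \<Rightarrow> nat \<times> nat \<Rightarrow> complex"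
  assumes "inv_sub W" "\<And>x. x \<in> X \<Longrightarrow> f x \<in> W"
  shows "sum f X \<in> W"
  using assms(2)
proof (induction X rule: infinite_finite_induct)
  case (insert x X)
  then have "f x + sum f X \<in> W" by (intro inv_subD(3)[OF assms(1)]) auto
  then show ?case by (subst sum.insert[OF insert(1,2)])
qed (simp_all only: sum.infinite sum.empty inv_subD[OF assms(1)] not_False_eq_True)

lemma inv_sub_H: "inv_sub H" by (auto simp: inv_sub_def H_closed g_H)

lemma inv_sub_0: "inv_sub {0}" by (auto simp: inv_sub_def H_closed g_linear scl_simps)

lemma scl_cancel:
  assumes "inv_sub W" "scl c v \<in> W" "c \<in> F" "c \<noteq> 0"
  shows "v \<in> W"
  using inv_subD(4)[OF assms(1), of "inverse c" "scl c v"] assms by (simp add: scl_simps)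

lemma Rs_w: "Rs a s (w i j) = (if s = i \<and> a \<le> j \<and> j \<le> n then r ^ j else 0)"
proof -
  have "Rs a s (w i j) = (\<Sum>j'\<in>{a..n}. if j' = j then (if s = i then r ^ j else 0) else 0)"
    unfolding Rs_def w_def by (intro sum.cong) auto
  then show ?thesis by auto
qed

lemma Cs_w: "Cs b s (w i j) = (if s = j \<and> 1 \<le> i \<and> i < b then r ^ i else 0)"
proof -
  have "Cs b s (w i j) = (\<Sum>i'\<in>{1..<b}. if i' = i then (if s = j then r ^ i else 0) else 0)"
    unfolding Cs_def w_def by (intro sum.cong) auto
  then show ?thesis by auto
qed

lemma g_w:
  assumes "1 \<le> k" "k < n"
  shows "k + 2 \<le> j \<Longrightarrow> j \<le> n \<Longrightarrow> g k (w k j) = w (k + 1) j"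
    "1 \<le> i \<Longrightarrow> i < k \<Longrightarrow> g k (w i k) = w i (k + 1)"
  using assms by (auto simp: fun_eq_iff g_def L_def Rs_w Cs_w) (auto simp: w_def pairs_def)

lemma phi_w: "k + 2 \<le> n \<Longrightarrow> phi k (w (k + 1) (k + 2)) = 1"
  by (simp add: phi_def Rs_w Cs_w) (simp add: w_def)

lemma H_expand:
  assumes "v \<in> H"
  shows "v = (\<Sum>p\<in>pairs n. scl (v p) (w (fst p) (snd p)))"
proof (rule ext)
  fix q
  have fin: "finite (pairs n)"
    by (rule finite_subset[of _ "{1..n} \<times> {1..n}"]) (auto simp: pairs_def)
  have "(\<Sum>p\<in>pairs n. scl (v p) (w (fst p) (snd p))) q = (\<Sum>p\<in>pairs n. if p = q then v q else 0)"
    unfolding sum_fun_apply by (intro sum.cong) (auto simp: w_def)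
  also have "\<dots> = v q" using fin H_supp[OF assms, of q] by auto
  finally show "v q = (\<Sum>p\<in>pairs n. scl (v p) (w (fst p) (snd p))) q" by simp
qed

lemma phi_in:
  assumes "inv_sub W" "v \<in> W" "phi k v \<noteq> 0" "1 \<le> k" "k < n"
  shows "w k (k + 1) \<in> W"
proof -
  have v: "v \<in> H" using assms inv_subD by blast
  have "scl (m / l * phi k v) (w k (k + 1)) = g k (g k v) + scl m (g k v) - v"
    using quadratic[OF assms(4,5) v] by simp
  also have "\<dots> \<in> W"
    using inv_subD[OF assms(1)] assms by (intro inv_sub_diff[OF assms(1)]) auto
  finally show ?thesis
    by (rule scl_cancel[OF assms(1)]) (use assms phi_F[OF v] in auto)
qed

text \<open>By \<open>phi_w\<close> the forms lead down from \<open>w k (k + 1)\<close> to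
  \<open>w 1 2\<close>; then the operators \<open>g j\<close> raise the second index and the
  \<open>g i\<close> the first, reaching every basis vector.\<close>

lemma w_generates:
  assumes W: "inv_sub W" and "w k (k + 1) \<in> W" "1 \<le> k" "k < n"
  shows "W = H"
proof -
  have "w 1 2 \<in> W" using assms(3,2,4)
  proof (induction k rule: dec_induct)
    case (step k)
    have "w (Suc k) (Suc k + 1) \<in> W" by fact
    moreover have "phi k (w (Suc k) (Suc k + 1)) = 1" using phi_w[of k] step by simp
    ultimately have "w k (k + 1) \<in> W" by (intro phi_in[OF W]) (use step in auto)
    then show ?case using step by auto
  qed (simp add: numeral_2_eq_2)
  have 1: "w 1 j \<in> W" if "2 \<le> j" "j \<le> n" for j
    using that
  proof (induction j rule: dec_induct)
    case base show ?case by fact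
  next
    case (step j)
    then show ?case using inv_subD(5)[OF W, of j "w 1 j"] g_w(2)[of j 1] by simp
  qed
  have 2: "w i j \<in> W" if "1 \<le> i" "i < j" "j \<le> n" for i j
    using that
  proof (induction i rule: dec_induct)
    case base then show ?case using 1[of j] by simp
  next
    case (step i)
    then show ?case using inv_subD(5)[OF W, of i "w i j"] g_w(1)[of i j] by simp
  qed
  have "v \<in> W" if "v \<in> H" for v
  proof (subst H_expand[OF that], rule inv_sub_sum[OF W])
    fix p assume "p \<in> pairs n"
    then show "scl (v p) (w (fst p) (snd p)) \<in> W"
      by (intro inv_subD(4)[OF W] H_F[OF that] 2) (auto simp: pairs_def)
  qed
  then show ?thesis using inv_subD(1)[OF W] by auto
qed

text \<open>Being linear in v, the condition on the right passes to sums of subspaces, which is how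
  the sum of two proper invariant subspaces is seen to be proper. \<open>H\<close> itself violates
  it, as \<open>phi 1 (w 2 3) = 1\<close>.\<close>

lemma proper_iff_phi:
  assumes "inv_sub W"
  shows "W \<noteq> H \<longleftrightarrow> (\<forall>k\<in>{1..<n}. \<forall>v\<in>W. phi k v = 0)"
proof
  assume "W \<noteq> H"
  then show "\<forall>k\<in>{1..<n}. \<forall>v\<in>W. phi k v = 0"
    using phi_in[OF assms] w_generates[OF assms] by fastforce
next
  assume *: "\<forall>k\<in>{1..<n}. \<forall>v\<in>W. phi k v = 0"
  have "w 2 3 \<in> H" using H_closed(5)[of "(2, 3)"] n_ge_3 by (simp add: pairs_def)
  moreover have "phi 1 (w 2 3) = 1" using phi_w[of 1] n_ge_3 by (simp add: numeral_2_eq_2 numeral_3_eq_3)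
  ultimately show "W \<noteq> H" using * n_ge_3 by force
qed

lemma proper_quadratic:
  assumes "inv_sub K" "K \<noteq> H" "1 \<le> k" "k < n" "v \<in> K"
  shows "g k (g k v) = v - scl m (g k v)"
proof -
  have "phi k v = 0" using proper_iff_phi assms by auto
  then have "g k (g k v) + scl m (g k v) - v = 0"
    using quadratic[OF assms(3,4)] inv_subD(1)[OF assms(1,5)] by (simp add: scl_simps)
  then show ?thesis by (simp add: algebra_simps add_eq_0_iff2 eq_neg_iff_add_eq_0)
qed

section \<open>The trivial line and the parameter at which it occurs\<close>

definition triv :: "(nat \<times> nat \<Rightarrow> complex) \<Rightarrow> bool" where
  "triv v \<longleftrightarrow> v \<in> H \<and> (\<forall>k\<in>{1..<n}. g k v = scl r v)"

definition triv_vec :: "nat \<times> nat \<Rightarrow> complex" where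
  "triv_vec = (\<lambda>(i, j). if (i, j) \<in> pairs n then r ^ (i + j) else 0)"

lemma geom: "(1 - r\<^sup>2) * (\<Sum>j\<in>{a..b}. r ^ (2 * j)) = (if a \<le> b then r ^ (2 * a) - r ^ (2 * b + 2) else 0)"
proof (cases "a \<le> b")
  case True
  then have "(1 - r\<^sup>2) * (\<Sum>j\<in>{a..b}. r ^ (2 * j)) = r ^ (2 * a) - r ^ (2 * b + 2)"
    by (induction b rule: dec_induct)
       (simp_all add: distrib_left left_diff_distrib power_add eval_nat_numeral)
  then show ?thesis using True by simp
qed simp

lemma m_factored: "m = (1 - r\<^sup>2) / r" by (simp add: m_alt power2_eq_square field_simps)

text \<open>Both weighted sums are geometric with ratio r^2, and the factor 1 - r^2 in m clears
  their denominators. An eigenvector needs the value r^(2k + 2), which cancels, so the condition is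
  the same for all k.\<close>

lemma L_triv_vec:
  assumes "1 \<le> k" "k < n"
  shows "L k triv_vec = r ^ (2 * k + 2) - r ^ (2 * n) + r ^ 3 / l"
proof -
  have "Rs (k + 2) (k + 1) triv_vec = (\<Sum>j\<in>{k+2..n}. r ^ (k + 1) * r ^ (2 * j))"
    unfolding Rs_def triv_vec_def using assms
    by (intro sum.cong) (auto simp: pairs_def mult_2_right ac_simps simp flip: power_add)
  then have 1: "(1 - r\<^sup>2) * Rs (k + 2) (k + 1) triv_vec = r ^ (k + 1) * (r ^ (2 * k + 4) - r ^ (2 * n + 2))"
    using geom[of "k + 2" n] assms
    by (cases "k + 1 = n") (auto simp: eval_nat_numeral simp flip: sum_distrib_left)
  have "Cs k (k + 1) triv_vec = (\<Sum>i\<in>{1..k-1}. r ^ (k + 1) * r ^ (2 * i))"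
    unfolding Cs_def triv_vec_def using assms
    by (intro sum.cong) (auto simp: pairs_def mult_2_right ac_simps simp flip: power_add)
  moreover have "(1 - r\<^sup>2) * (\<Sum>i\<in>{1..k-1}. r ^ (2 * i)) = r\<^sup>2 - r ^ (2 * k)"
  proof (cases "k = 1")
    case False
    then have "2 * (k - 1) + 2 = 2 * k" using assms by simp
    then show ?thesis using geom[of 1 "k - 1"] False assms by simp
  qed simp
  ultimately have 2: "(1 - r\<^sup>2) * Cs k (k + 1) triv_vec = r ^ (k + 1) * (r ^ 2 - r ^ (2 * k))"
    by (simp flip: sum_distrib_left)
  have "L k triv_vec = r ^ (2 * k + 1) / l + (1 - r\<^sup>2) * Rs (k + 2) (k + 1) triv_vec / r ^ (k + 3)
      + (1 - r\<^sup>2) * Cs k (k + 1) triv_vec / (l * r ^ k)"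
    unfolding L_def m_factored using assms by (simp add: triv_vec_def pairs_def field_simps eval_nat_numeral)
  also have "\<dots> = r ^ (2 * k + 2) - r ^ (2 * n) + r ^ 3 / l"
    unfolding 1 2 by (simp add: field_simps power_add eval_nat_numeral)
  finally show ?thesis .
qed

text \<open>At (1, j) the equation for \<open>g j\<close> multiplies the entry by r on passing to j
  + 1, and at (i, j) that for \<open>g i\<close> does so on passing to i + 1. The divisor r^3 is the
  entry of \<open>triv_vec\<close> at (1, 2).\<close>

lemma triv_form:
  assumes "triv v"
  shows "v = scl (v (1, 2) / r ^ 3) triv_vec"
proof (rule ext, clarify)
  fix i j
  have H: "v \<in> H" and gv: "\<And>k. 1 \<le> k \<Longrightarrow> k < n \<Longrightarrow> g k v = scl r v" using assms by (auto simp: triv_def)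
  have 1: "v (1, j) = v (1, 2) / r ^ 2 * r ^ j" if "2 \<le> j" "j \<le> n" for j
    using that
  proof (induction j rule: dec_induct)
    case (step j)
    have "v (1, j + 1) = g j v (1, j)" using step by (simp add: g_def pairs_def)
    then show ?case using gv[of j] step by simp
  qed simp
  have 2: "v (i, j) = v (1, j) / r * r ^ i" if "1 \<le> i" "i < j" "j \<le> n" for i j
    using that
  proof (induction i rule: dec_induct)
    case (step i)
    have "v (i + 1, j) = g i v (i, j)" using step by (simp add: g_def pairs_def)
    then show ?case using gv[of i] step by simp
  qed simp
  show "v (i, j) = scl (v (1, 2) / r ^ 3) triv_vec (i, j)"
  proof (cases "(i, j) \<in> pairs n")
    case True
    then have "v (i, j) = v (1, 2) / r ^ 2 * r ^ j / r * r ^ i"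
      using 1[of j] 2[of i j] by (auto simp: pairs_def)
    then show ?thesis using True by (simp add: triv_vec_def power_add eval_nat_numeral mult_ac)
  next
    case False
    then show ?thesis using H_supp[OF H] by (simp add: triv_vec_def)
  qed
qed

lemma triv_vec_H: "triv_vec \<in> H"
  by (auto simp: H_def triv_vec_def)

text \<open>All entries but (k, k + 1) satisfy the equation identically; there it reads r^3 / l =
  r^(2n) by \<open>L_triv_vec\<close>.\<close>

lemma triv_vec_triv: "triv triv_vec \<longleftrightarrow> l * r ^ (2 * n) = r ^ 3"
proof
  assume "triv triv_vec"
  then have "g 1 triv_vec (1, 2) = r * triv_vec (1, 2)" using n_ge_3 by (simp add: triv_def)
  then have "L 1 triv_vec = r ^ 4" using n_ge_3 by (simp add: g_def pairs_def triv_vec_def eval_nat_numeral)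
  then show "l * r ^ (2 * n) = r ^ 3" using L_triv_vec[of 1] n_ge_3 by (simp add: field_simps eval_nat_numeral)
next
  assume *: "l * r ^ (2 * n) = r ^ 3"
  have "g k triv_vec = scl r triv_vec" if "1 \<le> k" "k < n" for k
  proof (rule ext, clarify)
    fix i j
    show "g k triv_vec (i, j) = scl r triv_vec (i, j)"
    proof (cases "(i, j) = (k, k + 1)")
      case True
      have "r ^ 3 / l = r ^ (2 * n)" using *[symmetric] by simp
      then have "L k triv_vec = r ^ (2 * k + 2)" using L_triv_vec[OF that] by simp
      then show ?thesis using True that g_diag[OF that, of triv_vec]
        by (simp add: triv_vec_def pairs_def flip: power_Suc mult_2)
    next
      case False
      then show ?thesis using that
        by (auto simp: g_def triv_vec_def pairs_def m_alt field_simps)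
    qed
  qed
  then show "triv triv_vec" using triv_vec_H by (simp add: triv_def)
qed

lemma triv_l:
  assumes "triv v" "v \<noteq> 0"
  shows "l * r ^ (2 * n) = r ^ 3"
proof -
  define c where "c = v (1, 2) / r ^ 3"
  have v: "v = scl c triv_vec" using triv_form[OF assms(1)] by (simp add: c_def)
  have c: "c \<noteq> 0" using v assms(2) by (auto simp: scl_simps)
  have "triv triv_vec" unfolding triv_def
  proof (intro conjI ballI triv_vec_H)
    fix k assume "k \<in> {1..<n}"
    then have "scl c (g k triv_vec) = scl c (scl r triv_vec)"
      using assms(1) by (simp add: triv_def v g_linear scl_simps mult.commute)
    then have "scl (1 / c) (scl c (g k triv_vec)) = scl (1 / c) (scl c (scl r triv_vec))" by simp
    then show "g k triv_vec = scl r triv_vec" using c by (simp add: scl_simps)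
  qed
  then show ?thesis by (simp add: triv_vec_triv)
qed

end

section \<open>Structure of the proper invariant subspaces\<close>

declare One_nat_def [simp del]

locale lk_generic = lk +
  assumes q: "\<And>k. 1 \<le> k \<Longrightarrow> k \<le> n \<Longrightarrow> (r\<^sup>2) ^ k \<noteq> 1"
begin

section \<open>Nonvanishing q-integers and the eigenspace of \<open>g 1\<close>\<close>

lemma r_pow_neq_1: "1 \<le> k \<Longrightarrow> k \<le> n \<Longrightarrow> r ^ (2 * k) \<noteq> 1"
  using q[of k] by (simp add: power_mult)

lemma r_pow_2n_neq_r_pow4: "r ^ (2 * n) \<noteq> r ^ 4"
proof -
  have "2 * n = 4 + 2 * (n - 2)" using n_ge_3 by simp
  then have "r ^ (2 * n) = r ^ 4 * r ^ (2 * (n - 2))" by (metis power_add)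
  then show ?thesis using r_pow_neq_1[of "n - 2"] n_ge_3 by simp
qed

lemma r_pow4_neq_1: "r ^ 4 \<noteq> 1" using r_pow_neq_1[of 2] n_ge_3 by simp

lemma one_plus_r_sq_neq_0: "1 + r\<^sup>2 \<noteq> 0"
proof
  assume "1 + r\<^sup>2 = 0"
  then have "r\<^sup>2 = - 1" by (simp add: add_eq_0_iff)
  then have "r ^ 4 = 1" using power_mult[of r 2 2] by simp
  then show False using r_pow4_neq_1 by simp
qed

definition eig :: "nat \<Rightarrow> (nat \<times> nat \<Rightarrow> complex) set" where
  "eig k = {v \<in> H. g k v = scl (- 1 / r) v}"

text \<open>A vector of \<open>eig 1\<close> is determined by its entries \<open>(1, j)\<close> with \<open>j \<ge> 3\<close> when \<open>l \<noteq> - r\<close>; on these entries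
  \<open>g 3, \<dots>, g (n - 1)\<close> act as on the \<open>(n - 2)\<close>-dimensional permutation module, and \<open>rowf\<close> is its
  trivial quotient.\<close>

definition rowf :: "(nat \<times> nat \<Rightarrow> complex) \<Rightarrow> complex" where "rowf v = Rs 3 1 v / r ^ 3"

lemma rowf_linear: "rowf (u - v) = rowf u - rowf v" "rowf (scl c v) = c * rowf v"
  by (simp_all add: rowf_def Rs_linear diff_divide_distrib)

lemma eig_linear:
  "u \<in> eig k \<Longrightarrow> v \<in> eig k \<Longrightarrow> u - v \<in> eig k" "c \<in> F \<Longrightarrow> v \<in> eig k \<Longrightarrow> scl c v \<in> eig k"
  by (auto simp: eig_def H_closed g_linear scl_simps mult.commute)

lemma eig_H: "v \<in> eig k \<Longrightarrow> v \<in> H" by (simp add: eig_def)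

text \<open>The three claims read the eigenvalue equation at (1, j), at the entries which
  \<open>g 1\<close> scales by r, where r + 1/r is nonzero, and at (1, 2).\<close>

lemma E1_coords:
  assumes "v \<in> eig 1"
  shows "3 \<le> j \<Longrightarrow> v (2, j) = - v (1, j) / r" "3 \<le> i \<Longrightarrow> v (i, j) = 0"
    "v (1, 2) * (1 / l + 1 / r) = m * rowf v / r"
proof -
  have H: "v \<in> H" and gv: "g 1 v = scl (- 1 / r) v" using assms by (auto simp: eig_def)
  show 2: "v (2, j) = - v (1, j) / r" if "3 \<le> j" for j
  proof (cases "j \<le> n")
    case True
    then have "v (2, j) = g 1 v (1, j)" using that by (simp add: g_def pairs_def)
    then show ?thesis by (simp add: gv)
  qed (use H_supp[OF H] in \<open>simp add: pairs_def\<close>)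
  show "v (i, j) = 0" if "3 \<le> i" for j
  proof (cases "(i, j) \<in> pairs n")
    case True
    then have "r * v (i, j) = - 1 / r * v (i, j)"
      using g_far[of i j 1 v] that by (auto simp: gv pairs_def)
    then have "(1 + r\<^sup>2) * v (i, j) = 0" by (simp add: field_simps power2_eq_square)
    then show ?thesis using one_plus_r_sq_neq_0 by simp
  qed (use H_supp[OF H] in simp)
  have "Rs 3 2 v = - Rs 3 1 v / r"
    unfolding Rs_def by (simp add: 2 sum_divide_distrib sum_negf[symmetric])
  moreover have "L 1 v = - v (1, 2) / r"
    using g_diag[of 1 v] n_ge_3 by (simp add: gv)
  ultimately show "v (1, 2) * (1 / l + 1 / r) = m * rowf v / r"
    by (simp add: L_def rowf_def Cs_def algebra_simps)
qed

text \<open>\<open>phi 1\<close> vanishes on \<open>eig 1\<close>, since -1/r is a root of X^2 + m X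
  - 1; \<open>phi 2\<close> is thus the first form that can constrain this eigenspace.\<close>

lemma phi2_E1:
  assumes "v \<in> eig 1"
  shows "phi 2 v = - (1 - (l - 1 / l) / m) * v (1, 3) / r - l * (rowf v - v (1, 3)) / r\<^sup>2 + v (1, 2) + v (1, 3) / l"
proof -
  have "Rs 4 2 v = - Rs 4 1 v / r"
    unfolding Rs_def using E1_coords[OF assms] by (simp add: sum_divide_distrib sum_negf[symmetric])
  moreover have "Rs 4 3 v = 0"
    unfolding Rs_def using E1_coords[OF assms] by simp
  moreover have "Rs 4 1 v = r ^ 3 * (rowf v - v (1, 3))"
    using Rs_split[of 3 1 v] n_ge_3 by (simp add: rowf_def field_simps)
  moreover have "Cs 2 s v = r * v (1, s)" for s
  proof -
    have "{1..<2} = {1::nat}" by auto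
    then show ?thesis by (simp add: Cs_def)
  qed
  moreover have "v (2, 3) = - v (1, 3) / r" using E1_coords(1)[OF assms, of 3] by simp
  ultimately have "phi 2 v = (1 - (l - 1 / l) / m) * (- v (1, 3) / r)
      + (l * (- (r ^ 3 * (rowf v - v (1, 3))) / r) + 0) / r ^ 4
      + r * (r * v (1, 2) + r * v (1, 3) / l) / r\<^sup>2"
    by (simp add: phi_def)
  also have "\<dots> = - (1 - (l - 1 / l) / m) * v (1, 3) / r - l * (rowf v - v (1, 3)) / r\<^sup>2 + v (1, 2) + v (1, 3) / l"
  proof -
    have "X * (- a / r) + (l * (- (r ^ 3 * b) / r) + 0) / r ^ 4 + r * (r * c + r * a / l) / r\<^sup>2
        = - X * a / r - l * b / r\<^sup>2 + c + a / l" for X a b c :: complex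
      by (simp add: distrib_left add_divide_distrib power2_eq_square power3_eq_cube power4_eq_xxxx)
    then show ?thesis .
  qed
  finally show ?thesis .
qed

lemma E1_eqI:
  assumes "u \<in> eig 1" "v \<in> eig 1" "l \<noteq> - r" "\<And>j. 3 \<le> j \<Longrightarrow> j \<le> n \<Longrightarrow> u (1, j) = v (1, j)"
  shows "u = v"
proof (rule ext, clarify)
  fix i j
  define d where "d = u - v"
  have d: "d \<in> eig 1" and H: "d \<in> H" using eig_linear(1)[OF assms(1,2)] eig_H by (auto simp: d_def)
  have 1: "d (1, j) = 0" if "3 \<le> j" for j
    using H_supp[OF H, of "(1, j)"] assms(4)[of j] that by (cases "j \<le> n") (auto simp: d_def pairs_def)
  have "rowf d = 0" by (simp add: rowf_def Rs_def 1)
  then have "d (1, 2) * (1 / l + 1 / r) = 0" using E1_coords(3)[OF d] by simp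
  moreover have "1 / l + 1 / r \<noteq> 0" using assms(3) by (auto simp: field_simps add_eq_0_iff)
  ultimately have 2: "d (1, 2) = 0" by simp
  have "d (i, j) = 0"
  proof (cases "(i, j) \<in> pairs n")
    case True
    consider "i = 1" "j = 2" | "i = 1" "3 \<le> j" | "i = 2" "3 \<le> j" | "3 \<le> i"
      using True by (fastforce simp: pairs_def)
    then show ?thesis using 1 2 E1_coords[OF d] by cases auto
  qed (use H_supp[OF H] in simp)
  then show "u (i, j) = v (i, j)" by (simp add: d_def)
qed

lemma E1_stable:
  assumes "v \<in> eig 1" "3 \<le> k" "k < n"
  shows "g k v \<in> eig 1"
  using assms commute[of 1 k v] by (auto simp: eig_def g_H g_linear)

lemma E1_g_coords:
  assumes "3 \<le> k" "k < n"
  shows "g k v (1, k) = v (1, k + 1)" "g k v (1, k + 1) = v (1, k) - m * v (1, k + 1)"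
    "2 \<le> j \<Longrightarrow> j \<le> n \<Longrightarrow> j \<noteq> k \<Longrightarrow> j \<noteq> k + 1 \<Longrightarrow> g k v (1, j) = r * v (1, j)"
    "rowf (g k v) = r * rowf v"
  using assms Rs_g_twist[of k 1 3 v] by (auto simp: g_def pairs_def rowf_def)

text \<open>For entries \<open>r ^ (j - 3)\<close> (that is, \<open>t = 1\<close>) the value of \<open>rowf\<close> is the \<open>q\<close>-integer
  \<open>[n - 2]\<close> at \<open>q = r\<^sup>2\<close>.\<close>

lemma rowf_geom:
  assumes "\<And>j. 3 \<le> j \<Longrightarrow> j \<le> n \<Longrightarrow> v (1, j) = t / r ^ 3 * r ^ j"
  shows "rowf v * (1 - r\<^sup>2) = t * (1 - r ^ (2 * n) / r ^ 4)"
proof -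
  have "Rs 3 1 v = (\<Sum>j\<in>{3..n}. t / r ^ 3 * r ^ (2 * j))"
    unfolding Rs_def using assms by (intro sum.cong) (auto simp: mult_2 power_add)
  also have "\<dots> = t / r ^ 3 * (\<Sum>j\<in>{3..n}. r ^ (2 * j))" by (simp add: sum_distrib_left)
  finally have "(1 - r\<^sup>2) * Rs 3 1 v = t / r ^ 3 * (r ^ 6 - r ^ (2 * n + 2))"
    using geom[of 3 n] n_ge_3 by simp
  then have "rowf v * (1 - r\<^sup>2) = t / r ^ 6 * (r ^ 6 - r ^ (2 * n + 2))"
    unfolding rowf_def by (simp add: mult.commute flip: power_add)
  also have "\<dots> = t * (1 - r ^ (2 * n) / r ^ 4)"
  proof -
    have "r ^ 6 = r ^ 4 * r\<^sup>2" by (simp flip: power_add)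
    then show ?thesis unfolding power_add by (simp add: field_simps)
  qed
  finally show ?thesis .
qed

text \<open>An identity v (1, 3) = f v valid throughout \<open>U \<inter> eig 1\<close> also holds
  for the translates of v under the \<open>g k\<close> with k at least 3, which carry the later
  entries of the row into position 3. Since f is only scaled by r, the row is forced to be
  geometric.\<close>

lemma geom_propagate:
  assumes U: "inv_sub U" and f: "\<And>v k. v \<in> U \<inter> eig 1 \<Longrightarrow> 3 \<le> k \<Longrightarrow> k < n \<Longrightarrow> f (g k v) = r * f v"
    and 3: "\<And>v. v \<in> U \<inter> eig 1 \<Longrightarrow> v (1, 3) = f v" and v: "v \<in> U \<inter> eig 1"
    and j: "3 \<le> j" "j \<le> n"
  shows "v (1, j) = f v / r ^ 3 * r ^ j"
  using j v
proof (induction j arbitrary: v rule: dec_induct)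
  case base
  then show ?case using 3 by simp
next
  case (step j)
  have "g j v \<in> U \<inter> eig 1"
    using step inv_subD(5)[OF U] E1_stable by auto
  then have "g j v (1, j) = f (g j v) / r ^ 3 * r ^ j" using step by auto
  moreover have "g j v (1, j) = v (1, Suc j)" using E1_g_coords(1)[of j v] step by (simp add: Suc_eq_plus1)
  moreover have "f (g j v) = r * f v" using step by (intro f) auto
  ultimately show ?case by simp
qed

text \<open>At l = - r the coefficient 1/l + 1/r vanishes, so \<open>E1_coords\<close> gives
  \<open>rowf v = 0\<close> and leaves v (1, 2) free. Then \<open>phi 2\<close> ties v (1, 3) to v
  (1, 2), the row becomes geometric, and since [n - 2] is nonzero, \<open>rowf v = 0\<close> leaves
  only the zero vector.\<close>

lemma E1_empty:
  assumes K: "inv_sub K" "K \<noteq> H" and l: "l = - r" and v: "v \<in> K \<inter> eig 1"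
  shows "v = 0"
proof -
  have 0: "rowf v = 0" "v (1, 3) = r * v (1, 2) / 2" if "v \<in> K \<inter> eig 1" for v
  proof -
    have v: "v \<in> K" "v \<in> eig 1" using that by auto
    show rowf: "rowf v = 0" using E1_coords(3)[OF v(2)] l by simp
    have "phi 2 v = 0" using proper_iff_phi[OF K(1)] K(2) v n_ge_3 by auto
    moreover have "(l - 1 / l) / m = 1"
      using r_mult_r_neq_1 by (simp add: l m_alt field_simps)
    ultimately have "v (1, 2) - l * (- v (1, 3)) / r\<^sup>2 + v (1, 3) / l = 0"
      using phi2_E1[OF v(2)] rowf by (simp add: ac_simps)
    then have "v (1, 2) = 2 * v (1, 3) / r"
      by (simp add: l power2_eq_square)
    then show "v (1, 3) = r * v (1, 2) / 2" by simp
  qed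
  have j: "v (1, j) = r * v (1, 2) / 2 / r ^ 3 * r ^ j" if "3 \<le> j" "j \<le> n" for j
    by (rule geom_propagate[where f="\<lambda>v. r * v (1, 2) / 2", OF K(1) _ 0(2) v that]) (use n_ge_3 in \<open>auto simp: E1_g_coords\<close>)
  have "r * v (1, 2) / 2 * (1 - r ^ (2 * n) / r ^ 4) = 0"
    using rowf_geom[OF j] 0(1)[OF v] by simp
  moreover have "r ^ (2 * n) \<noteq> r ^ 4" by (rule r_pow_2n_neq_r_pow4)
  ultimately have v12: "v (1, 2) = 0" by simp
  show "v = 0"
  proof (rule ext, clarify)
    fix i j
    have v': "v \<in> eig 1" using v by simp
    show "v (i, j) = 0 (i, j)"
    proof (cases "(i, j) \<in> pairs n")
      case True
      then consider "i = 1" "j = 2" | "i = 1" "3 \<le> j" "j \<le> n" | "i = 2" "3 \<le> j" "j \<le> n" | "3 \<le> i"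
        by (fastforce simp: pairs_def)
      then show ?thesis using j[of j] v12 E1_coords[OF v'] by cases auto
    qed (use H_supp[OF eig_H[OF v']] in simp)
  qed
qed

text \<open>The coefficients of \<open>phi 2\<close> on \<open>eig 1\<close>; the zeros \<open>l = r\<close> and \<open>l = - r\<^sup>3\<close> of \<open>alpha\<close> are the values for
  which the standard summand of the permutation module can be annihilated.\<close>

definition alpha where "alpha = (l - r) * (l + r ^ 3) / (m * l * r ^ 3)"
definition beta where "beta = - l * (l + r ^ 3) / (r\<^sup>2 * (l + r))"

text \<open>At l = - r^3 both \<open>alpha\<close> and \<open>beta\<close> are zero and the second
  relation is empty; at l = r only \<open>alpha\<close> is, and the relation becomes
  \<open>rowf v = 0\<close>.\<close>

lemma proper_E1:
  assumes K: "inv_sub K" "K \<noteq> H" and l: "l \<noteq> - r" and v: "v \<in> K \<inter> eig 1"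
  shows "v (1, 2) = m * l / (l + r) * rowf v" "alpha * v (1, 3) + beta * rowf v = 0"
proof -
  have v: "v \<in> K" "v \<in> eig 1" using v by auto
  have lr: "l + r \<noteq> 0" using l by (simp add: add_eq_0_iff2)
  then show c: "v (1, 2) = m * l / (l + r) * rowf v"
  proof -
    have "1 / l + 1 / r = (l + r) / (l * r)" by (simp add: field_simps)
    then have "v (1, 2) * (l + r) = m * l * rowf v"
      using E1_coords(3)[OF v(2)] by (simp add: divide_eq_eq)
    then show ?thesis using lr by (simp add: field_simps)
  qed
  have "phi 2 v = 0" using proper_iff_phi[OF K(1)] K(2) v n_ge_3 by auto
  moreover have "phi 2 v = alpha * v (1, 3) + beta * rowf v"
  proof -
    have mr: "m * r = 1 - r\<^sup>2" by (simp add: m_factored)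
    have "(- (1 - (l - 1 / l) / m) / r + l / r\<^sup>2 + 1 / l) * (m * l * r ^ 3)
        = - (m * l - (l * l - 1)) * r\<^sup>2 + m * l * l * r + m * r ^ 3"
      by (simp add: distrib_right left_diff_distrib diff_divide_distrib)
         (simp add: power2_eq_square power3_eq_cube field_simps)
    also have "\<dots> = - l * r * (m * r) + l * l * r\<^sup>2 - r\<^sup>2 + l * l * (m * r) + r\<^sup>2 * (m * r)"
      by (simp add: algebra_simps power2_eq_square power3_eq_cube)
    also have "\<dots> = (l - r) * (l + r ^ 3)"
      unfolding mr by (simp add: algebra_simps power2_eq_square power3_eq_cube)
    finally have 1: "- (1 - (l - 1 / l) / m) / r + l / r\<^sup>2 + 1 / l = alpha"
      by (simp add: alpha_def eq_divide_eq)
    have "(m * l / (l + r) - l / r\<^sup>2) * (r\<^sup>2 * (l + r)) = m * l * r\<^sup>2 - l * (l + r)"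
      using lr by (simp add: left_diff_distrib)
    also have "\<dots> = l * r * (m * r) - l * (l + r)"
      by (simp add: algebra_simps power2_eq_square)
    also have "\<dots> = - l * (l + r ^ 3)"
      unfolding mr by (simp add: algebra_simps power2_eq_square power3_eq_cube)
    finally have 2: "m * l / (l + r) - l / r\<^sup>2 = beta"
      using lr unfolding beta_def by (subst nonzero_eq_divide_eq) auto
    have "phi 2 v = (- (1 - (l - 1 / l) / m) / r + l / r\<^sup>2 + 1 / l) * v (1, 3) + (m * l / (l + r) - l / r\<^sup>2) * rowf v"
    proof -
      have "- X * a / r - l * (b - a) / r\<^sup>2 + chain * b + a / l = (- X / r + l / r\<^sup>2 + 1 / l) * a + (chain - l / r\<^sup>2) * b"
        for X chain a b :: complex
        by (simp add: field_simps)
      then show ?thesis unfolding phi2_E1[OF v(2)] c .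
    qed
    then show ?thesis unfolding 1 2 .
  qed
  ultimately show "alpha * v (1, 3) + beta * rowf v = 0" by simp
qed

lemma proper_E1_ratio:
  assumes K: "inv_sub K" "K \<noteq> H" and l: "l \<noteq> - r" and v: "v \<in> K \<inter> eig 1" and alpha: "alpha \<noteq> 0"
  shows "v (1, 3) = - beta / alpha * rowf v"
proof -
  have "alpha * v (1, 3) = - beta * rowf v" using proper_E1(2)[OF K l v] by (simp add: eq_neg_iff_add_eq_0)
  also have "\<dots> = alpha * (- beta / alpha * rowf v)" using alpha by simp
  finally show ?thesis using alpha by (simp only: mult_cancel_left simp_thms)
qed

section \<open>Explicit vectors of the eigenspace and what they generate\<close>

lemma rowf_F: "v \<in> eig k \<Longrightarrow> rowf v \<in> F"
  using H_F[OF eig_H] by (simp add: rowf_def Rs_def)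

text \<open>The vector of \<open>eig 1\<close> whose row entries from 3 on are 1 at j and 0
  elsewhere; \<open>E1_coords\<close> dictates the other coefficients, with r^j / r^3 as its
  \<open>rowf\<close>.\<close>

definition xv :: "nat \<Rightarrow> nat \<times> nat \<Rightarrow> complex" where
  "xv j = w 1 j - scl (1 / r) (w 2 j) + scl (m * l / (l + r) * (r ^ j / r ^ 3)) (w 1 2)"

lemma xv_coord: "3 \<le> j \<Longrightarrow> 3 \<le> i \<Longrightarrow> xv j (1, i) = (if i = j then 1 else 0)"
  by (simp add: xv_def w_def)

lemma rowf_xv: "3 \<le> j \<Longrightarrow> j \<le> n \<Longrightarrow> rowf (xv j) = r ^ j / r ^ 3"
  by (simp add: rowf_def xv_def Rs_linear Rs_w)

lemma xv_E1:
  assumes l: "l \<noteq> - r" and j: "3 \<le> j" "j \<le> n"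
  shows "xv j \<in> eig 1"
proof -
  define c where "c = m * l / (l + r) * (r ^ j / r ^ 3)"
  have lr: "l + r \<noteq> 0" using l by (simp add: add_eq_0_iff2)
  have H: "xv j \<in> H"
    unfolding xv_def using j
    by (intro H_closed(2,3,4) H_closed(5)[of "(a, b)" for a b, simplified]) (auto simp: pairs_def)
  have "1 / l + 1 / r = (l + r) / (l * r)" by (simp add: field_simps)
  then have "c * (1 / l + 1 / r) = m * (r ^ j / r ^ 3) / r"
    using lr by (simp add: c_def)
  moreover have "L 1 (xv j) = c / l - m * (r ^ j / r ^ 3) / r"
    using j by (simp add: L_def xv_def Rs_linear Cs_linear Rs_w Cs_w c_def) (simp add: w_def)
  ultimately have "L 1 (xv j) = c / l - c * (1 / l + 1 / r)" by simp
  then have "L 1 (xv j) = - c / r" by (simp add: distrib_left)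
  moreover have "xv j (1, 2) = c" using j by (simp add: xv_def w_def c_def)
  ultimately have L: "L 1 (xv j) = - xv j (1, 2) / r" by simp
  have "g 1 (xv j) = scl (- 1 / r) (xv j)"
  proof (rule ext, clarify)
    fix a b
    show "g 1 (xv j) (a, b) = scl (- 1 / r) (xv j) (a, b)"
    proof (cases "(a, b) = (1, 2)")
      case True
      then show ?thesis using L n_ge_3 by (simp add: g_def pairs_def)
    next
      case False
      have 1: "xv j (2, b) = (if b = j then - 1 / r else 0)" if "3 \<le> b" for b
        using that j by (simp add: xv_def w_def)
      have 2: "xv j (a, b) = 0" if "3 \<le> a" for a b
        using that j by (simp add: xv_def w_def)
      have 3: "1 + m / r = 1 / (r * r)" by (simp add: m_alt field_simps)
      show ?thesis
      proof (cases "(a, b) \<in> pairs n")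
        case True
        then consider "a = 1" "3 \<le> b" | "a = 2" "3 \<le> b" | "3 \<le> a" "3 \<le> b"
          using False by (fastforce simp: pairs_def)
        then show ?thesis
          using True j n_ge_3 3 by cases (simp_all add: g_def 1 2 xv_coord)
      qed (use H_supp[OF H] in \<open>simp add: g_def\<close>)
    qed
  qed
  then show ?thesis using H by (simp add: eig_def)
qed

lemma zero_eig: "0 \<in> eig k"
  by (simp only: eig_def mem_Collect_eq g_linear scl_simps H_closed simp_thms)

lemma E1_zeroI:
  assumes "v \<in> eig 1" "l \<noteq> - r" "\<And>j. 3 \<le> j \<Longrightarrow> j \<le> n \<Longrightarrow> v (1, j) = 0"
  shows "v = 0"
  using E1_eqI[OF assms(1) zero_eig assms(2)] assms(3) by simp

text \<open>\<open>geom_propagate\<close> makes the row geometric with first entry c times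
  \<open>rowf u\<close>; summing that row must give \<open>rowf u\<close> back, which says c [n - 2]
  = 1.\<close>

lemma E1_line:
  assumes U: "inv_sub U" and l: "l \<noteq> - r" and c: "\<And>v. v \<in> U \<inter> eig 1 \<Longrightarrow> v (1, 3) = c * rowf v"
    and u: "u \<in> U \<inter> eig 1" "u \<noteq> 0"
  shows "rowf u \<noteq> 0" "1 - r\<^sup>2 = c * (1 - r ^ (2 * n) / r ^ 4)"
    "3 \<le> j \<Longrightarrow> j \<le> n \<Longrightarrow> u (1, j) = c * rowf u / r ^ 3 * r ^ j"
proof -
  show *: "u (1, j) = c * rowf u / r ^ 3 * r ^ j" if "3 \<le> j" "j \<le> n" for j
    by (rule geom_propagate[where f="\<lambda>v. c * rowf v", OF U _ c u(1) that]) (auto simp: E1_g_coords)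
  show 0: "rowf u \<noteq> 0"
  proof
    assume "rowf u = 0"
    then have "u = 0" using u * l by (intro E1_zeroI) auto
    then show False using u by simp
  qed
  show "1 - r\<^sup>2 = c * (1 - r ^ (2 * n) / r ^ 4)"
    using rowf_geom[OF *] 0 by (simp add: mult.assoc mult.left_commute[of c])
qed

text \<open>With \<open>alpha\<close> nonzero the row is determined by \<open>rowf\<close>, so
  \<open>K \<inter> eig 1\<close> has dimension at most one.\<close>

lemma E1_sub_line:
  assumes K: "inv_sub K" "K \<noteq> H" and U: "inv_sub U" "U \<subseteq> K" and l: "l \<noteq> - r" and alpha: "alpha \<noteq> 0"
    and u: "u \<in> U \<inter> eig 1" "u \<noteq> 0"
  shows "K \<inter> eig 1 \<subseteq> U"
proof
  fix v assume v: "v \<in> K \<inter> eig 1"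
  have c: "v (1, 3) = - beta / alpha * rowf v" if "v \<in> K \<inter> eig 1" for v
    by (rule proper_E1_ratio[OF K l that alpha])
  have u': "u \<in> K \<inter> eig 1" using u U by auto
  show "v \<in> U"
  proof (cases "v = 0")
    case False
    note 1 = E1_line[OF K(1) l c u' u(2)] and 2 = E1_line[OF K(1) l c v False]
    have F: "rowf v / rowf u \<in> F" using v u' rowf_F by auto
    have *: "v = scl (rowf v / rowf u) u"
    proof (rule E1_eqI)
      show "v (1, j) = scl (rowf v / rowf u) u (1, j)" if "3 \<le> j" "j \<le> n" for j
        using 1(1) 1(3)[OF _ that] 2(3)[OF _ that] by simp
    qed (use v u' F l in \<open>simp_all add: eig_linear\<close>)
    show ?thesis by (subst *) (use inv_subD(4)[OF U(1) F] u in blast)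
  qed (use U inv_subD in blast)
qed

lemma xv_shift:
  assumes "l \<noteq> - r" "3 \<le> j" "j < n"
  shows "g j (xv j) = xv (j + 1)"
proof (rule E1_eqI)
  show "g j (xv j) \<in> eig 1" using assms by (intro E1_stable xv_E1) auto
  show "xv (j + 1) \<in> eig 1" using assms by (intro xv_E1) auto
  show "g j (xv j) (1, i) = xv (j + 1) (1, i)" if i: "3 \<le> i" "i \<le> n" for i
  proof -
    consider "i = j" | "i = j + 1" | "i \<noteq> j" "i \<noteq> j + 1" by blast
    then show ?thesis
      using i assms by cases (simp_all add: E1_g_coords xv_coord)
  qed
qed (use assms in auto)

text \<open>For l other than - r these vectors span the kernel of \<open>rowf\<close> on
  \<open>eig 1\<close>, the standard summand; the factor 1 / r balances the weights r^k and r^(k +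
  1).\<close>

definition yv :: "nat \<Rightarrow> nat \<times> nat \<Rightarrow> complex" where
  "yv k = xv k - scl (1 / r) (xv (k + 1))"

lemma yv_E1: "l \<noteq> - r \<Longrightarrow> 3 \<le> k \<Longrightarrow> k < n \<Longrightarrow> yv k \<in> eig 1"
  unfolding yv_def by (intro eig_linear xv_E1) auto

lemma yv_coord:
  "3 \<le> k \<Longrightarrow> 3 \<le> i \<Longrightarrow> yv k (1, i) = (if i = k then 1 else if i = k + 1 then - 1 / r else 0)"
  by (simp add: yv_def xv_coord)

lemma rowf_yv: "3 \<le> k \<Longrightarrow> k < n \<Longrightarrow> rowf (yv k) = 0"
  unfolding yv_def rowf_linear by (simp add: rowf_xv power_add)

text \<open>On \<open>eig 1\<close> the operator \<open>g k - r\<close> has rank one, and the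
  coefficient measures how far the row is from being geometric between k and k + 1.\<close>

lemma twist_yv:
  assumes "l \<noteq> - r" "v \<in> eig 1" "3 \<le> k" "k < n"
  shows "g k v - scl r v = scl (v (1, k + 1) - r * v (1, k)) (yv k)"
proof (rule E1_eqI)
  have H: "v \<in> H" using assms eig_H by blast
  show "g k v - scl r v \<in> eig 1" using assms by (intro eig_linear E1_stable) auto
  show "scl (v (1, k + 1) - r * v (1, k)) (yv k) \<in> eig 1"
    using assms by (intro eig_linear yv_E1) (auto intro!: diff_F mult_F H_F[OF H])
  show "(g k v - scl r v) (1, i) = scl (v (1, k + 1) - r * v (1, k)) (yv k) (1, i)" if "3 \<le> i" "i \<le> n" for i
  proof -
    have mr: "m = 1 / r - r" by (rule m_alt)
    consider "i = k" | "i = k + 1" | "i \<noteq> k" "i \<noteq> k + 1" by blast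
    then show ?thesis
      using that assms by cases (simp_all add: E1_g_coords yv_coord mr left_diff_distrib diff_divide_distrib)
  qed
qed (use assms in auto)

lemma yv_step:
  assumes "inv_sub U" "l \<noteq> - r" "yv j \<in> U" "3 \<le> j" "j < n" "3 \<le> k" "k < n" "k = j + 1 \<or> j = k + 1"
  shows "yv k \<in> U"
proof -
  have "g k (yv j) - scl r (yv j) \<in> U"
    using assms by (intro inv_sub_diff inv_subD) auto
  also have "g k (yv j) - scl r (yv j) = scl (yv j (1, k + 1) - r * yv j (1, k)) (yv k)"
    using assms by (intro twist_yv yv_E1)
  also have "yv j (1, k + 1) - r * yv j (1, k) = 1"
    using assms(8) assms by (auto simp: yv_coord)
  finally show ?thesis by (simp add: scl_simps)
qed

text \<open>A geometric row with \<open>rowf\<close> zero vanishes because [n - 2] is nonzero. So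
  some \<open>g k - r\<close> does not kill \<open>u\<close> and yields \<open>yv k\<close>;
  neighbours then give every \<open>yv j\<close>, and these exhaust the kernel of
  \<open>rowf\<close>.\<close>

lemma E1_sub_standard:
  assumes U: "inv_sub U" and l: "l \<noteq> - r" and A0: "\<And>v. v \<in> K \<inter> eig 1 \<Longrightarrow> rowf v = 0" and UK: "U \<subseteq> K"
    and u: "u \<in> U \<inter> eig 1" "u \<noteq> 0"
  shows "K \<inter> eig 1 \<subseteq> U"
proof -
  have "\<exists>k. 3 \<le> k \<and> k < n \<and> u (1, k + 1) \<noteq> r * u (1, k)"
  proof (rule ccontr)
    assume *: "\<not> ?thesis"
    have j: "u (1, j) = u (1, 3) / r ^ 3 * r ^ j" if "3 \<le> j" "j \<le> n" for j
      using that
    proof (induction j rule: dec_induct)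
      case (step j)
      then have "u (1, j + 1) = r * u (1, j)" using * by auto
      then show ?case using step by (simp add: Suc_eq_plus1 power_add)
    qed simp
    have "u (1, 3) * (1 - r ^ (2 * n) / r ^ 4) = 0"
      using rowf_geom[OF j] A0 u UK by auto
    moreover have "r ^ (2 * n) \<noteq> r ^ 4" by (rule r_pow_2n_neq_r_pow4)
    ultimately have "u (1, 3) = 0" by simp
    then show False using E1_zeroI[of u] u l j by auto
  qed
  then obtain k where k: "3 \<le> k" "k < n" "u (1, k + 1) \<noteq> r * u (1, k)" by blast
  have uH: "u \<in> H" using u eig_H by blast
  have "g k u - scl r u \<in> U" using U u k by (intro inv_sub_diff inv_subD) auto
  then have yk: "yv k \<in> U"
    using scl_cancel[OF U, of "u (1, k + 1) - r * u (1, k)" "yv k"] twist_yv[OF l, of u k] u k H_F[OF uH] by simp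
  have y3: "yv 3 \<in> U" using k(1) yk k(2)
  proof (induction k rule: dec_induct)
    case (step k)
    then show ?case using yv_step[OF U l, of "Suc k" k] by auto
  qed
  have y: "yv j \<in> U" if "3 \<le> j" "j < n" for j using that
  proof (induction j rule: dec_induct)
    case base show ?case by fact
  next
    case (step j)
    then show ?case using yv_step[OF U l, of j "Suc j"] by auto
  qed
  \<comment> \<open>Elimination of the leading row entries by \<open>yv s\<close>; at s = n the one
    remaining entry is forced to be zero by \<open>rowf v = 0\<close>.\<close>
  have main: "v \<in> U" if "s \<le> n" "3 \<le> s" "v \<in> eig 1" "rowf v = 0" "\<And>j. 3 \<le> j \<Longrightarrow> j < s \<Longrightarrow> v (1, j) = 0" for s v
    using that
  proof (induction s arbitrary: v rule: inc_induct)
    case base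
    have "rowf v = r ^ n * v (1, n) / r ^ 3"
    proof -
      have "{3..n} = insert n {3..<n}" using n_ge_3 by auto
      then show ?thesis using base by (simp add: rowf_def Rs_def)
    qed
    then have "v (1, j) = 0" if "3 \<le> j" "j \<le> n" for j
      using base that by (cases "j = n") auto
    then have "v = 0" using E1_zeroI base l by blast
    then show ?case using inv_subD(2)[OF U] by (simp only:)
  next
    case (step s)
    have F: "v (1, s) \<in> F" using step.prems step.hyps eig_H H_F by blast
    let ?v = "v - scl (v (1, s)) (yv s)"
    have "?v \<in> U"
    proof (rule step.IH)
      show "?v \<in> eig 1" using step.prems step.hyps F l by (intro eig_linear yv_E1) auto
      show "rowf ?v = 0" using step.prems step.hyps by (simp add: rowf_linear rowf_yv)
      show "?v (1, j) = 0" if "3 \<le> j" "j < Suc s" for j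
        using step.prems step.hyps that by (cases "j = s") (auto simp: yv_coord)
    qed (use step.prems step.hyps in auto)
    then have "?v + scl (v (1, s)) (yv s) \<in> U"
      using y[of s] step.prems step.hyps F by (intro inv_subD(3,4)[OF U]) auto
    then show ?case by simp
  qed
  show ?thesis using main[of 3] A0 n_ge_3 by auto
qed

lemma twist_eig:
  assumes "inv_sub K" "K \<noteq> H" "1 \<le> k" "k < n" "v \<in> K"
  shows "g k v - scl r v \<in> eig k"
proof -
  have "g k (g k v - scl r v) = scl (- 1 / r) (g k v - scl r v)"
    unfolding g_linear proper_quadratic[OF assms]
  proof (rule ext)
    fix p
    have "v p - m * x - r * x = (- 1 / r) * (x - r * v p)" for x
      by (simp add: m_alt field_simps)
    then show "(v - scl m (g k v) - scl r (g k v)) p = scl (- 1 / r) (g k v - scl r v) p" by simp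
  qed
  moreover have "v \<in> H" using assms inv_subD by blast
  ultimately show ?thesis by (simp add: eig_def H_closed g_H)
qed

text \<open>The map \<open>(g 1 - r) (g 2 - r)\<close> sends \<open>v\<close> to \<open>v\<close> plus a multiple of \<open>xv 3\<close>, and \<open>xv 3\<close> generates all of
  \<open>eig 1\<close>. The multiple cannot vanish identically because \<open>[n] \<noteq> 0\<close> at \<open>q = r\<^sup>2\<close>.\<close>

lemma E1_sub_all:
  assumes U: "inv_sub U" "U \<noteq> H" and l: "l = - (r ^ 3)" and u: "u \<in> U \<inter> eig 1" "u \<noteq> 0"
  shows "eig 1 \<subseteq> U"
proof -
  have l': "l \<noteq> - r"
  proof
    assume "l = - r"
    then have "r ^ 3 = r" using l by simp
    then have "r * r\<^sup>2 = r" by (simp add: power2_eq_square power3_eq_cube)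
    then show False using r_sq_neq_1 by simp
  qed
  have lr: "l + r \<noteq> 0" using l' by (simp add: add_eq_0_iff2)
  have kap: "m * l / (l + r) = - r"
  proof -
    have "m * r = 1 - r\<^sup>2" by (simp add: m_factored)
    have "m * l = - (m * r) * r * r" by (simp add: l power3_eq_cube)
    also have "\<dots> = - r * (l + r)" unfolding \<open>m * r = 1 - r\<^sup>2\<close>
      by (simp add: l algebra_simps power2_eq_square power3_eq_cube)
    finally show ?thesis using lr by simp
  qed
  \<comment> \<open>\<open>d v\<close> is the change of the entry (1, 3) under the product in
    \<open>T\<close>; the entries (1, j) with j > 3 do not change.\<close>
  define d where "d v = (1 + 1 / r\<^sup>2) * v (1, 3) + r\<^sup>2 * rowf v" for v
  have dF: "d v \<in> F" if "v \<in> eig 1" for v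
    using H_F[OF eig_H[OF that]] rowf_F[OF that] unfolding d_def by simp
  have T: "g 1 (g 2 v - scl r v) - scl r (g 2 v - scl r v) = v + scl (d v) (xv 3)"
    if v: "v \<in> U \<inter> eig 1" for v
  proof (rule E1_eqI)
    define h where "h = g 2 v - scl r v"
    have v': "v \<in> U" "v \<in> eig 1" using v by auto
    have hU: "h \<in> U" using v' n_ge_3 unfolding h_def by (intro inv_sub_diff inv_subD U(1)) auto
    show "g 1 (g 2 v - scl r v) - scl r (g 2 v - scl r v) \<in> eig 1"
      using twist_eig[OF U _ _ hU] n_ge_3 by (simp add: h_def)
    have "v - scl (- d v) (xv 3) \<in> eig 1"
      using v' l' n_ge_3 dF by (intro eig_linear xv_E1) auto
    also have "v - scl (- d v) (xv 3) = v + scl (d v) (xv 3)" by (rule ext) simp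
    finally show "v + scl (d v) (xv 3) \<in> eig 1" .
    have v12: "v (1, 2) = - r * rowf v" using proper_E1(1)[OF U l' v] kap by simp
    show "(g 1 (g 2 v - scl r v) - scl r (g 2 v - scl r v)) (1, j) = (v + scl (d v) (xv 3)) (1, j)"
      if j: "3 \<le> j" "j \<le> n" for j
    proof -
      have *: "(g 1 h - scl r h) (1, j) = h (2, j) - r * h (1, j)"
        using j by (simp add: g_def pairs_def)
      show ?thesis
      proof (cases "j = 3")
        case True
        have "Rs 4 3 v = 0"
          unfolding Rs_def using E1_coords[OF v'(2)] by simp
        moreover have "Cs 2 3 v = r * v (1, 3)"
        proof -
          have "{1..<2} = {1::nat}" by auto
          then show ?thesis by (simp add: Cs_def)
        qed
        moreover have "v (2, 3) = - v (1, 3) / r" using E1_coords(1)[OF v'(2), of 3] by simp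
        ultimately have "h (2, 3) = (- v (1, 3) / r) / l + m / l * v (1, 3) + v (1, 3)"
          using n_ge_3 by (simp add: h_def g_def pairs_def L_def power2_eq_square)
        also have "\<dots> = (m - 1 / r) / l * v (1, 3) + v (1, 3)"
          by (simp add: diff_divide_distrib left_diff_distrib)
        also have "(m - 1 / r) / l = 1 / r\<^sup>2"
          by (simp add: m_alt) (simp add: l power2_eq_square power3_eq_cube)
        finally have 1: "h (2, 3) = v (1, 3) / r\<^sup>2 + v (1, 3)" by simp
        have h13: "h (1, 3) = - r * rowf v - m * v (1, 3) - r * v (1, 3)"
          using n_ge_3 v12 by (simp add: h_def g_def pairs_def)
        have "r * h (1, 3) = - (r\<^sup>2 * rowf v) - r * (m + r) * v (1, 3)"
          unfolding h13 by (simp add: algebra_simps power2_eq_square)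
        also have "r * (m + r) = 1" by (simp add: m_alt)
        finally have 2: "r * h (1, 3) = - (r\<^sup>2 * rowf v) - v (1, 3)" by simp
        have "h (2, 3) - r * h (1, 3) = v (1, 3) + d v"
          unfolding 1 2 d_def by (simp add: algebra_simps)
        then show ?thesis unfolding h_def[symmetric] * by (simp add: True xv_coord)
      next
        case False
        have "h (1, j) = 0" "h (2, j) = v (3, j) - r * v (2, j)"
          using j False by (simp_all add: h_def g_def pairs_def)
        moreover have "v (3, j) = 0" "v (2, j) = - v (1, j) / r"
          using E1_coords[OF v'(2)] j by auto
        ultimately have "h (2, j) - r * h (1, j) = v (1, j)" by simp
        then show ?thesis unfolding h_def[symmetric] * using False j by (simp add: xv_coord)
      qed
    qed
  qed (use l' in auto)
  have "\<exists>v\<in>U \<inter> eig 1. d v \<noteq> 0"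
  proof (rule ccontr)
    assume "\<not> ?thesis"
    then have *: "d v = 0" if "v \<in> U \<inter> eig 1" for v using that by blast
    \<comment> \<open>The constant that solves d v = 0 for v (1, 3) in terms of
      \<open>rowf v\<close>; the equation of \<open>E1_line\<close> for it amounts to r^(2n) =
      1.\<close>
    define c where "c = - (r ^ 4) / (1 + r\<^sup>2)"
    have c: "c * (1 + r\<^sup>2) = - (r ^ 4)" using one_plus_r_sq_neq_0 by (simp add: c_def)
    have "v (1, 3) = c * rowf v" if "v \<in> U \<inter> eig 1" for v
    proof -
      have "r\<^sup>2 * d v = (1 + r\<^sup>2) * v (1, 3) + r ^ 4 * rowf v"
        unfolding d_def by (simp add: distrib_left distrib_right power2_eq_square power4_eq_xxxx)
      then have "(1 + r\<^sup>2) * v (1, 3) = - (r ^ 4) * rowf v"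
        using *[OF that] by (simp add: add_eq_0_iff2)
      also have "\<dots> = (1 + r\<^sup>2) * (c * rowf v)" unfolding c[symmetric] by (simp only: mult_ac)
      finally show ?thesis using one_plus_r_sq_neq_0 by (simp only: mult_cancel_left) simp
    qed
    then have e: "1 - r\<^sup>2 = c * (1 - r ^ (2 * n) / r ^ 4)" by (rule E1_line(2)[OF U(1) l' _ u])
    have "(1 - r\<^sup>2) * (1 + r\<^sup>2) = c * (1 + r\<^sup>2) * (1 - r ^ (2 * n) / r ^ 4)"
      unfolding e by (simp only: mult_ac)
    then have "1 - r\<^sup>2 * r\<^sup>2 = - (r ^ 4) + r ^ (2 * n)"
      unfolding c by (simp add: distrib_left right_diff_distrib left_diff_distrib)
    then have "r ^ (2 * n) = 1" by (simp add: power2_eq_square power4_eq_xxxx)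
    then show False using r_pow_neq_1[of n] n_ge_3 by simp
  qed
  then obtain v where v: "v \<in> U \<inter> eig 1" "d v \<noteq> 0" by blast
  have "scl (d v) (xv 3) \<in> U"
  proof -
    have "g 2 v - scl r v \<in> U" using v n_ge_3 by (intro inv_sub_diff inv_subD U(1)) auto
    then have "g 1 (g 2 v - scl r v) - scl r (g 2 v - scl r v) - v \<in> U"
      using v n_ge_3 by (intro inv_sub_diff inv_subD U(1)) auto
    then show ?thesis using T[OF v(1)] by simp
  qed
  then have x3: "xv 3 \<in> U" using scl_cancel[OF U(1)] dF v by blast
  have x: "xv j \<in> U" if "3 \<le> j" "j \<le> n" for j using that
  proof (induction j rule: dec_induct)
    case base show ?case by fact
  next
    case (step j)
    then show ?case using xv_shift[OF l', of j] inv_subD(5)[OF U(1), of j "xv j"] by (simp add: Suc_eq_plus1)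
  qed
  have main: "v \<in> U" if "s \<le> n + 1" "3 \<le> s" "v \<in> eig 1" "\<And>j. 3 \<le> j \<Longrightarrow> j < s \<Longrightarrow> v (1, j) = 0" for s v
    using that
  proof (induction s arbitrary: v rule: inc_induct)
    case base
    then have "v = 0" using E1_zeroI l' by auto
    then show ?case using inv_subD(2)[OF U(1)] by (simp only:)
  next
    case (step s)
    have F: "v (1, s) \<in> F" using step.prems step.hyps eig_H H_F by blast
    let ?v = "v - scl (v (1, s)) (xv s)"
    have "?v \<in> U"
    proof (rule step.IH)
      show "?v \<in> eig 1" using step.prems step.hyps F l' by (intro eig_linear xv_E1) auto
      show "?v (1, j) = 0" if "3 \<le> j" "j < Suc s" for j
        using step.prems step.hyps that by (cases "j = s") (auto simp: xv_coord)
    qed (use step.prems step.hyps in auto)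
    then have "?v + scl (v (1, s)) (xv s) \<in> U"
      using x[of s] step.prems step.hyps F by (intro inv_subD(3,4)[OF U(1)]) auto
    then show ?case by simp
  qed
  show ?thesis using main[of 3] n_ge_3 by auto
qed

subsection \<open>Splitting off the trivial part\<close>

text \<open>By the braid relation, \<open>g k\<close> followed by \<open>g (k + 1)\<close> maps
  eigenvectors of \<open>g (k + 1)\<close> to eigenvectors of \<open>g k\<close>. The way back to v
  inside \<open>U\<close> uses that on \<open>K\<close> the inverse of each operator is g +
  m.\<close>

lemma E_transfer:
  assumes K: "inv_sub K" "K \<noteq> H" and U: "inv_sub U" and k: "1 \<le> k" "k + 1 < n"
    and E: "K \<inter> eig k \<subseteq> U"
  shows "K \<inter> eig (k + 1) \<subseteq> U"
proof
  fix v assume "v \<in> K \<inter> eig (k + 1)"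
  then have v: "v \<in> K" and gv: "g (k + 1) v = scl (- 1 / r) v" by (auto simp: eig_def)
  have gK1: "g k v \<in> K" using inv_subD(5)[OF K(1), of k v] v k by simp
  have gK: "g (k + 1) (g k v) \<in> K" using inv_subD(5)[OF K(1), of "k + 1" "g k v"] gK1 k by simp
  have "g k (g (k + 1) (g k v)) = scl (- 1 / r) (g (k + 1) (g k v))"
    unfolding braid[OF k] gv g_linear ..
  then have "g (k + 1) (g k v) \<in> eig k"
    using gK inv_subD(1)[OF K(1)] by (simp add: eig_def)
  then have x: "g (k + 1) (g k v) \<in> U" using E gK by blast
  have "g (k + 1) (g (k + 1) (g k v)) + scl m (g (k + 1) (g k v)) = g k v"
    using proper_quadratic[OF K, of "k + 1" "g k v"] k gK1 by simp
  moreover have "g (k + 1) (g (k + 1) (g k v)) + scl m (g (k + 1) (g k v)) \<in> U"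
    using inv_subD(3)[OF U inv_subD(5)[OF U _ _ x] inv_subD(4)[OF U m_F x], of "k + 1"] k by simp
  ultimately have y: "g k v \<in> U" by simp
  have "g k (g k v) + scl m (g k v) = v"
    using proper_quadratic[OF K, of k v] k v by simp
  moreover have "g k (g k v) + scl m (g k v) \<in> U"
    using inv_subD(3)[OF U inv_subD(5)[OF U _ _ y] inv_subD(4)[OF U m_F y], of k] k by simp
  ultimately show "v \<in> U" by simp
qed

lemma E_all:
  assumes "inv_sub K" "K \<noteq> H" "inv_sub U" "1 \<le> k" "k < n" "K \<inter> eig 1 \<subseteq> U"
  shows "K \<inter> eig k \<subseteq> U"
  using assms(4,5)
proof (induction k rule: dec_induct)
  case (step k)
  then show ?case using E_transfer[OF assms(1-3), of k] by (simp add: Suc_eq_plus1)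
qed (use assms in simp)

lemma diff_in:
  assumes "inv_sub K" "K \<noteq> H" "inv_sub U" "K \<inter> eig 1 \<subseteq> U" "1 \<le> k" "k < n" "v \<in> K"
  shows "g k v - scl r v \<in> U"
proof -
  have "g k v - scl r v \<in> K"
    using assms by (intro inv_sub_diff[OF assms(1)] inv_subD(4,5)[OF assms(1)]) auto
  moreover have "g k v - scl r v \<in> eig k" using assms by (intro twist_eig)
  ultimately show ?thesis using E_all[OF assms(1,2,3,5,6,4)] by blast
qed

lemma all_triv:
  assumes "inv_sub K" "K \<noteq> H" "K \<inter> eig 1 \<subseteq> {0}" "v \<in> K"
  shows "triv v"
  unfolding triv_def
proof (intro conjI ballI)
  show "v \<in> H" using assms inv_subD by blast
  fix k assume "k \<in> {1..<n}"
  then have "g k v - scl r v \<in> {0}"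
    using assms by (intro diff_in[OF assms(1,2) inv_sub_0 assms(3)]) auto
  then show "g k v = scl r v" by (simp only: singleton_iff right_minus_eq)
qed

text \<open>\<open>chain s v d\<close> is \<open>g (s + 1 - d) \<cdots> g s v\<close>. Summing these over the coset representatives, with weights
  \<open>r ^ d\<close>, turns a vector fixed by the first \<open>s - 1\<close> generators (up to \<open>r\<close>) into one fixed by
  the first \<open>s\<close>; modulo vectors on which all \<open>g k - r\<close> vanish this multiplies by \<open>[s + 1]\<close>.\<close>

primrec chain :: "nat \<Rightarrow> (nat \<times> nat \<Rightarrow> complex) \<Rightarrow> nat \<Rightarrow> nat \<times> nat \<Rightarrow> complex" where
  "chain s v 0 = v"
| "chain s v (Suc d) = g (s - d) (chain s v d)"

context
  fixes s v
  assumes s: "s < n" and v: "\<And>k. 1 \<le> k \<Longrightarrow> k < s \<Longrightarrow> g k v = scl r v"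
begin

lemma chain_below: "1 \<le> k \<Longrightarrow> k + d < s \<Longrightarrow> g k (chain s v d) = scl r (chain s v d)"
proof (induction d)
  case (Suc d)
  have "g k (chain s v (Suc d)) = g (s - d) (g k (chain s v d))"
    using Suc.prems s commute[of k "s - d" "chain s v d"] by simp
  also have "g k (chain s v d) = scl r (chain s v d)" using Suc.prems by (intro Suc.IH) auto
  also have "g (s - d) (scl r (chain s v d)) = scl r (chain s v (Suc d))" by (simp only: g_linear chain.simps)
  finally show ?case .
qed (simp add: v)

text \<open>\<open>g k\<close> commutes past the letters of index below k - 1. When it meets
  \<open>g (k - 1)\<close> followed by \<open>g k\<close>, the braid relation turns it into a
  \<open>g (k - 1)\<close> acting further in, where \<open>chain_below\<close> applies.\<close>

lemma chain_above: "d \<le> s \<Longrightarrow> k \<le> s \<Longrightarrow> s + 1 < k + d \<Longrightarrow> g k (chain s v d) = scl r (chain s v d)"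
proof (induction d)
  case (Suc d)
  define p where "p = s - d"
  have p: "1 \<le> p" "p + d = s" "p < k" using Suc.prems by (auto simp: p_def)
  show ?case
  proof (cases "k = p + 1")
    case True
    then obtain e where e: "d = Suc e" using p Suc.prems by (cases d) auto
    have "g k (chain s v (Suc d)) = g (p + 1) (g p (g (p + 1) (chain s v e)))"
    proof -
      have "s - d = p" "s - e = p + 1" using p e by auto
      then show ?thesis by (simp only: e chain.simps True)
    qed
    also have "\<dots> = g p (g (p + 1) (g p (chain s v e)))"
      using p Suc.prems s True by (intro braid[symmetric]) auto
    also have "g p (chain s v e) = scl r (chain s v e)"
      using p e by (intro chain_below) auto
    also have "g p (g (p + 1) (scl r (chain s v e))) = scl r (chain s v (Suc d))"
    proof -
      have "s - d = p" "s - e = p + 1" using p e by auto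
      then show ?thesis by (simp only: e chain.simps g_linear)
    qed
    finally show ?thesis .
  next
    case False
    have "g k (chain s v (Suc d)) = g k (g p (chain s v d))" by (simp add: p_def)
    also have "\<dots> = g p (g k (chain s v d))"
      using p False Suc.prems s by (intro commute[symmetric]) auto
    also have "g k (chain s v d) = scl r (chain s v d)"
      using Suc.prems p False by (intro Suc.IH) auto
    finally show ?thesis by (simp only: g_linear p_def chain.simps)
  qed
qed simp

text \<open>\<open>g k\<close> mixes only the terms d = s - k and d = s - k + 1, by the same Burau
  block as on columns, and scales the others by r. With the position p fixed this is
  \<open>twist_sum\<close> in the variable d.\<close>

lemma chain_sum:
  assumes K: "inv_sub K" "K \<noteq> H" "v \<in> K" and k: "1 \<le> k" "k \<le> s"
  shows "g k (\<Sum>d\<in>{0..s}. scl (r ^ d) (chain s v d)) = scl r (\<Sum>d\<in>{0..s}. scl (r ^ d) (chain s v d))"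
proof (rule ext)
  fix p
  have YK: "chain s v d \<in> K" if "d \<le> s" for d
    using that s by (induction d) (auto intro: K inv_subD[OF K(1)])
  have "(\<Sum>d\<in>{0..s}. r ^ d * g k (chain s v d) p) = r * (\<Sum>d\<in>{0..s}. r ^ d * chain s v d p)"
  proof (rule twist_sum[where k="s - k"])
    show "g k (chain s v (s - k)) p = chain s v (s - k + 1) p"
      using k by (simp flip: Suc_eq_plus1)
    show "g k (chain s v (s - k + 1)) p = chain s v (s - k) p - m * chain s v (s - k + 1) p"
      using k s YK[of "s - k"] proper_quadratic[OF K(1,2), of k "chain s v (s - k)"]
      by (simp flip: Suc_eq_plus1)
    show "g k (chain s v d) p = r * chain s v d p" if "d \<in> {0..s}" "d \<noteq> s - k" "d \<noteq> s - k + 1" for d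
    proof (cases "k + d < s")
      case True
      then show ?thesis using chain_below k by simp
    next
      case False
      then have "s + 1 < k + d" using that k by auto
      then show ?thesis using chain_above that k by simp
    qed
  qed (use k in auto)
  then show "g k (\<Sum>d\<in>{0..s}. scl (r ^ d) (chain s v d)) p = scl r (\<Sum>d\<in>{0..s}. scl (r ^ d) (chain s v d)) p"
    unfolding g_sum sum_fun_apply g_linear scl_apply .
qed

end

text \<open>The induction carries a vector on which \<open>g 1\<close>, ...,
  \<open>g (s - 1)\<close> are r and which is congruent modulo \<open>U\<close> to a multiple of v.
  Each step multiplies the coefficient by [s + 1], so c ends up as the q-factorial [n]!.\<close>

lemma split_off:
  assumes K: "inv_sub K" "K \<noteq> H" and U: "inv_sub U" "U \<subseteq> K"
    and KU: "\<And>k v. 1 \<le> k \<Longrightarrow> k < n \<Longrightarrow> v \<in> K \<Longrightarrow> g k v - scl r v \<in> U" and v: "v \<in> K"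
  obtains u c where "u \<in> K" "triv u" "c \<in> F" "c \<noteq> 0" "u - scl c v \<in> U"
proof -
  have "\<exists>u\<in>K. \<exists>c\<in>F. c \<noteq> 0 \<and> (\<forall>k. 1 \<le> k \<and> k < s \<longrightarrow> g k u = scl r u) \<and> u - scl c v \<in> U" if "1 \<le> s" "s \<le> n" for s
    using that
  proof (induction s rule: dec_induct)
    case base
    have "v - scl 1 v = 0" by (simp only: scl_simps diff_self)
    then have "v - scl 1 v \<in> U" using inv_subD(2)[OF U(1)] by (simp only:)
    moreover have "\<forall>k. 1 \<le> k \<and> k < (1::nat) \<longrightarrow> g k v = scl r v" by auto
    ultimately show ?case
      by (intro bexI[OF _ v] bexI[OF _ one_F] conjI one_neq_zero)
  next
    case (step s)
    from step.IH[OF Suc_leD[OF step.prems]] obtain u c where u: "u \<in> K" "c \<in> F" "c \<noteq> 0"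
      and gu: "\<forall>k. 1 \<le> k \<and> k < s \<longrightarrow> g k u = scl r u" and uU: "u - scl c v \<in> U"
      by (elim bexE conjE)
    note u = u gu[rule_format, OF conjI] uU
    have s: "s < n" using step.prems by simp
    define u' where "u' = (\<Sum>d\<in>{0..s}. scl (r ^ d) (chain s u d))"
    define C where "C = (\<Sum>d\<in>{0..s}. r ^ (2 * d))"
    have YK: "chain s u d \<in> K" if "d \<le> s" for d
      using that s by (induction d) (auto intro: u inv_subD[OF K(1)])
    have YU: "chain s u d - scl (r ^ d) u \<in> U" if "d \<le> s" for d
      using that
    proof (induction d)
      case 0
      have "chain s u 0 - scl (r ^ 0) u = 0" by (simp only: chain.simps power_0 scl_simps diff_self)
      then show ?case using inv_subD(2)[OF U(1)] by (simp only:)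
    next
      case (Suc d)
      have ih: "chain s u d - scl (r ^ d) u \<in> U" using Suc.prems by (intro Suc.IH) simp
      have "(g (s - d) (chain s u d) - scl r (chain s u d)) + scl r (chain s u d - scl (r ^ d) u) \<in> U"
        by (rule inv_subD(3)[OF U(1) KU[OF _ _ YK] inv_subD(4)[OF U(1) r_F ih]]) (use Suc.prems s in simp_all)
      also have "(g (s - d) (chain s u d) - scl r (chain s u d)) + scl r (chain s u d - scl (r ^ d) u) = chain s u (Suc d) - scl (r ^ Suc d) u"
        by (rule ext) (simp add: algebra_simps)
      finally show ?case .
    qed
    have "(\<Sum>d\<in>{0..s}. scl (r ^ d) (chain s u d - scl (r ^ d) u)) + scl C (u - scl c v) \<in> U"
    proof (rule inv_subD(3)[OF U(1) inv_sub_sum[OF U(1)] inv_subD(4)[OF U(1) _ uU]])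
      show "scl (r ^ d) (chain s u d - scl (r ^ d) u) \<in> U" if "d \<in> {0..s}" for d
        by (rule inv_subD(4)[OF U(1) _ YU]) (use that in simp_all)
    qed (simp add: C_def)
    also have "(\<Sum>d\<in>{0..s}. scl (r ^ d) (chain s u d - scl (r ^ d) u)) + scl C (u - scl c v) = u' - scl (C * c) v"
    proof (rule ext)
      fix p
      have "(\<Sum>d\<in>{0..s}. r ^ d * (chain s u d p - r ^ d * u p)) = (\<Sum>d\<in>{0..s}. r ^ d * chain s u d p) - C * u p"
        unfolding C_def sum_distrib_right sum_subtractf[symmetric]
        by (intro sum.cong refl) (simp add: right_diff_distrib mult_2 power_add)
      then show "((\<Sum>d\<in>{0..s}. scl (r ^ d) (chain s u d - scl (r ^ d) u)) + scl C (u - scl c v)) p = (u' - scl (C * c) v) p"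
        by (simp add: u'_def sum_fun_apply right_diff_distrib)
    qed
    finally have 1: "u' - scl (C * c) v \<in> U" .
    have "(1 - r\<^sup>2) * C = 1 - r ^ (2 * (s + 1))" unfolding C_def using geom[of 0 s] by simp
    then have 2: "C \<noteq> 0" using r_pow_neq_1[of "s + 1"] s by auto
    have 3: "u' \<in> K" unfolding u'_def
      by (rule inv_sub_sum[OF K(1)], rule inv_subD(4)[OF K(1) _ YK]) simp_all
    have 4: "g k u' = scl r u'" if "1 \<le> k" "k < Suc s" for k
      unfolding u'_def using that by (intro chain_sum[OF s u(4) K u(1)]) auto
    have "C * c \<in> F" using u by (simp add: C_def)
    moreover have "C * c \<noteq> 0" using 2 u(3) by simp
    moreover have "\<forall>k. 1 \<le> k \<and> k < Suc s \<longrightarrow> g k u' = scl r u'" using 4 by blast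
    ultimately show ?case using 1 by (intro bexI[OF _ 3] bexI[of _ "C * c"] conjI)
  qed
  from this[of n] obtain u c where "u \<in> K" "c \<in> F" "c \<noteq> 0" "\<forall>k. 1 \<le> k \<and> k < n \<longrightarrow> g k u = scl r u" "u - scl c v \<in> U"
    using n_ge_3 by auto
  moreover from this have "triv u" using inv_subD(1)[OF K(1)] by (auto simp: triv_def)
  ultimately show ?thesis using that by blast
qed

lemma E1_sub:
  assumes K: "inv_sub K" "K \<noteq> H" and U: "inv_sub U" "U \<subseteq> K" and u: "u \<in> U \<inter> eig 1" "u \<noteq> 0"
  shows "K \<inter> eig 1 \<subseteq> U"
proof -
  have uK: "u \<in> K \<inter> eig 1" using u U by auto
  have l1: "l \<noteq> - r" using E1_empty[OF K _ uK] u by blast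
  have UH: "U \<noteq> H" using K U inv_subD(1)[OF K(1)] by blast
  consider "alpha \<noteq> 0" | "l = - (r ^ 3)" | "l = r" "l \<noteq> - (r ^ 3)"
    by (auto simp: alpha_def eq_neg_iff_add_eq_0)
  then show ?thesis
  proof cases
    case 1
    then show ?thesis using E1_sub_line[OF K U l1 _ u] by blast
  next
    case 2
    then show ?thesis using E1_sub_all[OF U(1) UH _ u] by blast
  next
    case 3
    have "beta \<noteq> 0" using 3(2) l1 by (simp add: beta_def eq_neg_iff_add_eq_0)
    moreover have "alpha = 0" unfolding alpha_def by (simp add: 3(1))
    ultimately have "rowf v = 0" if "v \<in> K \<inter> eig 1" for v
      using proper_E1(2)[OF K l1 that] by simp
    then show ?thesis by (intro E1_sub_standard[OF U(1) l1 _ U(2) u])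
  qed
qed

text \<open>A nonzero \<open>U\<close> meets \<open>eig 1\<close> in a nonzero vector, since
  otherwise \<open>all_triv\<close> would make its vectors trivial. Then \<open>split_off\<close>
  gives a nonzero multiple of any v in \<open>K\<close> as a trivial vector modulo \<open>U\<close>,
  and that vector is zero.\<close>

lemma no_triv_simple:
  assumes K: "inv_sub K" "K \<noteq> H" and U: "inv_sub U" "U \<subseteq> K" "U \<noteq> {0}"
    and nt: "\<And>v. v \<in> K \<Longrightarrow> triv v \<Longrightarrow> v = 0"
  shows "U = K"
proof (rule antisym[OF U(2)], rule subsetI)
  fix v assume v: "v \<in> K"
  have UH: "U \<noteq> H" using K U inv_subD(1)[OF K(1)] by blast
  have "\<not> U \<inter> eig 1 \<subseteq> {0}"
    using all_triv[OF U(1) UH] nt U inv_subD(2)[OF U(1)] by blast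
  then obtain u where "u \<in> U \<inter> eig 1" "u \<noteq> 0" by blast
  then have E: "K \<inter> eig 1 \<subseteq> U" by (rule E1_sub[OF K U(1,2)])
  obtain u c where u: "u \<in> K" "triv u" "c \<in> F" "c \<noteq> 0" "u - scl c v \<in> U"
    using split_off[OF K U(1,2) diff_in[OF K U(1) E] v] by blast
  have "u = 0" using nt u by blast
  then have "u - scl c v = scl (- c) v" by (simp add: fun_eq_iff)
  then have "scl (- c) v \<in> U" using u(5) by (simp only:)
  then show "v \<in> U" by (rule scl_cancel[OF U(1)]) (use u in simp_all)
qed

text \<open>A trivial vector forces l r^(2n) = r^3. A nonzero vector of
  \<open>K \<inter> eig 1\<close> adds the equation c [n - 2] = 1 with c = - beta / alpha; together
  they give l = r^3 and hence r^(2n) = 1, which is excluded.\<close>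

lemma triv_all:
  assumes K: "inv_sub K" "K \<noteq> H" and t: "t \<in> K" "triv t" "t \<noteq> 0" and l: "l \<noteq> - (r ^ 3)" and v: "v \<in> K"
  shows "triv v"
proof (rule all_triv[OF K _ v], rule ccontr)
  assume "\<not> K \<inter> eig 1 \<subseteq> {0}"
  then obtain u where u: "u \<in> K \<inter> eig 1" "u \<noteq> 0" by blast
  define z where "z = r ^ (2 * n)"
  have lz: "l * z = r ^ 3" using triv_l[OF t(2,3)] by (simp add: z_def)
  have l1: "l \<noteq> - r" using E1_empty[OF K _ u(1)] u by blast
  have lr: "l + r \<noteq> 0" and lr3: "l + r ^ 3 \<noteq> 0" using l1 l by (auto simp: eq_neg_iff_add_eq_0)
  have "l \<noteq> r"
  proof
    assume "l = r"
    then have "r * z = r * r\<^sup>2" using lz by (simp add: power2_eq_square power3_eq_cube)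
    then have "z = r\<^sup>2" by simp
    moreover have "z = r\<^sup>2 * r ^ (2 * (n - 1))"
    proof -
      have "2 * n = 2 + 2 * (n - 1)" using n_ge_3 by simp
      then show ?thesis unfolding z_def by (metis power_add)
    qed
    ultimately show False using r_pow_neq_1[of "n - 1"] n_ge_3 by simp
  qed
  then have alpha: "alpha \<noteq> 0" using lr3 by (simp add: alpha_def)
  have c: "v (1, 3) = - beta / alpha * rowf v" if "v \<in> K \<inter> eig 1" for v
    by (rule proper_E1_ratio[OF K l1 that alpha])
  have "1 - r\<^sup>2 = - beta / alpha * (1 - z / r ^ 4)"
    using E1_line(2)[OF K(1) l1 c u] by (simp add: z_def)
  then have "alpha * (1 - r\<^sup>2) = - beta * (1 - z / r ^ 4)" using alpha by simp
  moreover have "alpha * (1 - r\<^sup>2) = (l + r ^ 3) * ((l - r) / (l * r\<^sup>2))"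
  proof -
    have "1 - r\<^sup>2 = m * r" by (simp add: m_factored)
    then show ?thesis unfolding alpha_def by (simp add: power2_eq_square power3_eq_cube)
  qed
  moreover have "- beta * (1 - z / r ^ 4) = (l + r ^ 3) * (l / (r\<^sup>2 * (l + r)) * (1 - z / r ^ 4))"
    unfolding beta_def by simp
  ultimately have "(l + r ^ 3) * ((l - r) / (l * r\<^sup>2)) = (l + r ^ 3) * (l / (r\<^sup>2 * (l + r)) * (1 - z / r ^ 4))"
    by (simp only:)
  then have *: "(l - r) / (l * r\<^sup>2) = l / (r\<^sup>2 * (l + r)) * (1 - z / r ^ 4)"
    using lr3 by (simp only: mult_cancel_left simp_thms)
  have "(l - r) * (l + r) = (l - r) / (l * r\<^sup>2) * (l * r\<^sup>2 * (l + r))" by simp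
  also have "\<dots> = l * l * (1 - z / r ^ 4)" unfolding * using lr by simp
  finally have "(l - r) * (l + r) = l * l * (1 - z / r ^ 4)" .
  then have "r * r = l * (l * z) / r ^ 4" by (simp add: left_diff_distrib right_diff_distrib distrib_left mult.commute)
  then have "r * r = l / r" unfolding lz by (simp add: power3_eq_cube power4_eq_xxxx)
  then have "r * r * r = l" by simp
  then have "l = r ^ 3" by (simp add: power3_eq_cube)
  then have "z = 1" using lz by simp
  then show False using r_pow_neq_1[of n] n_ge_3 by (simp add: z_def)
qed

subsection \<open>Uniqueness and the exceptional case\<close>

lemma triv_line:
  assumes K: "\<And>v. v \<in> K \<Longrightarrow> triv v" and U: "inv_sub U" "U \<subseteq> K" "U \<noteq> {0}" and KH: "K \<subseteq> H"
  shows "U = K"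
proof (rule antisym[OF U(2)], rule subsetI)
  fix v assume v: "v \<in> K"
  obtain u where u: "u \<in> U" "u \<noteq> 0" using U(3) inv_subD(2)[OF U(1)] by blast
  have uf: "u = scl (u (1, 2) / r ^ 3) triv_vec" using K U(2) u(1) by (intro triv_form) blast
  have vf: "v = scl (v (1, 2) / r ^ 3) triv_vec" using K v by (intro triv_form) blast
  have u0: "u (1, 2) \<noteq> 0"
  proof
    assume "u (1, 2) = 0"
    then have "u = scl (0 / r ^ 3) triv_vec" using uf by (simp only:)
    then have "u = 0" by (simp add: fun_eq_iff)
    then show False using u by blast
  qed
  have F: "v (1, 2) / u (1, 2) \<in> F" using u v U KH by (intro divide_F H_F) auto
  have "scl (v (1, 2) / u (1, 2)) u = scl (v (1, 2) / u (1, 2)) (scl (u (1, 2) / r ^ 3) triv_vec)"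
    by (subst uf) (rule refl)
  also have "\<dots> = scl (v (1, 2) / r ^ 3) triv_vec" using u0 by (simp add: fun_eq_iff)
  also have "\<dots> = v" by (rule vf[symmetric])
  finally show "v \<in> U" using inv_subD(4)[OF U(1) F u(1)] by (simp only:)
qed

lemma inv_sub_plus:
  assumes "inv_sub U" "inv_sub W"
  shows "inv_sub {u + v | u v. u \<in> U \<and> v \<in> W}" (is "inv_sub ?K")
  unfolding inv_sub_def
proof (intro conjI ballI subsetI)
  note U = inv_subD[OF assms(1)] and W = inv_subD[OF assms(2)]
  show "v \<in> H" if "v \<in> ?K" for v using that U(1) W(1) H_closed(2) by blast
  have "(0 :: nat \<times> nat \<Rightarrow> complex) = 0 + 0" by simp
  then show "0 \<in> ?K" using U(2) W(2) by blast
  show "x + y \<in> ?K" if xy: "x \<in> ?K" "y \<in> ?K" for x y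
  proof -
    obtain a b c d where *: "x = a + b" "y = c + d" "a \<in> U" "b \<in> W" "c \<in> U" "d \<in> W" using xy by blast
    have "x + y = (a + c) + (b + d)" unfolding * by (simp add: ac_simps)
    then show ?thesis using U(3) W(3) * by blast
  qed
  show "scl c x \<in> ?K" if "c \<in> F" "x \<in> ?K" for c x
    using that U(4) W(4) by (auto simp only: mem_Collect_eq scl_simps) blast
  show "g k x \<in> ?K" if k: "k \<in> {1..<n}" and x: "x \<in> ?K" for k x
  proof -
    obtain a b where *: "x = a + b" "a \<in> U" "b \<in> W" using x by blast
    have "g k x = g k a + g k b" unfolding * g_linear ..
    moreover have "g k a \<in> U" "g k b \<in> W" using U(5) W(5) * k by auto
    ultimately show ?thesis by blast
  qed
qed

text \<open>Both subspaces are compared with their sum, which has no invariant subspaces besides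
  itself and 0: either it consists of trivial vectors, or it contains none but 0. The exceptional
  parameters are those where a nonzero trivial vector can coexist with l = - r^3.\<close>

lemma unique_proper:
  assumes U: "inv_sub U" "U \<noteq> {0}" "U \<noteq> H" and W: "inv_sub W" "W \<noteq> {0}" "W \<noteq> H"
    and ne: "\<not> (l = - (r ^ 3) \<and> r ^ (2 * n) = - 1)"
  shows "U = W"
proof -
  define K where "K = {u + v | u v. u \<in> U \<and> v \<in> W}"
  have K: "inv_sub K" unfolding K_def using U(1) W(1) by (rule inv_sub_plus)
  have "phi k v = 0" if "k \<in> {1..<n}" "v \<in> K" for k v
    using that proper_iff_phi[OF U(1)] U(3) proper_iff_phi[OF W(1)] W(3) by (auto simp: K_def phi_linear)
  then have KH: "K \<noteq> H" using proper_iff_phi[OF K] by blast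
  have UK: "U \<subseteq> K"
  proof
    fix u assume "u \<in> U"
    moreover have "u = u + 0" by simp
    ultimately show "u \<in> K" unfolding K_def using inv_subD(2)[OF W(1)] by blast
  qed
  have WK: "W \<subseteq> K"
  proof
    fix u assume "u \<in> W"
    moreover have "u = 0 + u" by simp
    ultimately show "u \<in> K" unfolding K_def using inv_subD(2)[OF U(1)] by blast
  qed
  have "X = K" if X: "inv_sub X" "X \<subseteq> K" "X \<noteq> {0}" for X
  proof (cases "\<exists>t\<in>K. triv t \<and> t \<noteq> 0")
    case True
    then obtain t where t: "t \<in> K" "triv t" "t \<noteq> 0" by blast
    have "l * r ^ (2 * n) = r ^ 3" by (rule triv_l[OF t(2,3)])
    then have "r ^ (2 * n) = - 1" if "l = - (r ^ 3)"
    proof -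
      have "r ^ 3 * r ^ (2 * n) = r ^ 3 * - 1"
        using \<open>l * r ^ (2 * n) = r ^ 3\<close> unfolding that
        by (metis minus_minus mult_minus_left mult_minus_right mult_1_right)
      then show ?thesis by (simp only: mult_cancel_left power_eq_0_iff r_neq_0 simp_thms)
    qed
    then have "l \<noteq> - (r ^ 3)" using ne by blast
    then show ?thesis using inv_subD(1)[OF K]
      by (intro triv_line[OF triv_all[OF K KH t] X]) auto
  next
    case False
    then show ?thesis by (intro no_triv_simple[OF K KH X]) blast
  qed
  then show ?thesis using U W UK WK by blast
qed

section \<open>Cycles: an irreducible subspace at l = - r^3\<close>

text \<open>A quantum boundary map from pairs to points. Its kernel has codimension \<open>n - 1\<close> because of the
  single relation \<open>bdry_relation\<close>, and it is invariant for \<open>l = - r\<^sup>3\<close>.\<close>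

definition bdry :: "nat \<Rightarrow> (nat \<times> nat \<Rightarrow> complex) \<Rightarrow> complex" where
  "bdry j v = Cs j j v - Rs (j + 1) j v"

definition cycles :: "(nat \<times> nat \<Rightarrow> complex) set" where
  "cycles = {v \<in> H. \<forall>j\<in>{1..n}. bdry j v = 0}"

lemma bdry_linear:
  "bdry j (u + v) = bdry j u + bdry j v" "bdry j (u - v) = bdry j u - bdry j v" "bdry j (scl c v) = c * bdry j v" "bdry j 0 = 0"
  by (simp_all add: bdry_def Rs_linear Cs_linear right_diff_distrib)

text \<open>Every entry v (i, j) occurs twice with weight r^(i + j), once from each end and with
  opposite signs.\<close>

lemma bdry_relation: "(\<Sum>j\<in>{1..n}. r ^ j * bdry j v) = 0"
proof -
  let ?A = "{(i, j). i \<in> {1..n} \<and> j \<in> {1..n} \<and> i < j}"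
  have 1: "(\<Sum>j\<in>{1..n}. r ^ j * Cs j j v) = (\<Sum>(j, i)\<in>Sigma {1..n} (\<lambda>j. {1..<j}). r ^ j * (r ^ i * v (i, j)))"
    by (simp add: Cs_def sum_distrib_left sum.Sigma)
  also have "\<dots> = (\<Sum>(i, j)\<in>?A. r ^ j * (r ^ i * v (i, j)))"
    by (rule sum.reindex_bij_witness[where i="\<lambda>(i, j). (j, i)" and j="\<lambda>(i, j). (j, i)"]) auto
  finally have 1: "(\<Sum>j\<in>{1..n}. r ^ j * Cs j j v) = (\<Sum>(i, j)\<in>?A. r ^ j * (r ^ i * v (i, j)))" .
  have "(\<Sum>i\<in>{1..n}. r ^ i * Rs (i + 1) i v) = (\<Sum>(i, j)\<in>Sigma {1..n} (\<lambda>i. {i+1..n}). r ^ i * (r ^ j * v (i, j)))"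
    by (simp add: Rs_def sum_distrib_left sum.Sigma)
  also have "\<dots> = (\<Sum>(i, j)\<in>?A. r ^ i * (r ^ j * v (i, j)))"
    by (rule sum.cong) auto
  finally have 2: "(\<Sum>i\<in>{1..n}. r ^ i * Rs (i + 1) i v) = (\<Sum>(i, j)\<in>?A. r ^ j * (r ^ i * v (i, j)))"
    by (simp add: mult.left_commute)
  show ?thesis unfolding bdry_def right_diff_distrib sum_subtractf 1 2 by simp
qed

text \<open>At l = - r^3 the row and column parts of \<open>L k\<close> enter with opposite signs,
  as they do in \<open>bdry\<close>, so they combine into the factor 1 + m / r = 1 / r^2. The
  component k + 1 is recovered in \<open>cycles_inv\<close> from
  \<open>bdry_relation\<close>.\<close>

lemma bdry_g:
  assumes l: "l = - (r ^ 3)" and k: "1 \<le> k" "k < n" and j: "j \<in> {1..n}"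
  shows "j \<noteq> k \<Longrightarrow> j \<noteq> k + 1 \<Longrightarrow> bdry j (g k v) = r * bdry j v" "bdry k (g k v) = bdry (k + 1) v / r\<^sup>2"
proof -
  show "bdry j (g k v) = r * bdry j v" if "j \<noteq> k" "j \<noteq> k + 1"
  proof -
    have "k + 1 < j \<or> j \<le> k" "j + 1 \<le> k \<or> k + 1 < j + 1" using that by auto
    then show ?thesis
      using that k j Cs_g_twist[of k j j v] Rs_g_twist[of k j "j + 1" v]
      by (simp add: bdry_def right_diff_distrib)
  qed
  define c R x where crx: "c = Cs k (k + 1) v" "R = Rs (k + 2) (k + 1) v" "x = v (k, k + 1)"
  have e: "k + 1 + 1 = k + 2" by simp
  have "bdry k (g k v) = c - (r ^ (k + 1) * L k v + R)"
    using k Cs_g(1)[of k k v] Rs_g(1)[of k "k + 2" v] Rs_split[of "k + 1" k "g k v", unfolded e] g_diag[of k v]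
    by (simp add: bdry_def crx)
  also have "r ^ (k + 1) * L k v = r ^ (k + 1) * x / l + m * R / r + m * (r * (r * c)) / l"
    by (simp add: L_def crx distrib_left power_add power2_eq_square)
  also have "r ^ (k + 1) * x / l = - (r ^ k * x / r\<^sup>2)"
    by (simp add: l power2_eq_square power3_eq_cube power_add)
  also have "m * (r * (r * c)) / l = - (m * c / r)"
    by (simp add: l power3_eq_cube)
  finally have *: "bdry k (g k v) = (1 + m / r) * (c - R) + r ^ k * x / r\<^sup>2"
    by (simp add: distrib_right right_diff_distrib)
  have mr: "1 + m / r = 1 / r\<^sup>2"
    by (simp add: m_alt diff_divide_distrib power2_eq_square)
  have "bdry (k + 1) v = c - R + r ^ k * x"
    using k Cs_split[of k "k + 1" v] unfolding bdry_def e by (simp add: crx)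
  then show "bdry k (g k v) = bdry (k + 1) v / r\<^sup>2"
    unfolding * mr by (simp add: add_divide_distrib diff_divide_distrib)
qed

lemma cycles_inv:
  assumes l: "l = - (r ^ 3)"
  shows "inv_sub cycles"
  unfolding inv_sub_def
proof (intro conjI ballI subsetI)
  show "v \<in> H" if "v \<in> cycles" for v using that by (simp add: cycles_def)
  show "0 \<in> cycles" by (simp only: cycles_def mem_Collect_eq bdry_linear H_closed) blast
  show "u + v \<in> cycles" if "u \<in> cycles" "v \<in> cycles" for u v
    using that unfolding cycles_def mem_Collect_eq bdry_linear by (auto intro: H_closed)
  show "scl c v \<in> cycles" if "c \<in> F" "v \<in> cycles" for c v
    using that unfolding cycles_def mem_Collect_eq bdry_linear by (auto intro: H_closed)
  show "g k v \<in> cycles" if k: "k \<in> {1..<n}" and v: "v \<in> cycles" for k v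
  proof -
    have D0: "bdry j v = 0" if "1 \<le> j" "j \<le> n" for j using v that by (simp add: cycles_def)
    have 1: "bdry j (g k v) = 0" if "j \<in> {1..n}" "j \<noteq> k + 1" for j
    proof (cases "j = k")
      case True
      then show ?thesis using bdry_g(2)[OF l _ _ that(1), of k v] k D0[of "k + 1"] by simp
    next
      case False
      then show ?thesis using bdry_g(1)[OF l _ _ that(1) _ that(2), of v] k D0[of j] that by simp
    qed
    have "(\<Sum>j\<in>{1..n}. r ^ j * bdry j (g k v)) = (\<Sum>j\<in>{k + 1}. r ^ j * bdry j (g k v))"
      by (rule sum.mono_neutral_right) (use k 1 in auto)
    then have "bdry (k + 1) (g k v) = 0" using bdry_relation[of "g k v"] by simp
    then have "\<forall>j\<in>{1..n}. bdry j (g k v) = 0" using 1 by blast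
    moreover have "g k v \<in> H" using v g_H by (simp add: cycles_def)
    ultimately show ?thesis by (simp add: cycles_def)
  qed
qed

text \<open>The quantum analogue of the triangle cycle on 1, i, j: in the complete graph the edges
  at 1 form a spanning tree, and each edge avoiding 1, that is, each element of
  \<open>pairs_ge_2\<close>, closes one cycle.\<close>

definition cycle_vec :: "nat \<times> nat \<Rightarrow> nat \<times> nat \<Rightarrow> complex" where
  "cycle_vec p = w (fst p) (snd p) - scl (r ^ (fst p - 1)) (w 1 (snd p)) + scl (r ^ (snd p - 1)) (w 1 (fst p))"

definition pairs_ge_2 where "pairs_ge_2 = {(i, j). 2 \<le> i \<and> i < j \<and> j \<le> n}"

lemma bdry_w: "1 \<le> i \<Longrightarrow> i < j \<Longrightarrow> j \<le> n \<Longrightarrow> bdry t (w i j) = (if t = j then r ^ i else 0) - (if t = i then r ^ j else 0)"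
  by (simp add: bdry_def Rs_w Cs_w)

lemma cycle_vec_cycles: "p \<in> pairs_ge_2 \<Longrightarrow> cycle_vec p \<in> cycles"
proof -
  assume "p \<in> pairs_ge_2"
  then obtain i j where p: "p = (i, j)" "2 \<le> i" "i < j" "j \<le> n" by (auto simp: pairs_ge_2_def)
  have r: "r ^ i = r * r ^ (i - 1)" "r ^ j = r * r ^ (j - 1)"
    using p by (simp_all flip: power_Suc)
  have "bdry t (cycle_vec p) = 0" for t
    using p(2-) by (simp add: p(1) cycle_vec_def bdry_linear bdry_w r)
  moreover have "cycle_vec p \<in> H"
    unfolding cycle_vec_def p(1) fst_conv snd_conv using p(2-)
    by (intro H_closed(2,3,4) H_closed(5)[of "(a, b)" for a b, simplified]) (auto simp: pairs_def)
  ultimately show ?thesis by (simp add: cycles_def)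
qed

lemma cycle_vec_coord: "p \<in> pairs_ge_2 \<Longrightarrow> q \<in> pairs_ge_2 \<Longrightarrow> cycle_vec p q = (if q = p then 1 else 0)"
  by (auto simp: pairs_ge_2_def cycle_vec_def w_def)

text \<open>Spanning-tree argument: once the entries avoiding 1 vanish, the boundary at j > 1
  reduces to r times the entry (1, j).\<close>

lemma cycles_eqI:
  assumes "u \<in> cycles" "v \<in> cycles" "\<And>p. p \<in> pairs_ge_2 \<Longrightarrow> u p = v p"
  shows "u = v"
proof (rule ext, clarify)
  fix i j
  define d where "d = u - v"
  have dH: "d \<in> H" and D: "bdry t d = 0" if "t \<in> {1..n}" for t
    using assms that by (auto simp: cycles_def d_def bdry_linear H_closed)
  have d2: "d p = 0" if "p \<in> pairs_ge_2" for p using assms(3)[OF that] by (simp add: d_def)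
  have H: "d \<in> H" using dH[of 1] n_ge_3 by simp
  have d1: "d (1, j) = 0" if j: "2 \<le> j" "j \<le> n" for j
  proof -
    have "Cs j j d = (\<Sum>i\<in>{1}. r ^ i * d (i, j))"
      unfolding Cs_def by (rule sum.mono_neutral_right) (use j in \<open>auto simp: d2 pairs_ge_2_def\<close>)
    moreover have "Rs (j + 1) j d = 0"
      unfolding Rs_def by (rule sum.neutral) (use j in \<open>auto simp: d2 pairs_ge_2_def\<close>)
    ultimately show ?thesis using D[of j] j by (simp add: bdry_def)
  qed
  have "d (i, j) = 0"
  proof (cases "(i, j) \<in> pairs n")
    case True
    then show ?thesis using d1[of j] d2[of "(i, j)"] by (cases "i = 1") (auto simp: pairs_def pairs_ge_2_def)
  qed (rule H_supp[OF H])
  then show "u (i, j) = v (i, j)" by (simp add: d_def)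
qed

lemma fin_pairs_ge_2: "finite pairs_ge_2"
  by (rule finite_subset[of _ "{1..n} \<times> {1..n}"]) (auto simp: pairs_ge_2_def)

lemma cycles_span:
  assumes l: "l = - (r ^ 3)" and v: "v \<in> cycles"
  shows "v = (\<Sum>p\<in>pairs_ge_2. scl (v p) (cycle_vec p))"
proof (rule cycles_eqI[OF v])
  have "v \<in> H" using v by (simp add: cycles_def)
  then show "(\<Sum>p\<in>pairs_ge_2. scl (v p) (cycle_vec p)) \<in> cycles"
    by (intro inv_sub_sum[OF cycles_inv[OF l]] inv_subD(4)[OF cycles_inv[OF l]] H_F cycle_vec_cycles)
  fix q assume q: "q \<in> pairs_ge_2"
  have "(\<Sum>p\<in>pairs_ge_2. scl (v p) (cycle_vec p)) q = (\<Sum>p\<in>pairs_ge_2. if p = q then v q else 0)"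
    unfolding sum_fun_apply by (intro sum.cong) (use q in \<open>auto simp: cycle_vec_coord\<close>)
  then show "v q = (\<Sum>p\<in>pairs_ge_2. scl (v p) (cycle_vec p)) q" using q fin_pairs_ge_2 by simp
qed

text \<open>\<open>no_triv_simple\<close> applies because \<open>triv_vec\<close> is no cycle: its
  boundary at 1 is a nonzero multiple of [n - 1].\<close>

lemma cycles_simple:
  assumes l: "l = - (r ^ 3)"
  shows "cycles \<noteq> {0}" "inv_sub U \<Longrightarrow> U \<subseteq> cycles \<Longrightarrow> U = {0} \<or> U = cycles"
    "v \<in> cycles \<Longrightarrow> triv v \<Longrightarrow> v = 0"
proof -
  have p: "(2, 3) \<in> pairs_ge_2" using n_ge_3 by (simp add: pairs_ge_2_def)
  have "cycle_vec (2, 3) (2, 3) = 1" using cycle_vec_coord[OF p p] by simp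
  then show "cycles \<noteq> {0}" using cycle_vec_cycles[OF p] by force
  show tr: "v = 0" if v: "v \<in> cycles" "triv v" for v
  proof -
    have vf: "v = scl (v (1, 2) / r ^ 3) triv_vec" by (rule triv_form[OF v(2)])
    have "Rs 2 1 triv_vec = (\<Sum>j\<in>{2..n}. r * r ^ (2 * j))"
      unfolding Rs_def triv_vec_def by (intro sum.cong) (auto simp: pairs_def mult_2 power_add)
    then have "(1 - r\<^sup>2) * Rs 2 1 triv_vec = r * (r ^ 4 - r ^ (2 * n + 2))"
      using geom[of 2 n] n_ge_3 by (simp flip: sum_distrib_left)
    moreover have "r ^ (2 * n + 2) = r ^ 4 * r ^ (2 * (n - 1))"
    proof -
      have "2 * n + 2 = 4 + 2 * (n - 1)" using n_ge_3 by simp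
      then show ?thesis by (metis power_add)
    qed
    ultimately have "(1 - r\<^sup>2) * Rs 2 1 triv_vec = r * r ^ 4 * (1 - r ^ (2 * (n - 1)))"
      by (simp add: right_diff_distrib)
    then have R: "Rs 2 1 triv_vec \<noteq> 0" using r_pow_neq_1[of "n - 1"] n_ge_3 by auto
    have "bdry 1 v = 0" using v n_ge_3 by (simp add: cycles_def)
    then have "v (1, 2) / r ^ 3 * bdry 1 triv_vec = 0" by (subst (asm) vf) (simp only: bdry_linear)
    moreover have "bdry 1 triv_vec = - Rs 2 1 triv_vec" by (simp add: bdry_def Cs_def)
    ultimately have c: "v (1, 2) / r ^ 3 = 0" using R by simp
    have "v = scl 0 triv_vec" using vf unfolding c .
    then show ?thesis by (simp only: scl_simps)
  qed
  have "cycles \<noteq> H"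
  proof
    assume *: "cycles = H"
    have "w 1 2 \<in> H" using H_closed(5)[of "(1, 2)"] n_ge_3 by (simp add: pairs_def)
    then have "w 1 2 \<in> cycles" using * by simp
    then have "bdry 2 (w 1 2) = 0" using n_ge_3 by (simp add: cycles_def)
    then show False using bdry_w[of 1 2 2] n_ge_3 by simp
  qed
  then show "U = {0} \<or> U = cycles" if "inv_sub U" "U \<subseteq> cycles"
    using no_triv_simple[OF cycles_inv[OF l] _ that _ tr] by blast
qed

lemma card_pairs_ge_2: "card pairs_ge_2 = (n - 1) * (n - 2) div 2"
proof -
  have "pairs_ge_2 = (\<Union>j\<in>{3..n}. (\<lambda>i. (i, j)) ` {2..<j})"
  proof (rule Set.set_eqI)
    fix x :: "nat \<times> nat"
    obtain a b where x: "x = (a, b)" by (cases x)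
    have "(a, b) \<in> pairs_ge_2 \<longleftrightarrow> b \<in> {3..n} \<and> a \<in> {2..<b}" by (auto simp: pairs_ge_2_def)
    also have "\<dots> \<longleftrightarrow> (a, b) \<in> (\<Union>j\<in>{3..n}. (\<lambda>i. (i, j)) ` {2..<j})"
    proof -
      have "(a, b) \<in> (\<lambda>i. (i, j)) ` {2..<j} \<longleftrightarrow> b = j \<and> a \<in> {2..<j}" for j by auto
      then show ?thesis unfolding UN_iff by blast
    qed
    finally show "x \<in> pairs_ge_2 \<longleftrightarrow> x \<in> (\<Union>j\<in>{3..n}. (\<lambda>i. (i, j)) ` {2..<j})" unfolding x .
  qed
  also have "card \<dots> = (\<Sum>j\<in>{3..n}. card ((\<lambda>i. (i, j)) ` {2..<j}))"
    by (rule card_UN_disjoint) auto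
  also have "\<dots> = (\<Sum>j\<in>{3..n}. j - 2)"
    by (intro sum.cong refl) (simp add: card_image inj_on_def)
  also have "2 * \<dots> = (n - 1) * (n - 2)"
    using n_ge_3
  proof (induction n rule: dec_induct)
    case (step n)
    then obtain k where "n = k + 2" using le_Suc_ex[of 2 n] by (auto simp: add.commute)
    then show ?case using step by (simp add: algebra_simps)
  qed simp
  finally show ?thesis by simp
qed

end

section \<open>The action of the algebra\<close>

lemma base_field_closed:
  "0 \<in> base_field l r" "1 \<in> base_field l r" "l \<in> base_field l r" "r \<in> base_field l r"
  "a \<in> base_field l r \<Longrightarrow> b \<in> base_field l r \<Longrightarrow> a + b \<in> base_field l r"
  "a \<in> base_field l r \<Longrightarrow> b \<in> base_field l r \<Longrightarrow> a * b \<in> base_field l r"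
  "a \<in> base_field l r \<Longrightarrow> - a \<in> base_field l r"
  "a \<in> base_field l r \<Longrightarrow> inverse a \<in> base_field l r"
proof -
  show z: "0 \<in> base_field l r"
    using field.zero_in_generate[OF class_field, of "{l, r}"] by (simp add: base_field_def)
  show "1 \<in> base_field l r"
    using generate_field.one[of class_ring "{l, r}"] by (simp add: base_field_def)
  show "l \<in> base_field l r" "r \<in> base_field l r"
    by (auto simp: base_field_def intro: generate_field.incl)
  assume a: "a \<in> base_field l r"
  show "- a \<in> base_field l r"
    using generate_field.a_inv[of a class_ring "{l, r}"] a by (simp add: base_field_def class_ring_simps)
  \<comment> \<open>Generation of a field inverts only nonzero elements;
    \<open>inverse 0 = 0\<close> is covered by \<open>z\<close>.\<close>
  show "inverse a \<in> base_field l r"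
    using generate_field.m_inv[of a class_ring "{l, r}"] a z
    by (cases "a = 0") (simp_all add: base_field_def class_ring_simps)
  assume b: "b \<in> base_field l r"
  show "a + b \<in> base_field l r"
    using generate_field.eng_add[of a class_ring "{l, r}" b] a b by (simp add: base_field_def)
  show "a * b \<in> base_field l r"
    using generate_field.eng_mult[of a class_ring "{l, r}" b] a b by (simp add: base_field_def)
qed

lemma poly_mapping_sum_single:
  "(\<Sum>u\<in>Poly_Mapping.keys a. Poly_Mapping.single u (Poly_Mapping.lookup a u)) = a"
proof (rule poly_mapping_eqI)
  fix k
  have "Poly_Mapping.lookup (\<Sum>u\<in>Poly_Mapping.keys a. Poly_Mapping.single u (Poly_Mapping.lookup a u)) k
      = (\<Sum>u\<in>Poly_Mapping.keys a. if u = k then Poly_Mapping.lookup a k else 0)"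
    unfolding lookup_sum by (intro sum.cong refl) (simp add: lookup_single when_def)
  then show "Poly_Mapping.lookup (\<Sum>u\<in>Poly_Mapping.keys a. Poly_Mapping.single u (Poly_Mapping.lookup a u)) k
      = Poly_Mapping.lookup a k"
    by (simp add: not_in_keys_iff_lookup_eq_zero)
qed

section \<open>Transport between \<open>lk_space\<close> and coordinate functions\<close>

locale lk_rep_space = lk "base_field l r" n l r for n l r
begin

abbreviation V where "V \<equiv> lk_space n l r"

lemma field_base_ring: "field (base_ring l r)"
  unfolding base_ring_def base_field_def
  by (rule field.generate_field_is_field[OF class_field]) simp

lemma base_ring_simps:
  "carrier (base_ring l r) = base_field l r" "mult (base_ring l r) = (*)" "add (base_ring l r) = (+)"
  "zero (base_ring l r) = 0" "one (base_ring l r) = 1"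
  by (simp_all add: base_ring_def)

lemma vs_V: "vectorspace (base_ring l r) V"
proof -
  interpret field "base_ring l r" by (rule field_base_ring)
  show ?thesis unfolding lk_space_def vectorspace_def
    using func_space_is_module field_axioms by blast
qed

interpretation vs: vectorspace "base_ring l r" V by (rule vs_V)

lemma ring_base_ring: "ring (base_ring l r)"
  using field_base_ring by (simp add: field_def domain_def cring_def)

lemmas func_space_defs = LinearCombinations.ring.func_space_def[OF ring_base_ring]

lemma V_simps:
  "carrier V = pairs n \<rightarrow>\<^sub>E base_field l r" "add V = (\<lambda>u v. restrict (\<lambda>p. u p + v p) (pairs n))"
  "zero V = restrict (\<lambda>p. 0) (pairs n)" "module.smult V = (\<lambda>c v. restrict (\<lambda>p. c * v p) (pairs n))"
  by (simp_all add: lk_space_def func_space_defs base_ring_simps)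

text \<open>\<^const>\<open>lk_space\<close> consists of extensional functions, which are \<open>undefined\<close> off the pairs; \<open>cut\<close> and
  \<open>res\<close> exchange them with functions vanishing off the pairs, where pointwise algebra is available.\<close>

definition cut :: "(nat \<times> nat \<Rightarrow> complex) \<Rightarrow> nat \<times> nat \<Rightarrow> complex" where
  "cut v = (\<lambda>p. if p \<in> pairs n then v p else 0)"

definition res :: "(nat \<times> nat \<Rightarrow> complex) \<Rightarrow> nat \<times> nat \<Rightarrow> complex" where
  "res v = restrict v (pairs n)"

lemma cut_H: "v \<in> carrier V \<Longrightarrow> cut v \<in> H"
  by (auto simp: V_simps cut_def H_def)

lemma res_V: "v \<in> H \<Longrightarrow> res v \<in> carrier V"
  by (auto simp: V_simps res_def intro: H_F)

lemma res_cut: "v \<in> carrier V \<Longrightarrow> res (cut v) = v"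
  by (rule ext) (auto simp: V_simps res_def cut_def PiE_def extensional_def)

lemma cut_res: "v \<in> H \<Longrightarrow> cut (res v) = v"
  by (rule ext) (auto simp: res_def cut_def H_supp)

lemma cut_inj: "u \<in> carrier V \<Longrightarrow> v \<in> carrier V \<Longrightarrow> cut u = cut v \<Longrightarrow> u = v"
  using res_cut by metis

lemma cut_ops:
  "cut (u \<oplus>\<^bsub>V\<^esub> v) = cut u + cut v" "cut (c \<odot>\<^bsub>V\<^esub> v) = scl c (cut v)" "cut \<zero>\<^bsub>V\<^esub> = 0"
  by (auto simp: V_simps cut_def fun_eq_iff)

lemma V_closed:
  "u \<in> carrier V \<Longrightarrow> v \<in> carrier V \<Longrightarrow> u \<oplus>\<^bsub>V\<^esub> v \<in> carrier V"
  "c \<in> base_field l r \<Longrightarrow> v \<in> carrier V \<Longrightarrow> c \<odot>\<^bsub>V\<^esub> v \<in> carrier V" "\<zero>\<^bsub>V\<^esub> \<in> carrier V"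
  using vs.smult_closed by (simp_all add: base_ring_simps)

lemma cut_finsum:
  assumes "finite X" "\<And>x. x \<in> X \<Longrightarrow> f x \<in> carrier V"
  shows "cut (\<Oplus>\<^bsub>V\<^esub>x\<in>X. f x) = (\<Sum>x\<in>X. cut (f x))"
  using assms
proof (induction X rule: finite_induct)
  case empty
  then show ?case by (simp only: vs.M.finsum_empty sum.empty cut_ops)
next
  case (insert x X)
  have "(\<Oplus>\<^bsub>V\<^esub>x\<in>insert x X. f x) = f x \<oplus>\<^bsub>V\<^esub> (\<Oplus>\<^bsub>V\<^esub>x\<in>X. f x)"
    using insert by (intro vs.M.finsum_insert) auto
  moreover have "cut (\<Oplus>\<^bsub>V\<^esub>x\<in>X. f x) = (\<Sum>x\<in>X. cut (f x))" using insert by blast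
  ultimately show ?case by (simp only: cut_ops sum.insert[OF insert(1,2)])
qed

lemma V_finsum_closed: "(\<And>x. x \<in> X \<Longrightarrow> f x \<in> carrier V) \<Longrightarrow> (\<Oplus>\<^bsub>V\<^esub>x\<in>X. f x) \<in> carrier V"
  by (rule vs.M.finsum_closed) auto

lemma fin_pairs: "finite (pairs n)"
  by (rule finite_subset[of _ "{1..n} \<times> {1..n}"]) (auto simp: pairs_def)

section \<open>The maps \<open>nu\<close> in coordinates\<close>

lemma basis_V: "lk_basis n i j \<in> carrier V"
  by (auto simp: V_simps lk_basis_def)

lemma cut_basis: "(i, j) \<in> pairs n \<Longrightarrow> cut (lk_basis n i j) = w i j"
  by (rule ext) (auto simp: cut_def lk_basis_def w_def)

lemma g_w_all:
  assumes k: "1 \<le> k" "k < n" and ij: "1 \<le> i" "i < j" "j \<le> n"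
  shows "{i, j} \<inter> {k, k + 1} = {} \<Longrightarrow> g k (w i j) = scl r (w i j)"
    "i = k \<Longrightarrow> j = k + 1 \<Longrightarrow> g k (w i j) = scl (1 / l) (w k (k + 1))"
    "i = k + 1 \<Longrightarrow> g k (w i j) = w k j + scl (m * r ^ (j - k - 2)) (w k (k + 1)) + scl (- m) (w (k + 1) j)"
    "j = k + 1 \<Longrightarrow> i < k \<Longrightarrow> g k (w i j) = w i k + scl (m / (l * r ^ (k - 1 - i))) (w k (k + 1)) + scl (- m) (w i (k + 1))"
proof -
  show "g k (w i j) = scl r (w i j)" if "{i, j} \<inter> {k, k + 1} = {}"
    using that k ij by (auto simp: fun_eq_iff g_def L_def Rs_w Cs_w) (auto simp: w_def pairs_def)
  show "g k (w i j) = scl (1 / l) (w k (k + 1))" if "i = k" "j = k + 1"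
    using that k ij by (auto simp: fun_eq_iff g_def L_def Rs_w Cs_w) (auto simp: w_def pairs_def)
  show "g k (w i j) = w k j + scl (m * r ^ (j - k - 2)) (w k (k + 1)) + scl (- m) (w (k + 1) j)" if i: "i = k + 1"
  proof -
    have "j = (j - k - 2) + (k + 2)" using ij i by simp
    then have "r ^ j = r ^ (j - k - 2) * r ^ (k + 2)" by (metis power_add)
    then have "L k (w i j) = m * r ^ (j - k - 2)"
      using ij k by (simp add: L_def Rs_w Cs_w i) (simp add: w_def)
    then show ?thesis
      using i k ij by (auto simp: fun_eq_iff g_def) (auto simp: w_def pairs_def)
  qed
  show "g k (w i j) = w i k + scl (m / (l * r ^ (k - 1 - i))) (w k (k + 1)) + scl (- m) (w i (k + 1))" if j: "j = k + 1" "i < k"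
  proof -
    have "k = (k - 1 - i) + (i + 1)" using j by simp
    then have "r ^ k = r ^ (k - 1 - i) * r ^ (i + 1)" by (metis power_add)
    then have "L k (w i j) = m / (l * r ^ (k - 1 - i))"
      using ij k j by (simp add: L_def Rs_w Cs_w power_add) (simp add: w_def)
    then show ?thesis
      using j k ij by (auto simp: fun_eq_iff g_def) (auto simp: w_def pairs_def)
  qed
qed

lemma nu_basis_cut:
  assumes k: "1 \<le> k" "k < n" and p: "p \<in> pairs n"
  shows "nu_basis n l r k p \<in> carrier V" "cut (nu_basis n l r k p) = g k (w (fst p) (snd p))"
proof -
  obtain i j where ij: "p = (i, j)" "1 \<le> i" "i < j" "j \<le> n" using p by (auto simp: pairs_def)
  show "nu_basis n l r k p \<in> carrier V"
    unfolding nu_basis_def Let_def ij(1) m_def[symmetric] case_prod_conv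
    by (auto intro!: V_closed basis_V)
  consider "{i, j} \<inter> {k, k + 1} = {}" | "i = k" "j = k + 1" | "i = k" "k + 2 \<le> j"
    | "i = k + 1" | "j = k" | "j = k + 1" "i < k" using ij by fastforce
  then show "cut (nu_basis n l r k p) = g k (w (fst p) (snd p))"
  proof cases
    case 1
    then show ?thesis unfolding nu_basis_def Let_def ij(1) m_def[symmetric] case_prod_conv fst_conv snd_conv
      using g_w_all(1)[OF k ij(2-4) 1] ij k by (simp add: cut_ops cut_basis pairs_def)
  next
    case 2
    then show ?thesis unfolding nu_basis_def Let_def ij(1) m_def[symmetric] case_prod_conv fst_conv snd_conv
      using g_w_all(2)[OF k ij(2-4) 2] ij k by (simp add: cut_ops cut_basis pairs_def)
  next
    case 3
    then show ?thesis unfolding nu_basis_def Let_def ij(1) m_def[symmetric] case_prod_conv fst_conv snd_conv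
      using g_w(1)[OF k 3(2) ij(4)] ij k by (simp add: cut_ops cut_basis pairs_def)
  next
    case 4
    then show ?thesis unfolding nu_basis_def Let_def ij(1) m_def[symmetric] case_prod_conv fst_conv snd_conv
      using g_w_all(3)[OF k ij(2-4) 4] ij k by (simp add: cut_ops cut_basis pairs_def)
  next
    case 5
    then show ?thesis unfolding nu_basis_def Let_def ij(1) m_def[symmetric] case_prod_conv fst_conv snd_conv
      using g_w(2)[OF k ij(2)] ij k by (simp add: cut_ops cut_basis pairs_def)
  next
    case 6
    then show ?thesis unfolding nu_basis_def Let_def ij(1) m_def[symmetric] case_prod_conv fst_conv snd_conv
      using g_w_all(4)[OF k ij(2-4) 6] ij k by (simp add: cut_ops cut_basis pairs_def)
  qed
qed

lemma nu_cut:
  assumes k: "1 \<le> k" "k < n" and v: "v \<in> carrier V"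
  shows "nu n l r k v \<in> carrier V" "cut (nu n l r k v) = g k (cut v)"
proof -
  have 1: "v p \<odot>\<^bsub>V\<^esub> nu_basis n l r k p \<in> carrier V" if "p \<in> pairs n" for p
    using nu_basis_cut(1)[OF k that] v that by (intro V_closed) (auto simp: V_simps)
  show "nu n l r k v \<in> carrier V"
    unfolding nu_def using 1 by (intro vs.M.finsum_closed) auto
  have "cut (nu n l r k v) = (\<Sum>p\<in>pairs n. cut (v p \<odot>\<^bsub>V\<^esub> nu_basis n l r k p))"
    unfolding nu_def using 1 by (rule cut_finsum[OF fin_pairs])
  also have "\<dots> = (\<Sum>p\<in>pairs n. g k (scl (cut v p) (w (fst p) (snd p))))"
    by (intro sum.cong refl) (simp add: cut_ops nu_basis_cut[OF k] g_linear, simp add: cut_def)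
  also have "\<dots> = g k (cut v)"
    by (subst H_expand[OF cut_H[OF v]]) (simp only: g_sum)
  finally show "cut (nu n l r k v) = g k (cut v)" .
qed

end

section \<open>The free algebra acting on coordinate functions\<close>

context lk_rep_space
begin

text \<open>Since \<open>g k\<close> multiplies the range of \<open>g k\<^sup>2 + m g k - 1\<close> by \<open>1 / l\<close>, it satisfies a cubic equation with
  constant term \<open>1 / l\<close>; this is the resulting inverse.\<close>

definition ginv :: "nat \<Rightarrow> (nat \<times> nat \<Rightarrow> complex) \<Rightarrow> nat \<times> nat \<Rightarrow> complex" where
  "ginv k v = scl (- l) (g k (g k v) + scl (m - 1 / l) (g k v) - scl (1 + m / l) v)"

lemma ginv_linear: "ginv k (u + v) = ginv k u + ginv k v" "ginv k (scl c v) = scl c (ginv k v)" "ginv k 0 = 0"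
  by (simp_all only: ginv_def g_linear scl_simps) (simp_all add: fun_eq_iff algebra_simps)

lemma ginv_H: "v \<in> H \<Longrightarrow> ginv k v \<in> H"
  by (auto simp: ginv_def intro!: H_closed g_H)

lemma g_ginv:
  assumes k: "1 \<le> k" "k < n" and v: "v \<in> H"
  shows "g k (ginv k v) = v" "ginv k (g k v) = v"
proof -
  define c where "c = m / l * phi k v"
  have q: "g k (g k v) = scl c (w k (k + 1)) - scl m (g k v) + v"
    using quadratic[OF k v] unfolding c_def[symmetric] by (metis add_diff_cancel diff_add_cancel diff_add_eq add.commute)
  have ww: "g k (w k (k + 1)) = scl (1 / l) (w k (k + 1))"
    using g_w_all(2)[OF k k(1), of "k + 1"] k by simp
  have "g k (g k (g k v)) = g k (scl c (w k (k + 1)) - scl m (g k v) + v)" using q by (rule arg_cong)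
  also have "\<dots> = scl (c / l) (w k (k + 1)) - scl m (g k (g k v)) + g k v"
    by (simp only: g_linear ww scl_simps) simp
  also have "scl (c / l) (w k (k + 1)) = scl (1 / l) (g k (g k v) + scl m (g k v) - v)"
    unfolding q by (simp add: fun_eq_iff)
  finally have 3: "g k (g k (g k v)) = scl (1 / l) (g k (g k v) + scl m (g k v) - v) - scl m (g k (g k v)) + g k v" .
  have "scl (- l) (g k (g k (g k v)) + scl (m - 1 / l) (g k (g k v)) - scl (1 + m / l) (g k v)) = v"
    unfolding 3
  proof (rule ext)
    fix p
    have "- l * ((1 / l * (x + m * y - z) - m * x + y) + (m - 1 / l) * x - (1 + m / l) * y) = z" for x y z
      by (simp add: algebra_simps diff_divide_distrib add_divide_distrib)
    then show "scl (- l) (scl (1 / l) (g k (g k v) + scl m (g k v) - v) - scl m (g k (g k v)) + g k v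
        + scl (m - 1 / l) (g k (g k v)) - scl (1 + m / l) (g k v)) p = v p" by simp
  qed
  then show "g k (ginv k v) = v" "ginv k (g k v) = v"
    by (simp_all only: ginv_def g_linear)
qed

fun hact :: "letter \<Rightarrow> (nat \<times> nat \<Rightarrow> complex) \<Rightarrow> nat \<times> nat \<Rightarrow> complex" where
  "hact (G k) = g k"
| "hact (Ginv k) = ginv k"

definition wact :: "gword \<Rightarrow> (nat \<times> nat \<Rightarrow> complex) \<Rightarrow> nat \<times> nat \<Rightarrow> complex" where
  "wact u v = foldr hact (letters u) v"

lemma hact_linear: "hact x (u + v) = hact x u + hact x v" "hact x (scl c v) = scl c (hact x v)" "hact x 0 = 0"
  by (cases x; simp only: hact.simps g_linear ginv_linear)+

lemma wact_linear: "wact x (u + v) = wact x u + wact x v" "wact x (scl c v) = scl c (wact x v)" "wact x 0 = 0"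
proof -
  have "foldr hact xs (u + v) = foldr hact xs u + foldr hact xs v \<and> foldr hact xs (scl c v) = scl c (foldr hact xs v) \<and> foldr hact xs 0 = 0" for xs
    by (induction xs) (simp_all only: foldr.simps o_apply id_apply hact_linear simp_thms)
  then show "wact x (u + v) = wact x u + wact x v" "wact x (scl c v) = scl c (wact x v)" "wact x 0 = 0"
    unfolding wact_def by blast+
qed

lemma wact_sum:
  fixes f :: "'a \<Rightarrow> nat \<times> nat \<Rightarrow> complex"
  shows "wact x (sum f X) = (\<Sum>i\<in>X. wact x (f i))"
proof (induction X rule: infinite_finite_induct)
  case (insert x X)
  then show ?case by (simp only: sum.insert[OF insert(1,2)] wact_linear)
qed (simp_all only: sum.infinite sum.empty wact_linear not_False_eq_True)

lemma wact_plus: "wact (x + y) v = wact x (wact y v)"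
  by (simp add: wact_def plus_gword_def)

lemma wact_H: "v \<in> H \<Longrightarrow> wact u v \<in> H"
proof -
  assume v: "v \<in> H"
  have "hact x v \<in> H" if "v \<in> H" for x v using that by (cases x) (simp_all add: g_H ginv_H)
  then have "foldr hact xs v \<in> H" for xs by (induction xs) (simp_all add: v)
  then show ?thesis by (simp add: wact_def)
qed

text \<open>The counterpart of \<open>free_act\<close> on coordinate functions. It puts no carrier
  condition on a, so additivity and multiplicativity hold without side conditions.\<close>

definition Phi :: "(gword \<Rightarrow>\<^sub>0 complex) \<Rightarrow> (nat \<times> nat \<Rightarrow> complex) \<Rightarrow> nat \<times> nat \<Rightarrow> complex" where
  "Phi a v = (\<Sum>u\<in>Poly_Mapping.keys a. scl (Poly_Mapping.lookup a u) (wact u v))"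

lemma Phi_add: "Phi (a + b) v = Phi a v + Phi b v"
  unfolding Phi_def
  by (rule setsum_keys_plus_distrib) (simp_all only: scl_simps)

lemma Phi_0: "Phi 0 v = 0"
  by (simp only: Phi_def keys_zero sum.empty)

lemma Phi_sum: "Phi (sum f X) v = (\<Sum>x\<in>X. Phi (f x) v)"
proof (induction X rule: infinite_finite_induct)
  case (insert x X)
  then show ?case by (simp only: sum.insert[OF insert(1,2)] Phi_add)
qed (simp_all only: sum.infinite sum.empty Phi_0 not_False_eq_True)

lemma Phi_single: "Phi (Poly_Mapping.single u c) v = scl c (wact u v)"
proof (cases "c = 0")
  case True
  then show ?thesis by (simp only: single_zero Phi_0 scl_simps)
next
  case False
  then show ?thesis by (simp add: Phi_def)
qed

lemma Phi_mult: "Phi (a * b) v = Phi a (Phi b v)"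
proof -
  let ?s = "Poly_Mapping.single" and ?l = "Poly_Mapping.lookup"
  have "a * b = (\<Sum>u\<in>Poly_Mapping.keys a. \<Sum>u'\<in>Poly_Mapping.keys b. ?s (u + u') (?l a u * ?l b u'))"
    using sum_product[of "\<lambda>u. ?s u (?l a u)" "Poly_Mapping.keys a" "\<lambda>u. ?s u (?l b u)" "Poly_Mapping.keys b"]
    by (simp only: poly_mapping_sum_single mult_single)
  then have "Phi (a * b) v = (\<Sum>u\<in>Poly_Mapping.keys a. \<Sum>u'\<in>Poly_Mapping.keys b. scl (?l a u * ?l b u') (wact u (wact u' v)))"
    by (simp only: Phi_sum Phi_single wact_plus)
  also have "\<dots> = (\<Sum>u\<in>Poly_Mapping.keys a. scl (?l a u) (wact u (Phi b v)))"
    unfolding Phi_def wact_sum by (intro sum.cong refl) (simp add: fun_eq_iff sum_fun_apply wact_linear sum_distrib_left mult.assoc)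
  also have "\<dots> = Phi a (Phi b v)" by (simp only: Phi_def)
  finally show ?thesis .
qed

lemma Phi_uminus: "Phi (- a) v = - Phi a v"
  using Phi_add[of "- a" a v] by (simp only: left_minus Phi_0) (metis eq_neg_iff_add_eq_0)

lemma Phi_minus: "Phi (a - b) v = Phi a v - Phi b v"
  using Phi_add[of "a - b" b v] by (simp only: diff_add_cancel) (metis add_diff_cancel)

lemma Phi_basic:
  "Phi (gen k) v = g k v" "Phi (gen_inv k) v = ginv k v" "Phi (const c) v = scl c v" "Phi 1 v = v"
proof -
  show "Phi (gen k) v = g k v" "Phi (gen_inv k) v = ginv k v" "Phi (const c) v = scl c v"
    by (simp_all add: gen_def gen_inv_def const_def Phi_single wact_def scl_simps zero_gword_def)
  have "Phi 1 v = Phi (Poly_Mapping.single 0 1) v" by simp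
  then show "Phi 1 v = v" by (simp only: Phi_single) (simp add: wact_def zero_gword_def scl_simps)
qed

lemma Phi_e: "v \<in> H \<Longrightarrow> 1 \<le> k \<Longrightarrow> k < n \<Longrightarrow> Phi (bmw_e l r k) v = scl (phi k v) (w k (k + 1))"
proof -
  assume a: "v \<in> H" "1 \<le> k" "k < n"
  have "Phi (bmw_e l r k) v = scl (l / m) (g k (g k v) + scl m (g k v) - v)"
    unfolding bmw_e_def m_def[symmetric] by (simp only: Phi_mult Phi_basic Phi_minus Phi_add)
  also have "\<dots> = scl (phi k v) (w k (k + 1))"
    unfolding quadratic[OF a(2,3,1)] by (simp add: fun_eq_iff)
  finally show ?thesis .
qed

section \<open>The defining relations act as zero\<close>

abbreviation FA where "FA \<equiv> free_alg n l r"

lemma FA_simps: "mult FA = (*)" "one FA = 1" "zero FA = 0" "add FA = (+)"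
  "a \<in> carrier FA \<longleftrightarrow> (\<forall>u\<in>Poly_Mapping.keys a.
        Poly_Mapping.lookup a u \<in> base_field l r \<and> letter_index ` set (letters u) \<subseteq> {1..n - 1})"
  by (simp_all add: free_alg_def)

lemma FA_lookup: "a \<in> carrier FA \<Longrightarrow> Poly_Mapping.lookup a u \<in> base_field l r"
  by (cases "u \<in> Poly_Mapping.keys a") (auto simp: FA_simps not_in_keys_iff_lookup_eq_zero)

lemma FA_keys: "a \<in> carrier FA \<Longrightarrow> u \<in> Poly_Mapping.keys a \<Longrightarrow> letter_index ` set (letters u) \<subseteq> {1..n - 1}"
  by (simp add: FA_simps)

lemma FA_add: "a \<in> carrier FA \<Longrightarrow> b \<in> carrier FA \<Longrightarrow> a + b \<in> carrier FA"
  unfolding FA_simps(5)[of "a + b"] lookup_add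
  by (intro ballI conjI add_F FA_lookup) (use keys_add[of a b] FA_keys[of a] FA_keys[of b] in blast)+

lemma FA_uminus: "a \<in> carrier FA \<Longrightarrow> - a \<in> carrier FA"
  by (simp add: FA_simps)

lemma FA_mult: "a \<in> carrier FA \<Longrightarrow> b \<in> carrier FA \<Longrightarrow> a * b \<in> carrier FA"
proof -
  assume a: "a \<in> carrier FA" and b: "b \<in> carrier FA"
  have "Poly_Mapping.lookup (a * b) u \<in> base_field l r" for u
    unfolding lookup_mult Sum_any.expand_set
    by (intro sum_F mult_F) (auto simp: when_def FA_lookup[OF a] FA_lookup[OF b])
  moreover have "letter_index ` set (letters u) \<subseteq> {1..n - 1}" if u: "u \<in> Poly_Mapping.keys (a * b)" for u
  proof -
    obtain x y where "u = x + y" "x \<in> Poly_Mapping.keys a" "y \<in> Poly_Mapping.keys b"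
      using keys_mult[of a b] u by blast
    then show ?thesis using FA_keys[OF a, of x] FA_keys[OF b, of y] by (simp add: plus_gword_def image_Un)
  qed
  ultimately show ?thesis by (simp add: FA_simps)
qed

lemma FA_0: "0 \<in> carrier FA" and FA_1: "1 \<in> carrier FA"
proof -
  have "letters 0 = []" by (simp add: zero_gword_def)
  then show "0 \<in> carrier FA" "1 \<in> carrier FA" by (simp_all add: FA_simps)
qed

lemma ring_FA: "ring FA"
proof (rule ringI)
  show "abelian_group FA"
    by (rule abelian_groupI) (auto simp: FA_simps(1-4) ac_simps intro: FA_add FA_0 bexI[OF _ FA_uminus])
  show "Group.monoid FA"
    by (rule monoidI) (auto simp: FA_simps(1-4) mult.assoc intro: FA_mult FA_1)
qed (simp_all add: FA_simps(1-4) distrib_left distrib_right)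

lemma FA_gens: "1 \<le> k \<Longrightarrow> k < n \<Longrightarrow> gen k \<in> carrier FA" "1 \<le> k \<Longrightarrow> k < n \<Longrightarrow> gen_inv k \<in> carrier FA"
  "c \<in> base_field l r \<Longrightarrow> const c \<in> carrier FA"
  by (auto simp: FA_simps gen_def gen_inv_def const_def zero_gword_def)

lemma FA_minus: "a \<in> carrier FA \<Longrightarrow> b \<in> carrier FA \<Longrightarrow> a - b \<in> carrier FA"
  using FA_add[OF _ FA_uminus, of a b] by simp

lemma FA_e: "1 \<le> k \<Longrightarrow> k < n \<Longrightarrow> bmw_e l r k \<in> carrier FA"
  unfolding bmw_e_def m_def[symmetric]
  by (intro FA_mult FA_minus FA_add FA_gens FA_1 divide_F l_F m_F)

text \<open>Vectors are tested in \<open>H\<close> only, where \<open>g_ginv\<close> is available;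
  closure under right multiplication then rests on \<open>Phi_H\<close>. The ideal generated by the
  relations lies in this ideal, so the action descends to the quotient.\<close>

definition Ann where "Ann = {a \<in> carrier FA. \<forall>v\<in>H. Phi a v = 0}"

lemma Phi_linear0: "Phi a 0 = 0"
  unfolding Phi_def wact_linear scl_simps by (rule sum.neutral) simp

lemma Phi_H: "a \<in> carrier FA \<Longrightarrow> v \<in> H \<Longrightarrow> Phi a v \<in> H"
  unfolding Phi_def
  by (rule inv_sub_sum[OF inv_sub_H], rule H_closed(4)) (simp_all add: FA_lookup wact_H)

lemma ideal_Ann: "ideal Ann FA"
proof (rule idealI[OF ring_FA])
  interpret FA: ring FA by (rule ring_FA)
  have inv: "\<ominus>\<^bsub>FA\<^esub> a = - a" if "a \<in> carrier FA" for a
    using that FA.minus_equality[of "- a" a] FA_uminus[of a] by (simp add: FA_simps(3,4))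
  show "subgroup Ann (add_monoid FA)"
  proof (rule FA.add.subgroupI)
    show "Ann \<noteq> {}" using FA_0 Phi_0 unfolding Ann_def by blast
    show "\<ominus>\<^bsub>FA\<^esub> a \<in> Ann" if "a \<in> Ann" for a
      using that FA_uminus[of a] by (simp add: Ann_def inv Phi_uminus)
    show "a \<oplus>\<^bsub>FA\<^esub> b \<in> Ann" if "a \<in> Ann" "b \<in> Ann" for a b
      using that FA_add[of a b] by (simp add: Ann_def FA_simps(4) Phi_add)
  qed (auto simp: Ann_def)
  show "x \<otimes>\<^bsub>FA\<^esub> a \<in> Ann" if "a \<in> Ann" "x \<in> carrier FA" for a x
    using that FA_mult[of x a] by (simp add: Ann_def FA_simps(1) Phi_mult Phi_linear0)
  show "a \<otimes>\<^bsub>FA\<^esub> x \<in> Ann" if "a \<in> Ann" "x \<in> carrier FA" for a x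
    using that FA_mult[of a x] Phi_H[of x] by (simp add: Ann_def FA_simps(1) Phi_mult)
qed

lemma phi_w_diag:
  assumes "1 \<le> k" "k < n"
  shows "phi k (w k (k + 1)) = 1 - (l - 1 / l) / m"
  by (simp add: phi_def Rs_w Cs_w) (simp add: w_def)

lemma relations_FA: "bmw_relations n l r \<subseteq> carrier FA"
proof -
  have 1: "1 / l \<in> base_field l r" by simp
  show ?thesis
    unfolding bmw_relations_def
    by (intro Un_least subsetI; elim CollectE exE conjE; simp only:)
       (intro FA_minus FA_mult FA_gens FA_e FA_1 1 l_F; auto)+
qed

text \<open>Since \<open>bmw_e l r i\<close> sends v to \<open>phi i v\<close> times
  \<open>w i (i + 1)\<close>, each relation e g e = l e reduces to one number: the value of
  \<open>phi i\<close> at the image of \<open>w i (i + 1)\<close> under the neighbouring operator,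
  which has to be l.\<close>

lemma relations_Ann: "bmw_relations n l r \<subseteq> Ann"
proof
  fix a assume a: "a \<in> bmw_relations n l r"
  have aFA: "a \<in> carrier FA" using a relations_FA by blast
  have mem: "a \<in> Ann" if "\<And>v. v \<in> H \<Longrightarrow> Phi a v = 0"
    using aFA that by (simp add: Ann_def)
  have gw: "g k (w k (k + 1)) = scl (1 / l) (w k (k + 1))" if "1 \<le> k" "k < n" for k
    using g_w_all(2)[OF that that(1), of "k + 1"] that by simp
  consider k where "a = gen k * gen_inv k - 1" "1 \<le> k" "k < n"
    | k where "a = gen_inv k * gen k - 1" "1 \<le> k" "k < n"
    | i j where "a = gen i * gen j - gen j * gen i" "1 \<le> i" "i < n" "1 \<le> j" "j < n" "i + 2 \<le> j \<or> j + 2 \<le> i"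
    | i where "a = gen i * gen (i + 1) * gen i - gen (i + 1) * gen i * gen (i + 1)" "1 \<le> i" "i + 1 < n"
    | i where "a = gen i * bmw_e l r i - const (1 / l) * bmw_e l r i" "1 \<le> i" "i < n"
    | i where "a = bmw_e l r i * gen (i + 1) * bmw_e l r i - const l * bmw_e l r i" "1 \<le> i" "i + 1 < n"
    | i where "a = bmw_e l r i * gen (i - 1) * bmw_e l r i - const l * bmw_e l r i" "2 \<le> i" "i < n"
    using a unfolding bmw_relations_def by (elim UnE CollectE exE conjE) force+
  then show "a \<in> Ann"
  proof cases
    case (1 k)
    then show ?thesis by (intro mem) (simp add: Phi_minus Phi_mult Phi_basic g_ginv)
  next
    case (2 k)
    then show ?thesis by (intro mem) (simp add: Phi_minus Phi_mult Phi_basic g_ginv)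
  next
    case (3 i j)
    then have "g i (g j v) = g j (g i v)" for v
      using commute[of i j v] commute[of j i v] by auto
    then show ?thesis by (intro mem) (simp add: 3(1) Phi_minus Phi_mult Phi_basic)
  next
    case (4 i)
    then show ?thesis by (intro mem) (simp add: Phi_minus Phi_mult Phi_basic braid)
  next
    case (5 i)
    then show ?thesis
      by (intro mem) (simp add: Phi_minus Phi_mult Phi_basic Phi_e g_linear gw scl_simps mult.commute)
  next
    case (6 i)
    have gw6: "g (i + 1) (w i (i + 1)) = w i (i + 2)"
    proof -
      have e: "i + 1 + 1 = i + 2" by simp
      show ?thesis using g_w(2)[of "i + 1" i, unfolded e] 6(2,3) by simp
    qed
    have ph: "phi i (w i (i + 2)) = l"
      using 6 by (simp add: phi_def Rs_w Cs_w) (simp add: w_def)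
    have H: "w i (i + 1) \<in> H" "w i (i + 2) \<in> H"
      using 6 H_closed(5)[of "(i, i + 1)"] H_closed(5)[of "(i, i + 2)"] by (simp_all add: pairs_def)
    show ?thesis
    proof (rule mem)
      fix v assume v: "v \<in> H"
      have e: "Phi (bmw_e l r i) u = scl (phi i u) (w i (i + 1))" if "u \<in> H" for u
        using Phi_e[OF that, of i] 6(2,3) by simp
      have "Phi (bmw_e l r i * gen (i + 1) * bmw_e l r i) v
          = Phi (bmw_e l r i) (scl (phi i v) (w i (i + 2)))"
        by (simp only: Phi_mult Phi_basic e[OF v] g_linear gw6)
      also have "\<dots> = scl (l * phi i v) (w i (i + 1))"
        unfolding e[OF H_closed(4)[OF phi_F[OF v] H(2)]] phi_linear(3) ph by (simp only: mult.commute)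
      also have "\<dots> = Phi (const l * bmw_e l r i) v"
        by (simp only: Phi_mult Phi_basic e[OF v] scl_simps)
      finally show "Phi a v = 0" unfolding 6(1) by (simp add: Phi_minus)
    qed
  next
    case (7 i)
    then obtain k where k: "i = k + 1" "1 \<le> k" "k + 1 < n" by (intro that[of "i - 1"]) auto
    have gw7: "g k (w (k + 1) (k + 2)) = w k (k + 2) + scl m (w k (k + 1)) + scl (- m) (w (k + 1) (k + 2))"
      using g_w_all(3)[of k "k + 1" "k + 2"] k by simp
    \<comment> \<open>The three terms contribute 1/l, m and - m + (l - 1/l).\<close>
    have ph: "phi (k + 1) (w k (k + 2) + scl m (w k (k + 1)) + scl (- m) (w (k + 1) (k + 2))) = l"
    proof -
      have "phi (k + 1) (w k (k + 2)) = 1 / l" "phi (k + 1) (w k (k + 1)) = 1"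
        using k by (simp_all add: phi_def Rs_w Cs_w power_add) (simp_all add: w_def)
      moreover have "phi (k + 1) (w (k + 1) (k + 2)) = 1 - (l - 1 / l) / m"
      proof -
        have e: "k + 1 + 1 = k + 2" by simp
        show ?thesis using phi_w_diag[of "k + 1", unfolded e] k by simp
      qed
      ultimately show ?thesis by (simp add: phi_linear right_diff_distrib diff_divide_distrib)
    qed
    have "w k (k + 2) \<in> H" "w k (k + 1) \<in> H" "w (k + 1) (k + 2) \<in> H"
      using k H_closed(5)[of "(k, k + 1)"] H_closed(5)[of "(k, k + 2)"] H_closed(5)[of "(k + 1, k + 2)"]
      by (simp_all add: pairs_def)
    then have H: "w k (k + 2) + scl m (w k (k + 1)) + scl (- m) (w (k + 1) (k + 2)) \<in> H"
      by (intro H_closed minus_F m_F)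
    show ?thesis
    proof (rule mem)
      fix v assume v: "v \<in> H"
      have e: "Phi (bmw_e l r (k + 1)) u = scl (phi (k + 1) u) (w (k + 1) (k + 2))" if "u \<in> H" for u
      proof -
        have e: "k + 1 + 1 = k + 2" by simp
        show ?thesis using Phi_e[OF that, of "k + 1", unfolded e] k by simp
      qed
      have "Phi (bmw_e l r (k + 1) * gen k * bmw_e l r (k + 1)) v
          = Phi (bmw_e l r (k + 1)) (scl (phi (k + 1) v) (w k (k + 2) + scl m (w k (k + 1)) + scl (- m) (w (k + 1) (k + 2))))"
        by (simp only: Phi_mult Phi_basic e[OF v] g_linear(3) gw7)
      also have "\<dots> = scl (l * phi (k + 1) v) (w (k + 1) (k + 2))"
        unfolding e[OF H_closed(4)[OF phi_F[OF v] H]] phi_linear(3) ph by (simp only: mult.commute)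
      also have "\<dots> = Phi (const l * bmw_e l r (k + 1)) v"
        by (simp only: Phi_mult Phi_basic e[OF v] scl_simps)
      finally show "Phi a v = 0" unfolding 7(1) k(1) by (simp add: Phi_minus)
    qed
  qed
qed

section \<open>Descent to the quotient algebra\<close>

lemma letter_act_cut:
  assumes x: "letter_index x \<in> {1..n - 1}" and v: "v \<in> carrier V"
  shows "letter_act n l r x v \<in> carrier V" "cut (letter_act n l r x v) = hact x (cut v)"
proof -
  have "letter_act n l r x v \<in> carrier V \<and> cut (letter_act n l r x v) = hact x (cut v)"
  proof (cases x)
    case (G k)
    then have k: "1 \<le> k" "k < n" using x n_ge_3 by auto
    then show ?thesis using G nu_cut[OF k v] by simp
  next
    case (Ginv k)
    then have k: "1 \<le> k" "k < n" using x n_ge_3 by auto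
    let ?u = "res (ginv k (cut v))"
    have H: "ginv k (cut v) \<in> H" using cut_H[OF v] by (rule ginv_H)
    have u: "?u \<in> carrier V" "cut ?u = ginv k (cut v)" using res_V[OF H] cut_res[OF H] by auto
    have "nu n l r k ?u = v"
      by (rule cut_inj[OF nu_cut(1)[OF k u(1)] v]) (simp only: nu_cut(2)[OF k u(1)] u(2) g_ginv(1)[OF k cut_H[OF v]])
    \<comment> \<open>\<open>inv_into\<close> only chooses some preimage; injectivity makes it the
      one given by \<open>ginv\<close>.\<close>
    moreover have "inj_on (nu n l r k) (carrier V)"
    proof (rule inj_onI)
      fix a b assume ab: "a \<in> carrier V" "b \<in> carrier V" "nu n l r k a = nu n l r k b"
      then have "g k (cut a) = g k (cut b)" using nu_cut(2)[OF k] by metis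
      then have "cut a = cut b" using g_ginv(2)[OF k cut_H] ab by metis
      then show "a = b" using cut_inj ab by blast
    qed
    ultimately have "letter_act n l r x v = ?u"
      using u Ginv by (simp add: inv_into_f_eq)
    then show ?thesis using u Ginv by simp
  qed
  then show "letter_act n l r x v \<in> carrier V" "cut (letter_act n l r x v) = hact x (cut v)" by auto
qed

lemma foldr_act_cut:
  assumes "letter_index ` set xs \<subseteq> {1..n - 1}" and v: "v \<in> carrier V"
  shows "foldr (letter_act n l r) xs v \<in> carrier V \<and> cut (foldr (letter_act n l r) xs v) = foldr hact xs (cut v)"
  using assms(1)
proof (induction xs)
  case (Cons x xs)
  then have "foldr (letter_act n l r) xs v \<in> carrier V" "cut (foldr (letter_act n l r) xs v) = foldr hact xs (cut v)"
    and "letter_index x \<in> {1..n - 1}" by auto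
  then show ?case using letter_act_cut[of x "foldr (letter_act n l r) xs v"] by simp
qed (simp add: v)

lemma free_act_cut:
  assumes a: "a \<in> carrier FA" and v: "v \<in> carrier V"
  shows "free_act n l r a v \<in> carrier V" "cut (free_act n l r a v) = Phi a (cut v)"
proof -
  have 1: "foldr (letter_act n l r) (letters u) v \<in> carrier V \<and> cut (foldr (letter_act n l r) (letters u) v) = wact u (cut v)"
    if "u \<in> Poly_Mapping.keys a" for u
    unfolding wact_def using foldr_act_cut[OF FA_keys[OF a that] v] .
  have 2: "Poly_Mapping.lookup a u \<odot>\<^bsub>V\<^esub> foldr (letter_act n l r) (letters u) v \<in> carrier V"
    if "u \<in> Poly_Mapping.keys a" for u
    using 1[OF that] FA_lookup[OF a] by (intro V_closed(2)) auto
  show "free_act n l r a v \<in> carrier V"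
    unfolding free_act_def using 2 by (intro V_finsum_closed) auto
  show "cut (free_act n l r a v) = Phi a (cut v)"
    unfolding free_act_def Phi_def
    by (subst cut_finsum[OF finite_keys 2], assumption) (intro sum.cong refl, simp only: cut_ops 1)
qed

text \<open>The members of a coset differ by elements of \<open>Ann\<close>, so
  \<open>the_elem\<close> is applied to a singleton.\<close>

lemma lk_rep_eq:
  assumes a: "a \<in> carrier FA" and v: "v \<in> carrier V"
  shows "lk_rep n l r (Idl\<^bsub>FA\<^esub> (bmw_relations n l r) +>\<^bsub>FA\<^esub> a) v = free_act n l r a v"
proof -
  interpret FA: ring FA by (rule ring_FA)
  let ?I = "Idl\<^bsub>FA\<^esub> (bmw_relations n l r)"
  interpret I: ideal ?I FA by (rule FA.genideal_ideal[OF relations_FA])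
  have I: "?I \<subseteq> Ann" by (rule FA.genideal_minimal[OF ideal_Ann relations_Ann])
  have "free_act n l r b v = free_act n l r a v" if b: "b \<in> ?I +>\<^bsub>FA\<^esub> a" for b
  proof -
    obtain h where h: "h \<in> ?I" "b = h + a" using b by (auto simp: a_r_coset_def' FA_simps(4))
    have hA: "h \<in> carrier FA" "Phi h (cut v) = 0" using h I cut_H[OF v] by (auto simp: Ann_def)
    have bFA: "b \<in> carrier FA" using h hA a FA_add by simp
    show ?thesis
    proof (rule cut_inj[OF free_act_cut(1)[OF bFA v] free_act_cut(1)[OF a v]])
      have "Phi b (cut v) = Phi a (cut v)" by (simp add: h(2) Phi_add hA)
      then show "cut (free_act n l r b v) = cut (free_act n l r a v)"
        by (simp only: free_act_cut(2)[OF bFA v] free_act_cut(2)[OF a v])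
    qed
  qed
  moreover have "a \<in> ?I +>\<^bsub>FA\<^esub> a" using I.a_rcos_self[OF a] .
  ultimately have "(\<lambda>b. free_act n l r b v) ` (?I +>\<^bsub>FA\<^esub> a) = {free_act n l r a v}" by blast
  then show ?thesis by (simp add: lk_rep_def)
qed

lemma carrier_bmw: "carrier (bmw n l r) = (\<lambda>a. Idl\<^bsub>FA\<^esub> (bmw_relations n l r) +>\<^bsub>FA\<^esub> a) ` carrier FA"
  by (auto simp: bmw_def FactRing_def A_RCOSETS_def')

lemma subspace_cut:
  "VectorSpace.subspace (base_ring l r) W V \<longleftrightarrow> W \<subseteq> carrier V \<and> \<zero>\<^bsub>V\<^esub> \<in> W \<and>
     (\<forall>u\<in>W. \<forall>v\<in>W. u \<oplus>\<^bsub>V\<^esub> v \<in> W) \<and> (\<forall>c\<in>base_field l r. \<forall>v\<in>W. c \<odot>\<^bsub>V\<^esub> v \<in> W)"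
  using vs_V by (auto simp: VectorSpace.subspace_def submodule_def base_ring_simps vectorspace_def)

text \<open>In one direction the coset of \<open>gen k\<close> is applied; in the other, every
  element of the algebra acts by a combination of words in \<open>g\<close> and \<open>ginv\<close>,
  and \<open>ginv k\<close> is a polynomial in \<open>g k\<close>.\<close>

lemma lk_invariant_iff: "lk_invariant n l r W \<longleftrightarrow> W \<subseteq> carrier V \<and> inv_sub (cut ` W)"
proof
  assume inv: "lk_invariant n l r W"
  then have W: "W \<subseteq> carrier V" "\<zero>\<^bsub>V\<^esub> \<in> W" "\<And>u v. u \<in> W \<Longrightarrow> v \<in> W \<Longrightarrow> u \<oplus>\<^bsub>V\<^esub> v \<in> W"
    "\<And>c v. c \<in> base_field l r \<Longrightarrow> v \<in> W \<Longrightarrow> c \<odot>\<^bsub>V\<^esub> v \<in> W"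
    by (auto simp: lk_invariant_def subspace_cut)
  have "inv_sub (cut ` W)" unfolding inv_sub_def
  proof (intro conjI)
    show "cut ` W \<subseteq> H" using W cut_H by blast
    show "0 \<in> cut ` W" using W(2) cut_ops(3) by (metis imageI)
    show "\<forall>u\<in>cut ` W. \<forall>v\<in>cut ` W. u + v \<in> cut ` W"
      unfolding ball_simps cut_ops(1)[symmetric] using W(3) by blast
    show "\<forall>c\<in>base_field l r. \<forall>v\<in>cut ` W. scl c v \<in> cut ` W"
      unfolding ball_simps cut_ops(2)[symmetric] using W(4) by blast
    show "\<forall>k\<in>{1..<n}. \<forall>v\<in>cut ` W. g k v \<in> cut ` W"
    proof (intro ballI)
      fix k u assume "k \<in> {1..<n}" "u \<in> cut ` W"
      then obtain v where v: "v \<in> W" "u = cut v" and k: "1 \<le> k" "k < n" by auto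
      have vV: "v \<in> carrier V" using v W by auto
      have "lk_rep n l r (Idl\<^bsub>FA\<^esub> (bmw_relations n l r) +>\<^bsub>FA\<^esub> gen k) v \<in> W"
        using inv v(1) FA_gens(1)[OF k] unfolding lk_invariant_def carrier_bmw by blast
      then have "free_act n l r (gen k) v \<in> W" unfolding lk_rep_eq[OF FA_gens(1)[OF k] vV] .
      moreover have "cut (free_act n l r (gen k) v) = g k u"
        using free_act_cut(2)[OF FA_gens(1)[OF k] vV] by (simp add: v Phi_basic)
      ultimately show "g k u \<in> cut ` W" by (metis imageI)
    qed
  qed
  then show "W \<subseteq> carrier V \<and> inv_sub (cut ` W)" using W by blast
next
  assume *: "W \<subseteq> carrier V \<and> inv_sub (cut ` W)"
  then have WV: "W \<subseteq> carrier V" and inv: "inv_sub (cut ` W)" by auto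
  have mem: "v \<in> W" if "v \<in> carrier V" "cut v \<in> cut ` W" for v
    using that WV cut_inj by (auto simp: image_iff) 
  have PhiW: "Phi a v \<in> cut ` W" if a: "a \<in> carrier FA" and v: "v \<in> cut ` W" for a v
  proof -
    have ginv: "ginv k u \<in> cut ` W" if u: "u \<in> cut ` W" and k: "1 \<le> k" "k < n" for k u
      unfolding ginv_def using inv_subD(5)[OF inv k u] inv_subD(5)[OF inv k inv_subD(5)[OF inv k u]] u
      by (intro inv_subD(3,4)[OF inv] inv_sub_diff[OF inv]) auto
    have fold: "foldr hact xs v \<in> cut ` W" if "letter_index ` set xs \<subseteq> {1..n - 1}" for xs
      using that
    proof (induction xs)
      case (Cons x xs)
      then show ?case using ginv inv_subD(5)[OF inv] by (cases x) auto
    qed (simp add: v)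
    have "wact u v \<in> cut ` W" if "u \<in> Poly_Mapping.keys a" for u
      unfolding wact_def using fold[OF FA_keys[OF a that]] .
    then show ?thesis unfolding Phi_def
      by (intro inv_sub_sum[OF inv] inv_subD(4)[OF inv] FA_lookup[OF a])
  qed
  have rep: "lk_rep n l r X v \<in> W" if X: "X \<in> carrier (bmw n l r)" and vW: "v \<in> W" for X v
  proof -
    obtain a where a: "a \<in> carrier FA" "X = Idl\<^bsub>FA\<^esub> (bmw_relations n l r) +>\<^bsub>FA\<^esub> a"
      using X unfolding carrier_bmw by blast
    have v: "v \<in> carrier V" using vW WV by blast
    have "Phi a (cut v) \<in> cut ` W" using vW by (intro PhiW a(1) imageI)
    then show ?thesis unfolding a(2) lk_rep_eq[OF a(1) v]
      by (intro mem[OF free_act_cut(1)[OF a(1) v]]) (simp only: free_act_cut(2)[OF a(1) v])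
  qed
  have "VectorSpace.subspace (base_ring l r) W V"
    unfolding subspace_cut
  proof (intro conjI ballI WV)
    show "\<zero>\<^bsub>V\<^esub> \<in> W" using inv_subD(2)[OF inv] by (intro mem V_closed) (simp only: cut_ops)
    show "u \<oplus>\<^bsub>V\<^esub> v \<in> W" if "u \<in> W" "v \<in> W" for u v
      using that WV inv_subD(3)[OF inv, of "cut u" "cut v"] by (intro mem V_closed) (auto simp only: cut_ops)
    show "c \<odot>\<^bsub>V\<^esub> v \<in> W" if "c \<in> base_field l r" "v \<in> W" for c v
      using that WV inv_subD(4)[OF inv, of c "cut v"] by (intro mem V_closed) (auto simp only: cut_ops)
  qed
  then show "lk_invariant n l r W" using rep by (simp add: lk_invariant_def)
qed

lemma cut_image_res: "W \<subseteq> H \<Longrightarrow> cut ` res ` W = W"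
  using cut_res by (force simp: image_iff)

lemma res_image_cut: "W \<subseteq> carrier V \<Longrightarrow> res ` cut ` W = W"
  using res_cut by (force simp: image_iff)

lemma cut_carrier: "cut ` carrier V = H"
proof
  show "cut ` carrier V \<subseteq> H" using cut_H by blast
  show "H \<subseteq> cut ` carrier V" using cut_res res_V by (metis image_eqI subsetI)
qed

lemma lk_invariant_res: "inv_sub W \<Longrightarrow> lk_invariant n l r (res ` W)"
proof -
  assume W: "inv_sub W"
  then have H: "W \<subseteq> H" using inv_subD(1) by blast
  have "res ` W \<subseteq> carrier V" using H res_V by blast
  then show ?thesis using W by (simp only: lk_invariant_iff cut_image_res[OF H] simp_thms)
qed

text \<open>The coordinates on \<open>I\<close> serve as dual basis: there the \<open>b p\<close>
  are unit vectors, which gives independence, while \<open>expand\<close> gives spanning. This form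
  fits both the trivial line and the cycles.\<close>

lemma lk_dim_basis:
  assumes W: "inv_sub W" and I: "I \<subseteq> pairs n" and b: "\<And>p. p \<in> I \<Longrightarrow> b p \<in> W"
    and delta: "\<And>p q. p \<in> I \<Longrightarrow> q \<in> I \<Longrightarrow> b p q = (if q = p then 1 else 0)"
    and expand: "\<And>v. v \<in> W \<Longrightarrow> v = (\<Sum>p\<in>I. scl (v p) (b p))"
  shows "lk_dim n l r (res ` W) = card I"
proof -
  let ?W = "res ` W" and ?K = "base_ring l r" and ?b = "\<lambda>p. res (b p)"
  let ?Vw = "V\<lparr>carrier := ?W\<rparr>"
  have WH: "W \<subseteq> H" using W inv_subD(1) by blast
  have WV: "?W \<subseteq> carrier V" using WH res_V by blast
  have finI: "finite I" using I fin_pairs finite_subset by blast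
  have "VectorSpace.subspace ?K ?W V"
    using lk_invariant_res[OF W] by (simp add: lk_invariant_def)
  then interpret Wv: vectorspace ?K ?Vw
    by (rule vectorspace.subspace_is_vs[OF vs_V])
  have fs: "cut (finsum ?Vw f X) = (\<Sum>x\<in>X. cut (f x))" if "finite X" "\<And>x. x \<in> X \<Longrightarrow> f x \<in> ?W"
    for f and X :: "(nat \<times> nat \<Rightarrow> complex) set"
    using that
  proof (induction X rule: finite_induct)
    case empty
    have "finsum ?Vw f {} = \<zero>\<^bsub>?Vw\<^esub>" by (rule Wv.M.finsum_empty)
    also have "\<dots> = \<zero>\<^bsub>V\<^esub>" by simp
    finally show ?case by (simp only: sum.empty cut_ops)
  next
    case (insert x X)
    have "finsum ?Vw f (insert x X) = f x \<oplus>\<^bsub>?Vw\<^esub> finsum ?Vw f X"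
      using insert.hyps insert.prems by (intro Wv.M.finsum_insert) auto
    then have "finsum ?Vw f (insert x X) = f x \<oplus>\<^bsub>V\<^esub> finsum ?Vw f X" by simp
    moreover have "cut (finsum ?Vw f X) = (\<Sum>x\<in>X. cut (f x))" using insert.IH insert.prems by blast
    ultimately show ?case by (simp only: cut_ops sum.insert[OF insert.hyps])
  qed
  have lc: "cut (Wv.lincomb a X) = (\<Sum>x\<in>X. scl (a x) (cut x))"
    if X: "finite X" "X \<subseteq> ?W" "a \<in> X \<rightarrow> base_field l r" for a X
  proof -
    have "a x \<odot>\<^bsub>V\<^esub> x \<in> ?W" if "x \<in> X" for x
      using Wv.smult_closed[of "a x" x] X that by (auto simp: base_ring_simps)
    then have "cut (Wv.lincomb a X) = (\<Sum>x\<in>X. cut (a x \<odot>\<^bsub>V\<^esub> x))"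
      unfolding Wv.lincomb_def by (subst fs) (use X in auto)
    then show ?thesis by (simp only: cut_ops)
  qed
  have inj: "inj_on ?b I"
  proof (rule inj_onI)
    fix p q assume pq: "p \<in> I" "q \<in> I" "?b p = ?b q"
    then have "b p = b q" using cut_res b WH by (metis subsetD)
    then show "p = q" using delta[of p p] delta[of q p] pq by (metis zero_neq_one)
  qed
  have BW: "?b ` I \<subseteq> ?W" using b by blast
  have cb: "cut (?b p) = b p" if "p \<in> I" for p using cut_res b[OF that] WH by blast
  have "Wv.basis (?b ` I)"
    unfolding Wv.basis_def
  proof (intro conjI)
    show "?b ` I \<subseteq> carrier ?Vw" using BW by simp
    show "\<not> Wv.lin_dep (?b ` I)"
    proof
      assume "Wv.lin_dep (?b ` I)"
      then obtain X a v where X: "finite X" "X \<subseteq> ?b ` I" "a \<in> X \<rightarrow> base_field l r"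
        and 0: "Wv.lincomb a X = \<zero>\<^bsub>V\<^esub>" and v: "v \<in> X" "a v \<noteq> 0"
        unfolding Wv.lin_dep_def by (auto simp: base_ring_simps)
      obtain p where p: "p \<in> I" "v = ?b p" using v X by blast
      have "(\<Sum>x\<in>X. scl (a x) (cut x)) = 0"
        using lc[of X a] X BW 0 by (simp only: cut_ops)
      then have "(\<Sum>x\<in>X. a x * cut x p) = 0"
        using sum_fun_apply[of "\<lambda>x. scl (a x) (cut x)" X p] by simp
      moreover have "(\<Sum>x\<in>X. a x * cut x p) = (\<Sum>x\<in>X. if x = v then a v else 0)"
      proof (rule sum.cong[OF refl])
        fix x assume "x \<in> X"
        then obtain q where q: "q \<in> I" "x = ?b q" using X by blast
        have "cut x p = (if p = q then 1 else 0)" using delta[OF q(1) p(1)] cb[OF q(1)] q by simp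
        moreover have "x = v \<longleftrightarrow> p = q" using inj p q by (auto dest: inj_onD)
        ultimately show "a x * cut x p = (if x = v then a v else 0)" by auto
      qed
      ultimately show False using v X(1) by simp
    qed
    show "Wv.span (?b ` I) = carrier ?Vw"
    proof
      show "Wv.span (?b ` I) \<subseteq> carrier ?Vw" using BW by (intro Wv.span_is_subset2) simp
      show "carrier ?Vw \<subseteq> Wv.span (?b ` I)"
      proof
        fix v assume "v \<in> carrier ?Vw"
        then obtain u where u: "u \<in> W" "v = res u" by auto
        define a where "a x = u (inv_into I ?b x)" for x
        have aF: "a \<in> ?b ` I \<rightarrow> base_field l r"
          unfolding a_def using H_F[of u] u WH by blast
        have "cut (Wv.lincomb a (?b ` I)) = (\<Sum>x\<in>?b ` I. scl (a x) (cut x))"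
          by (rule lc) (use finI BW aF in auto)
        also have "\<dots> = (\<Sum>p\<in>I. scl (a (?b p)) (cut (?b p)))"
          by (rule sum.reindex_cong[OF inj refl]) simp
        also have "\<dots> = (\<Sum>p\<in>I. scl (u p) (b p))"
          by (intro sum.cong refl) (simp only: cb a_def inv_into_f_f[OF inj])
        also have "\<dots> = u" by (rule expand[OF u(1), symmetric])
        finally have "cut (Wv.lincomb a (?b ` I)) = cut v" using u WH cut_res by auto
        moreover have "Wv.lincomb a (?b ` I) \<in> carrier V" "v \<in> carrier V"
          using Wv.lincomb_closed[of "?b ` I" a] BW aF WV u by (auto simp: base_ring_simps)
        ultimately have "v = Wv.lincomb a (?b ` I)" using cut_inj by metis
        then show "v \<in> Wv.span (?b ` I)"
          unfolding Wv.span_def using aF finI by (auto simp: base_ring_simps)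
      qed
    qed
  qed
  then have "Wv.dim = card (?b ` I)" using finI by (intro Wv.dim_basis) auto
  then show ?thesis by (simp add: lk_dim_def card_image[OF inj])
qed

end

section \<open>Transfer of the results to the BMW module\<close>

locale lk_main = lk_rep_space n l r + lk_generic "base_field l r" n l r for n l r
begin

lemma zero_iff:
  assumes W: "W \<subseteq> carrier V"
  shows "W = {\<zero>\<^bsub>V\<^esub>} \<longleftrightarrow> cut ` W = {0}"
proof
  assume "W = {\<zero>\<^bsub>V\<^esub>}"
  then show "cut ` W = {0}" by (simp only: image_insert image_empty cut_ops)
next
  assume *: "cut ` W = {0}"
  have "x = \<zero>\<^bsub>V\<^esub>" if x: "x \<in> W" for x
  proof (rule cut_inj)
    have "cut x \<in> {0}" using * x by blast
    then show "cut x = cut \<zero>\<^bsub>V\<^esub>" by (simp only: cut_ops singleton_iff)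
  qed (use W x V_closed(3) in auto)
  moreover have "W \<noteq> {}" using * by blast
  ultimately show "W = {\<zero>\<^bsub>V\<^esub>}" by blast
qed

lemma full_iff: "W \<subseteq> carrier V \<Longrightarrow> W = carrier V \<longleftrightarrow> cut ` W = H"
  using res_image_cut cut_carrier by (metis order_refl)

lemma irreducible_iff:
  "lk_irreducible n l r W \<longleftrightarrow> lk_invariant n l r W \<and> cut ` W \<noteq> {0} \<and>
     (\<forall>U. inv_sub U \<and> U \<subseteq> cut ` W \<longrightarrow> U = {0} \<or> U = cut ` W)"
proof (cases "lk_invariant n l r W")
  case True
  then have WV: "W \<subseteq> carrier V" by (simp add: lk_invariant_iff)
  have "(\<forall>U. lk_invariant n l r U \<and> U \<subseteq> W \<longrightarrow> U = {\<zero>\<^bsub>V\<^esub>} \<or> U = W) \<longleftrightarrow>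
      (\<forall>U. inv_sub U \<and> U \<subseteq> cut ` W \<longrightarrow> U = {0} \<or> U = cut ` W)" (is "?l \<longleftrightarrow> ?r")
  proof (intro iffI allI impI)
    fix U assume ?l and U: "inv_sub U \<and> U \<subseteq> cut ` W"
    have UH: "U \<subseteq> H" using U inv_subD(1) by blast
    have "res ` U \<subseteq> W" using U res_image_cut[OF WV] by blast
    then have "res ` U = {\<zero>\<^bsub>V\<^esub>} \<or> res ` U = W" using \<open>?l\<close> lk_invariant_res U by blast
    then have "cut ` res ` U = {0} \<or> cut ` res ` U = cut ` W"
    proof
      assume "res ` U = {\<zero>\<^bsub>V\<^esub>}"
      then have "cut ` res ` U = {0}" by (simp only: image_insert image_empty cut_ops)
      then show ?thesis ..
    qed simp
    then show "U = {0} \<or> U = cut ` W" unfolding cut_image_res[OF UH] .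
  next
    fix U assume ?r and U: "lk_invariant n l r U \<and> U \<subseteq> W"
    then have UV: "U \<subseteq> carrier V" "inv_sub (cut ` U)" by (auto simp: lk_invariant_iff)
    have "cut ` U = {0} \<or> cut ` U = cut ` W" using \<open>?r\<close> UV U by blast
    then show "U = {\<zero>\<^bsub>V\<^esub>} \<or> U = W"
    proof
      assume "cut ` U = cut ` W"
      then have "res ` cut ` U = res ` cut ` W" by (rule arg_cong)
      then show ?thesis unfolding res_image_cut[OF UV(1)] res_image_cut[OF WV] ..
    qed (simp add: zero_iff[OF UV(1)])
  qed
  then show ?thesis unfolding lk_irreducible_def using True zero_iff[OF WV] by blast
qed (simp add: lk_irreducible_def)

lemma reducible_obtains:
  assumes "lk_reducible n l r"
  obtains U where "lk_invariant n l r U" "U \<noteq> {\<zero>\<^bsub>V\<^esub>}" "U \<noteq> carrier V"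
proof -
  have inv: "lk_invariant n l r (carrier V)"
    unfolding lk_invariant_iff cut_carrier using inv_sub_H by blast
  have "w 1 2 \<in> H" using H_closed(5)[of "(1, 2)"] n_ge_3 by (simp add: pairs_def)
  moreover have "w 1 2 (1, 2) = 1" by (simp add: w_def)
  ultimately have "H \<noteq> {0}" by force
  then have "carrier V \<noteq> {\<zero>\<^bsub>V\<^esub>}" using zero_iff[of "carrier V"] cut_carrier by simp
  then obtain U where "lk_invariant n l r U" "U \<noteq> {\<zero>\<^bsub>V\<^esub>}" "U \<noteq> carrier V"
    using assms inv unfolding lk_reducible_def lk_irreducible_def by blast
  then show thesis by (rule that)
qed

lemma invariant_unique:
  assumes "lk_invariant n l r U" "U \<noteq> {\<zero>\<^bsub>V\<^esub>}" "U \<noteq> carrier V"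
    and "lk_invariant n l r W" "W \<noteq> {\<zero>\<^bsub>V\<^esub>}" "W \<noteq> carrier V"
    and ne: "\<not> (l = - (r ^ 3) \<and> r ^ (2 * n) = - 1)"
  shows "U = W"
proof -
  have U: "U \<subseteq> carrier V" "inv_sub (cut ` U)" and W: "W \<subseteq> carrier V" "inv_sub (cut ` W)"
    using assms by (auto simp: lk_invariant_iff)
  have "cut ` U = cut ` W"
    using assms zero_iff full_iff by (intro unique_proper U W ne) (simp_all add: U W)
  then show ?thesis using res_image_cut U W by metis
qed

text \<open>The two equations combine to l r^(2n) = r^3, so the trivial line is invariant. The sum
  is direct because a common vector is a trivial cycle, and \<open>cycles_simple\<close> leaves only
  0.\<close>

lemma exceptional:
  assumes l: "l = - (r ^ 3)" and z: "r ^ (2 * n) = - 1"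
  shows "\<exists>U W. lk_invariant n l r U \<and> lk_dim n l r U = 1 \<and>
           lk_irreducible n l r W \<and> lk_dim n l r W = (n - 1) * (n - 2) div 2 \<and>
           U \<inter> W = {\<zero>\<^bsub>V\<^esub>}"
proof -
  have t: "triv triv_vec" unfolding triv_vec_triv by (simp add: l z)
  define T where "T = {scl c triv_vec | c. c \<in> base_field l r}"
  have T: "inv_sub T" unfolding inv_sub_def
  proof (intro conjI ballI subsetI)
    show "v \<in> H" if "v \<in> T" for v using that triv_vec_H H_closed(4) by (auto simp: T_def)
    have "scl 0 triv_vec = 0" by (simp only: scl_simps)
    then show "0 \<in> T" unfolding T_def by force
    show "u + v \<in> T" if "u \<in> T" "v \<in> T" for u v
      using that unfolding T_def by (auto simp flip: scl_simps(3))
    show "scl c v \<in> T" if "c \<in> base_field l r" "v \<in> T" for c v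
      using that unfolding T_def by (auto simp: scl_simps)
    show "g k v \<in> T" if "k \<in> {1..<n}" "v \<in> T" for k v
      using that t unfolding T_def by (auto simp: triv_def g_linear scl_simps)
  qed
  have T1: "lk_dim n l r (res ` T) = card {(1::nat, 2::nat)}"
  proof (rule lk_dim_basis[where b = "\<lambda>p. scl (1 / r ^ 3) triv_vec", OF T])
    show "{(1, 2)} \<subseteq> pairs n" using n_ge_3 by (simp add: pairs_def)
    show "scl (1 / r ^ 3) triv_vec \<in> T" unfolding T_def by auto
    have t12: "triv_vec (1, 2) = r ^ 3" using n_ge_3 by (simp add: triv_vec_def pairs_def)
    then show "scl (1 / r ^ 3) triv_vec q = (if q = p then 1 else 0)" if "p \<in> {(1, 2)}" "q \<in> {(1, 2)}" for p q
      using that by simp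
    show "v = (\<Sum>p\<in>{(1, 2)}. scl (v p) (scl (1 / r ^ 3) triv_vec))" if "v \<in> T" for v
      using that t12 by (auto simp: T_def scl_simps)
  qed
  note cycles = cycles_simple[OF l] and cyclesi = cycles_inv[OF l]
  have cyclesH: "cycles \<subseteq> H" using inv_subD(1)[OF cyclesi] by blast
  have dimW: "lk_dim n l r (res ` cycles) = card pairs_ge_2"
    by (rule lk_dim_basis[where b = cycle_vec, OF cyclesi])
       (auto simp: cycle_vec_cycles cycle_vec_coord pairs_def intro: cycles_span[OF l], auto simp: pairs_ge_2_def)
  have irr: "lk_irreducible n l r (res ` cycles)"
    unfolding irreducible_iff cut_image_res[OF cyclesH]
    using lk_invariant_res[OF cyclesi] cycles by blast
  have "res ` T \<inter> res ` cycles = {\<zero>\<^bsub>V\<^esub>}"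
  proof
    show "res ` T \<inter> res ` cycles \<subseteq> {\<zero>\<^bsub>V\<^esub>}"
    proof
      fix x assume x: "x \<in> res ` T \<inter> res ` cycles"
      then obtain u v where u: "u \<in> T" "x = res u" and v: "v \<in> cycles" "x = res v" by blast
      have uH: "u \<in> H" "v \<in> H" using u v cyclesH inv_subD(1)[OF T] by auto
      then have uv: "u = v" using cut_res u v by metis
      obtain c where c: "u = scl c triv_vec" "c \<in> base_field l r" using u by (auto simp: T_def)
      have "triv u" using t uH c by (simp add: triv_def g_linear scl_simps mult.commute)
      then have "u = 0" using cycles(3) v uv by blast
      then have "cut x = cut \<zero>\<^bsub>V\<^esub>" using u cut_res uH by (simp only: cut_ops)
      moreover have "x \<in> carrier V" using u uH res_V by blast
      ultimately show "x \<in> {\<zero>\<^bsub>V\<^esub>}" using cut_inj V_closed(3) by blast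
    qed
    have "\<zero>\<^bsub>V\<^esub> \<in> res ` X" if "inv_sub X" for X
    proof -
      have "\<zero>\<^bsub>V\<^esub> = res 0" using res_cut[OF V_closed(3)] by (simp only: cut_ops)
      then show ?thesis using inv_subD(2)[OF that] by blast
    qed
    then show "{\<zero>\<^bsub>V\<^esub>} \<subseteq> res ` T \<inter> res ` cycles" using T cyclesi by blast
  qed
  then show ?thesis
    using lk_invariant_res[OF T] T1 irr dimW card_pairs_ge_2 by (intro exI[of _ "res ` T"] exI[of _ "res ` cycles"]) simp
qed

end

theorem theoremE:
  fixes n :: nat and l r :: complex
  assumes "n \<ge> 3"
    and "l \<noteq> 0" and "r \<noteq> 0"
    and "\<forall>k\<in>{1..n}. (r\<^sup>2) ^ k \<noteq> 1"
    and "lk_reducible n l r"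
  shows "if l = - (r ^ 3) \<and> r ^ (2 * n) = - 1
    then \<exists>U W. lk_invariant n l r U \<and> lk_dim n l r U = 1 \<and>
           lk_irreducible n l r W \<and> lk_dim n l r W = (n - 1) * (n - 2) div 2 \<and>
           U \<inter> W = {\<zero>\<^bsub>lk_space n l r\<^esub>}
    else \<exists>!W. lk_invariant n l r W \<and>
           W \<noteq> {\<zero>\<^bsub>lk_space n l r\<^esub>} \<and> W \<noteq> carrier (lk_space n l r)"
proof -
  have "r\<^sup>2 \<noteq> 1" using assms(1,4) by force
  then interpret lk_main n l r
    by unfold_locales (use assms in \<open>auto simp: base_field_closed\<close>)
  show ?thesis
  proof (cases "l = - (r ^ 3) \<and> r ^ (2 * n) = - 1")
    case True
    then show ?thesis unfolding if_P[OF True] by (intro exceptional) auto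
  next
    case False
    obtain U where U: "lk_invariant n l r U" "U \<noteq> {\<zero>\<^bsub>V\<^esub>}" "U \<noteq> carrier V"
      by (rule reducible_obtains[OF assms(5)])
    have "\<exists>!W. lk_invariant n l r W \<and> W \<noteq> {\<zero>\<^bsub>V\<^esub>} \<and> W \<noteq> carrier V"
    proof (rule ex1I[of _ U])
      fix W assume "lk_invariant n l r W \<and> W \<noteq> {\<zero>\<^bsub>V\<^esub>} \<and> W \<noteq> carrier V"
      then show "W = U" by (elim conjE) (rule invariant_unique[OF _ _ _ U False])
    qed (intro conjI U)
    then show ?thesis unfolding if_not_P[OF False] .
  qed
qed

end
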